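(* Let $\theta\in\mathbb R$. The braided Lie algebra $\mathrm{aut}_{\mathcal O(S^4_\theta)}(\mathcal O(S^7_\theta))$ of infinitesimal gauge transformations of the $\mathcal O(SU(2))$-Hopf--Galois extension $\mathcal O(S^4_\theta)\subseteq\mathcal O(S^7_\theta)$ is generated, as an $\mathcal O(S^4_\theta)$-module, by the elements $$\widetilde K_j:=\mathcal D(K_j)=K_j,\qquad \widetilde W_{\mathsf r}:=\mathcal D(W_{\mathsf r})=W_{\mathsf r}\circ e^{-\pi i\theta(r_1H_2-r_2H_1)},\qquad j=1,2,\ \mathsf r=(r_1,r_2)\in\Gamma,$$ with bracket $$[\widetilde K_1,\widetilde K_2]_{\mathsf R_{\mathsf F}}=\mathcal D([K_1,K_2]),\quad [\widetilde K_j,\widetilde W_{\mathsf r}]_{\mathsf R_{\mathsf F}}=\mathcal D([K_j,W_{\mathsf r}]),\quad [\widetilde W_{\mathsf r},\widetilde W_{\mathsf s}]_{\mathsf R_{\mathsf F}}=e^{-i\pi\theta\,\mathsf r\wedge\mathsf s}\,\mathcal D([W_{\mathsf r},W_{\mathsf s}]),$$ where $\mathsf r\wedge\mathsf s=r_1s_2-r_2s_1$. The braided Lie bracket of generic elements is given, for $\widetilde X,\widetilde X'\in\mathrm{aut}_{\mathcal O(S^4_\theta)}(\mathcal O(S^7_\theta))$ and $b,b'\in\mathcal O(S^4_\theta)$, by $$[b\bullet_\theta\widetilde X,\,b'\bullet_\theta\widetilde X']_{\mathsf R_{\mathsf F}}=b\bullet_\theta(\mathsf R_{\mathsf F\,\alpha}\triangleright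 b')\bullet_\theta[\mathsf R_{\mathsf F}{}^\alpha\triangleright\widetilde X,\widetilde X']_{\mathsf R_{\mathsf F}},$$ with $\mathcal O(S^4_\theta)$-module structure $(b\bullet_\theta\widetilde X)(a)=b\bullet_\theta\widetilde X(a)$.
   Context: Ground field $\mathbb C$. $\mathcal O(S^7)$ is the commutative algebra generated by $z_\mu,z_\mu^*$ ($\mu=1,\dots,4$) with $\sum_\mu z_\mu z_\mu^*=1$. Right $\mathcal O(SU(2))$-coaction $\delta$ (an algebra map): right matrix multiplication of the $4\times2$ matrix with rows $(z_1,-z_2^* ),(z_2,z_1^* ),(z_3,-z_4^* ),(z_4,z_3^* )$ by the defining matrix $\begin{pmatrix}w_1&-w_2^*\\ w_2&w_1^*\end{pmatrix}$ of $SU(2)$. The coinvariants form $\mathcal O(S^4)\subset\mathcal O(S^7)$, generated by $\alpha=2(z_1z_3^*+z_2^*z_4)$, $\beta=2(z_2z_3^*-z_1^*z_4)$, $\alpha^*,\beta^*$, $x=z_1z_1^*+z_2z_2^*-z_3z_3^*-z_4z_4^*$, with $\alpha\alpha^*+\beta\beta^*+x^2=1$; this is a Hopf--Galois extension. With $\partial_\mu(z_\nu)=\delta_{\mu\nu}=\partial^*_\mu(z^*_\nu)$, $\partial_\mu(z_\nu^* )=0=\partial_\mu^*(z_\nu)$, define the derivations of $\mathcal O(S^7)$: $H_1=\frac12(z_1\partial_1-z_1^*\partial_1^*-z_2\partial_2+z_2^*\partial_2^*-z_3\partial_3+z_3^*\partial_3^*+z_4\partial_4-z_4^*\partial_4^*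 )$, $H_2=\frac12(-z_1\partial_1+z_1^*\partial_1^*+z_2\partial_2-z_2^*\partial_2^*-z_3\partial_3+z_3^*\partial_3^*+z_4\partial_4-z_4^*\partial_4^* )$, $E_{10}=\frac1{\sqrt2}(z_1\partial_3-z_3^*\partial_1^*-z_4\partial_2+z_2^*\partial_4^* )$, $E_{-10}=\frac1{\sqrt2}(z_3\partial_1-z_1^*\partial_3^*-z_2\partial_4+z_4^*\partial_2^* )$, $E_{01}=\frac1{\sqrt2}(z_2\partial_3-z_3^*\partial_2^*+z_4\partial_1-z_1^*\partial_4^* )$, $E_{0-1}=\frac1{\sqrt2}(z_1\partial_4-z_4^*\partial_1^*+z_3\partial_2-z_2^*\partial_3^* )$, $E_{11}=-z_4\partial_3+z_3^*\partial_4^*$, $E_{-1-1}=z_4^*\partial_3^*-z_3\partial_4$, $E_{1-1}=-z_1\partial_2+z_2^*\partial_1^*$, $E_{-11}=-z_2\partial_1+z_1^*\partial_2^*$. Let $\Gamma=\{(\pm1,0),(0,\pm1),(\pm1,\pm1)\}$ (all eight roots) and $K_1=2xH_2+\sqrt2\beta^*E_{01}+\sqrt2\beta E_{0-1}$, $K_2=2xH_1+\sqrt2\alpha^*E_{10}+\sqrt2\alpha E_{-10}$, $W_{01}=\sqrt2(\beta H_1+\alpha^*E_{11}+\alpha E_{-11})$, $W_{0-1}=\sqrt2(\beta^*H_1+\alpha^*E_{1-1}+\alpha E_{-1-1})$, $W_{10}=\sqrt2(\alpha H_2-\beta^*E_{11}+\beta E_{1-1})$, $W_{-10}=\sqrt2(\alpha^*H_2+\beta^*E_{-11}-\beta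 E_{-1-1})$, $W_{11}=2xE_{11}+\sqrt2\alpha E_{01}-\sqrt2\beta E_{10}$, $W_{-1-1}=2xE_{-1-1}+\sqrt2\alpha^*E_{0-1}-\sqrt2\beta^*E_{-10}$, $W_{1-1}=-2xE_{1-1}+\sqrt2\beta^*E_{10}+\sqrt2\alpha E_{0-1}$, $W_{-11}=-2xE_{-11}+\sqrt2\beta E_{-10}+\sqrt2\alpha^*E_{01}$. These generate, as an $\mathcal O(S^4)$-module, the Lie algebra $\mathrm{aut}_{\mathcal O(S^4)}(\mathcal O(S^7))$ of derivations of $\mathcal O(S^7)$ that commute with the coaction and vanish on $\mathcal O(S^4)$; $[\ ,\ ]$ is its commutator. Twisting. $K$ is the universal enveloping algebra of the abelian Lie algebra spanned by $H_1,H_2$, acting on $\mathcal O(S^7)$ by the derivations $H_1=\frac12(z_1\partial_1-z_1^*\partial_1^*-z_2\partial_2+z_2^*\partial_2^*-z_3\partial_3+z_3^*\partial_3^*+z_4\partial_4-z_4^*\partial_4^* )$ and $H_2=\frac12(-z_1\partial_1+z_1^*\partial_1^*+z_2\partial_2-z_2^*\partial_2^*-z_3\partial_3+z_3^*\partial_3^*+z_4\partial_4-z_4^*\partial_4^* )$, and on linear maps $\psi$ of $\mathcal O(S^7)$ by $H_j\triangleright\psi=[H_j,\psi]$; in particular $H_j\triangleright K_l=0$, $H_j\triangleright W_{\mathsf r}=r_jW_{\mathsf r}$. The twist is $\mathsf F=e^{\pi i\theta(H_1\otimes H_2-H_2\otimes H_1)}$, inverse $\bar{\mathsf F}=\bar{\mathsf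 F}^\alpha\otimes\bar{\mathsf F}_\alpha$. $\mathcal O(S^7_\theta)$ and $\mathcal O(S^4_\theta)$ are the vector spaces $\mathcal O(S^7)$, $\mathcal O(S^4)$ with product $a\bullet_\theta a'=(\bar{\mathsf F}^\alpha\triangleright a)(\bar{\mathsf F}_\alpha\triangleright a')$, i.e. $a\bullet_\theta a'=e^{-\pi i\theta\,\mathsf s\wedge\mathsf m}aa'$ when $H_ja=s_ja$, $H_ja'=m_ja'$; the coaction is unchanged. $K_{\mathsf F}$ (which equals $K$ as Hopf algebra) is triangular with $\mathsf R_{\mathsf F}=\mathsf F_{21}\bar{\mathsf F}=\bar{\mathsf F}^2=\mathsf R_{\mathsf F}{}^\alpha\otimes\mathsf R_{\mathsf F\,\alpha}$ (sums understood); exponentials act on weight vectors by scalars. $\mathrm{aut}_{\mathcal O(S^4_\theta)}(\mathcal O(S^7_\theta))$ is the space of linear maps $u:\mathcal O(S^7_\theta)\to\mathcal O(S^7_\theta)$ with $\delta\circ u=(u\otimes\mathrm{id})\circ\delta$, $u(a\bullet_\theta a')=u(a)\bullet_\theta a'+(\mathsf R_{\mathsf F\,\alpha}\triangleright a)\bullet_\theta(\mathsf R_{\mathsf F}{}^\alpha\triangleright u)(a')$, and $u(b)=0$ for $b\in\mathcal O(S^4_\theta)$, with bracket $[u,u']_{\mathsf R_{\mathsf F}}=u\circ u'-(\mathsf R_{\mathsf F\,\alpha}\triangleright u')\circ(\mathsf R_{\mathsf F}{}^\alpha\triangleright u)$. The map $\mathcal D$ is $\mathcal D(u)(a)=(\bar{\mathsf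 F}^\alpha\triangleright u)(\bar{\mathsf F}_\alpha\triangleright a)$. *)

theory Defs
  imports
    Complex_Main
    "HOL-Library.Poly_Mapping"
    "HOL-Library.Product_Plus"
    "HOL-Library.Numeral_Type"
begin

section \<open>Commutative algebras over the complex numbers\<close>

class comm_complex_algebra = comm_ring + comm_monoid_mult +
  fixes scaleC :: "complex \<Rightarrow> 'a \<Rightarrow> 'a" (infixr "*\<^sub>C" 75)
  assumes scaleC_add_right: "c *\<^sub>C (x + y) = c *\<^sub>C x + c *\<^sub>C y"
    and scaleC_add_left: "(c + d) *\<^sub>C x = c *\<^sub>C x + d *\<^sub>C x"
    and scaleC_scaleC: "c *\<^sub>C (d *\<^sub>C x) = (c * d) *\<^sub>C x"
    and scaleC_one: "1 *\<^sub>C x = x"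
    and mult_scaleC_left: "(c *\<^sub>C x) * y = c *\<^sub>C (x * y)"

interpretation complex_algebra: vector_space "scaleC :: complex \<Rightarrow> 'a::comm_complex_algebra \<Rightarrow> 'a"
  by unfold_locales (simp_all add: scaleC_add_right scaleC_add_left scaleC_scaleC scaleC_one)

definition clinear :: "('a::comm_complex_algebra \<Rightarrow> 'b::comm_complex_algebra) \<Rightarrow> bool" where
  "clinear f \<longleftrightarrow> Vector_Spaces.linear scaleC scaleC f"

definition algebra_map :: "('a::comm_complex_algebra \<Rightarrow> 'b::comm_complex_algebra) \<Rightarrow> bool" where
  "algebra_map f \<longleftrightarrow> clinear f \<and> f 1 = 1 \<and> (\<forall>a b. f (a * b) = f a * f b)"

definition derivation :: "('a::comm_complex_algebra \<Rightarrow> 'a) \<Rightarrow> bool" where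
  "derivation d \<longleftrightarrow> clinear d \<and> (\<forall>a b. d (a * b) = d a * b + a * d b)"

section \<open>Coordinate algebras of spheres\<close>

text \<open>The indeterminates \<open>z\<^sub>i\<close> and \<open>z\<^sub>i\<^sup>*\<close>. Polynomials in them are finitely supported functions
  from monomials (finitely supported functions from indeterminates to exponents) to coefficients.\<close>

datatype 'n gen = Z 'n | Zs 'n

type_synonym 'n sphere_poly = "('n gen \<Rightarrow>\<^sub>0 nat) \<Rightarrow>\<^sub>0 complex"

definition Var :: "'n gen \<Rightarrow> 'n sphere_poly" where
  "Var g = Poly_Mapping.single (Poly_Mapping.single g 1) 1"

definition sphere_relator :: "'n::finite sphere_poly" where
  "sphere_relator = (\<Sum>i\<in>UNIV. Var (Z i) * Var (Zs i)) - 1"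

definition sphere_eq :: "'n::finite sphere_poly \<Rightarrow> 'n sphere_poly \<Rightarrow> bool" where
  "sphere_eq p q \<longleftrightarrow> sphere_relator dvd (p - q)"

lemma equivp_sphere_eq: "equivp (sphere_eq :: 'n::finite sphere_poly \<Rightarrow> _)" (is "equivp ?R")
proof (rule equivpI)
  show "reflp ?R" by (auto simp: reflp_def sphere_eq_def)
  show "symp ?R"
    by (rule sympI) (metis sphere_eq_def dvd_minus_iff minus_diff_eq)
  show "transp ?R"
  proof (rule transpI)
    fix x y z :: "'n sphere_poly"
    assume "sphere_eq x y" "sphere_eq y z"
    then have "sphere_relator dvd ((x - y) + (y - z))"
      unfolding sphere_eq_def by (rule dvd_add)
    then show "sphere_eq x z" by (simp add: sphere_eq_def)
  qed
qed

text \<open>For \<open>CARD('n) = N\<close> this is the commutative algebra generated by \<open>z\<^sub>i, z\<^sub>i\<^sup>*\<close> with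
  \<open>\<Sum>\<^sub>i z\<^sub>i z\<^sub>i\<^sup>* = 1\<close>, that is, the coordinate algebra of the sphere of dimension \<open>2N - 1\<close>.\<close>

quotient_type 'n sphere_alg = "'n::finite sphere_poly" / sphere_eq
  by (rule equivp_sphere_eq)

instantiation sphere_alg :: (finite) comm_complex_algebra
begin

lift_definition zero_sphere_alg :: "'a sphere_alg" is 0 .
lift_definition one_sphere_alg :: "'a sphere_alg" is 1 .

lift_definition plus_sphere_alg :: "'a sphere_alg \<Rightarrow> 'a sphere_alg \<Rightarrow> 'a sphere_alg" is "(+)"
  unfolding sphere_eq_def by (metis add_diff_add dvd_add)

lift_definition uminus_sphere_alg :: "'a sphere_alg \<Rightarrow> 'a sphere_alg" is uminus
  unfolding sphere_eq_def by (metis dvd_minus_iff minus_diff_minus)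

lift_definition minus_sphere_alg :: "'a sphere_alg \<Rightarrow> 'a sphere_alg \<Rightarrow> 'a sphere_alg" is "(-)"
  unfolding sphere_eq_def
proof -
  fix p p' q q' :: "'a sphere_poly"
  assume "sphere_relator dvd p - p'" "sphere_relator dvd q - q'"
  then have "sphere_relator dvd (p - p') - (q - q')" by (rule dvd_diff)
  then show "sphere_relator dvd p - q - (p' - q')" by (simp add: algebra_simps)
qed

lift_definition times_sphere_alg :: "'a sphere_alg \<Rightarrow> 'a sphere_alg \<Rightarrow> 'a sphere_alg" is "(*)"
  unfolding sphere_eq_def
proof -
  fix p p' q q' :: "'a sphere_poly"
  assume "sphere_relator dvd p - p'" "sphere_relator dvd q - q'"
  then have "sphere_relator dvd (p - p') * q + p' * (q - q')" by simp
  then show "sphere_relator dvd p * q - p' * q'" by (simp add: algebra_simps)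
qed

lift_definition scaleC_sphere_alg :: "complex \<Rightarrow> 'a sphere_alg \<Rightarrow> 'a sphere_alg"
  is "\<lambda>c p. Poly_Mapping.single 0 c * p"
  unfolding sphere_eq_def by (metis dvd_mult right_diff_distrib)

instance
proof
  fix a b c :: "'a sphere_alg" and k l :: complex
  show "a + b + c = a + (b + c)" "a + b = b + a" "0 + a = a" "- a + a = 0" "a - b = a + - b"
    "a * b * c = a * (b * c)" "a * b = b * a" "1 * a = a" "(a + b) * c = a * c + b * c"
    by (transfer, simp add: algebra_simps equivp_reflp[OF equivp_sphere_eq])+
  show "k *\<^sub>C (a + b) = k *\<^sub>C a + k *\<^sub>C b" "k *\<^sub>C (l *\<^sub>C a) = (k * l) *\<^sub>C a"
    "(k + l) *\<^sub>C a = k *\<^sub>C a + l *\<^sub>C a" "1 *\<^sub>C a = a" "(k *\<^sub>C a) * b = k *\<^sub>C (a * b)"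
    by (transfer, simp add: algebra_simps mult_single single_add flip: mult.assoc single_one,
        simp add: equivp_reflp[OF equivp_sphere_eq])+
qed

end


section \<open>Tensor products of algebras\<close>

text \<open>The monoid algebra of the multiplicative monoid \<open>A \<times> B\<close>, divided by the ideal generated by the
  bilinearity relations, is \<open>A \<otimes> B\<close> with \<open>(a \<otimes> b)(a' \<otimes> b') = aa' \<otimes> bb'\<close>. Monomials of a monoid
  algebra are written additively, so the componentwise multiplication of pairs becomes a sum.\<close>

datatype ('a, 'b) mpair = MPair 'a 'b

instantiation mpair :: (comm_monoid_mult, comm_monoid_mult) comm_monoid_add
begin

definition zero_mpair :: "('a, 'b) mpair" where
  "zero_mpair = MPair 1 1"

fun plus_mpair :: "('a, 'b) mpair \<Rightarrow> ('a, 'b) mpair \<Rightarrow> ('a, 'b) mpair" where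
  "MPair a b + MPair a' b' = MPair (a * a') (b * b')"

instance
proof
  fix p q r :: "('a, 'b) mpair"
  show "p + q + r = p + (q + r)" "p + q = q + p" "0 + p = p"
    by (cases p; cases q; cases r; simp add: zero_mpair_def ac_simps)+
qed

end

type_synonym ('a, 'b) formal_tensor = "('a, 'b) mpair \<Rightarrow>\<^sub>0 complex"

definition ftens :: "'a \<Rightarrow> 'b \<Rightarrow> ('a, 'b) formal_tensor" where
  "ftens a b = Poly_Mapping.single (MPair a b) 1"

definition tensor_relators ::
    "('a::comm_complex_algebra, 'b::comm_complex_algebra) formal_tensor set" where
  "tensor_relators =
     {ftens (a + a') b - ftens a b - ftens a' b | a a' b. True} \<union>
     {ftens a (b + b') - ftens a b - ftens a b' | a b b'. True} \<union>
     {ftens (c *\<^sub>C a) b - Poly_Mapping.single 0 c * ftens a b | c a b. True} \<union>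
     {ftens a (c *\<^sub>C b) - Poly_Mapping.single 0 c * ftens a b | c a b. True}"

text \<open>A commutative ring is a module over itself by multiplication; the span of a set in this
  module is the ideal generated by the set.\<close>

interpretation ring_module: module "(*) :: 'a::comm_ring_1 \<Rightarrow> 'a \<Rightarrow> 'a"
  by unfold_locales (simp_all add: algebra_simps)

definition tensor_eq ::
    "('a::comm_complex_algebra, 'b::comm_complex_algebra) formal_tensor \<Rightarrow> ('a, 'b) formal_tensor \<Rightarrow> bool"
  where "tensor_eq p q \<longleftrightarrow> p - q \<in> ring_module.span tensor_relators"

lemma equivp_tensor_eq:
  "equivp (tensor_eq :: ('a::comm_complex_algebra, 'b::comm_complex_algebra) formal_tensor \<Rightarrow> _)"
  (is "equivp ?R")
proof (rule equivpI)
  show "reflp ?R" by (simp add: reflp_def tensor_eq_def ring_module.span_zero)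
  show "symp ?R"
  proof (rule sympI)
    fix x y :: "('a, 'b) formal_tensor"
    assume "tensor_eq x y"
    then have "- (x - y) \<in> ring_module.span tensor_relators"
      unfolding tensor_eq_def by (rule ring_module.span_neg)
    then show "tensor_eq y x" by (simp add: tensor_eq_def)
  qed
  show "transp ?R"
  proof (rule transpI)
    fix x y z :: "('a, 'b) formal_tensor"
    assume "tensor_eq x y" "tensor_eq y z"
    then have "(x - y) + (y - z) \<in> ring_module.span tensor_relators"
      unfolding tensor_eq_def by (rule ring_module.span_add)
    then show "tensor_eq x z" by (simp add: tensor_eq_def)
  qed
qed

quotient_type (overloaded) ('a, 'b) tensor =
  "('a::comm_complex_algebra, 'b::comm_complex_algebra) formal_tensor" / tensor_eq
  by (rule equivp_tensor_eq)

instantiation tensor :: (comm_complex_algebra, comm_complex_algebra) comm_complex_algebra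
begin

lift_definition zero_tensor :: "('a, 'b) tensor" is 0 .
lift_definition one_tensor :: "('a, 'b) tensor" is 1 .

lift_definition plus_tensor :: "('a, 'b) tensor \<Rightarrow> ('a, 'b) tensor \<Rightarrow> ('a, 'b) tensor" is "(+)"
  unfolding tensor_eq_def
proof -
  fix p p' q q' :: "('a, 'b) formal_tensor"
  assume "p - p' \<in> ring_module.span tensor_relators" "q - q' \<in> ring_module.span tensor_relators"
  then have "(p - p') + (q - q') \<in> ring_module.span tensor_relators"
    by (rule ring_module.span_add)
  then show "p + q - (p' + q') \<in> ring_module.span tensor_relators" by (simp add: algebra_simps)
qed

lift_definition uminus_tensor :: "('a, 'b) tensor \<Rightarrow> ('a, 'b) tensor" is uminus
  unfolding tensor_eq_def
proof -
  fix p q :: "('a, 'b) formal_tensor"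
  assume "p - q \<in> ring_module.span tensor_relators"
  then have "- (p - q) \<in> ring_module.span tensor_relators"
    by (rule ring_module.span_neg)
  then show "- p - - q \<in> ring_module.span tensor_relators" by simp
qed

lift_definition minus_tensor :: "('a, 'b) tensor \<Rightarrow> ('a, 'b) tensor \<Rightarrow> ('a, 'b) tensor" is "(-)"
  unfolding tensor_eq_def
proof -
  fix p p' q q' :: "('a, 'b) formal_tensor"
  assume "p - p' \<in> ring_module.span tensor_relators" "q - q' \<in> ring_module.span tensor_relators"
  then have "(p - p') - (q - q') \<in> ring_module.span tensor_relators"
    by (rule ring_module.span_diff)
  then show "p - q - (p' - q') \<in> ring_module.span tensor_relators" by (simp add: algebra_simps)
qed

lift_definition times_tensor :: "('a, 'b) tensor \<Rightarrow> ('a, 'b) tensor \<Rightarrow> ('a, 'b) tensor" is "(*)"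
  unfolding tensor_eq_def
proof -
  fix p p' q q' :: "('a, 'b) formal_tensor"
  assume "p - p' \<in> ring_module.span tensor_relators" "q - q' \<in> ring_module.span tensor_relators"
  then have "q * (p - p') + p' * (q - q') \<in> ring_module.span tensor_relators"
    by (intro ring_module.span_add ring_module.span_scale)
  then show "p * q - p' * q' \<in> ring_module.span tensor_relators" by (simp add: algebra_simps)
qed

lift_definition scaleC_tensor :: "complex \<Rightarrow> ('a, 'b) tensor \<Rightarrow> ('a, 'b) tensor"
  is "\<lambda>c p. Poly_Mapping.single 0 c * p"
  unfolding tensor_eq_def
proof -
  fix c :: complex and p q :: "('a, 'b) formal_tensor"
  assume "p - q \<in> ring_module.span tensor_relators"
  then have "Poly_Mapping.single 0 c * (p - q) \<in> ring_module.span tensor_relators"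
    by (rule ring_module.span_scale)
  then show "Poly_Mapping.single 0 c * p - Poly_Mapping.single 0 c * q
      \<in> ring_module.span tensor_relators"
    by (simp add: right_diff_distrib)
qed

instance
proof
  have eqI: "tensor_eq p q" if "p = q" for p q :: "('a, 'b) formal_tensor"
    unfolding that by (rule equivp_reflp[OF equivp_tensor_eq])
  fix a b c :: "('a, 'b) tensor" and k l :: complex
  show "a + b + c = a + (b + c)" by (transfer, rule eqI, rule add.assoc)
  show "a + b = b + a" by (transfer, rule eqI, rule add.commute)
  show "0 + a = a" by (transfer, rule eqI, rule add_0)
  show "- a + a = 0" by (transfer, rule eqI, rule left_minus)
  show "a - b = a + - b" by (transfer, rule eqI, rule diff_conv_add_uminus)
  show "a * b * c = a * (b * c)" by (transfer, rule eqI, rule mult.assoc)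
  show "a * b = b * a" by (transfer, rule eqI, rule mult.commute)
  show "1 * a = a" by (transfer, rule eqI, rule mult_1)
  show "(a + b) * c = a * c + b * c" by (transfer, rule eqI, rule distrib_right)
  show "k *\<^sub>C (a + b) = k *\<^sub>C a + k *\<^sub>C b" by (transfer, rule eqI, rule distrib_left)
  show "k *\<^sub>C (l *\<^sub>C a) = (k * l) *\<^sub>C a"
    by (transfer, rule eqI) (simp only: mult_single add_0 flip: mult.assoc)
  show "(k + l) *\<^sub>C a = k *\<^sub>C a + l *\<^sub>C a"
    by (transfer, rule eqI) (simp only: single_add distrib_right)
  show "1 *\<^sub>C a = a" by (transfer, rule eqI) (simp only: single_one mult_1)
  show "(k *\<^sub>C a) * b = k *\<^sub>C (a * b)" by (transfer, rule eqI, rule mult.assoc)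
qed

end

lift_definition tens :: "'a \<Rightarrow> 'b \<Rightarrow> ('a::comm_complex_algebra, 'b::comm_complex_algebra) tensor"
    (infix "\<otimes>\<^sub>C" 75) is ftens .

definition tensor_map :: "('a \<Rightarrow> 'c) \<Rightarrow> ('b \<Rightarrow> 'd) \<Rightarrow>
    ('a::comm_complex_algebra, 'b::comm_complex_algebra) tensor \<Rightarrow>
    ('c::comm_complex_algebra, 'd::comm_complex_algebra) tensor" where
  "tensor_map f g = (THE h. clinear h \<and> (\<forall>a b. h (a \<otimes>\<^sub>C b) = f a \<otimes>\<^sub>C g b))"

section \<open>The Hopf-Galois extension before twisting\<close>

lift_definition coord :: "'n::finite gen \<Rightarrow> 'n sphere_alg" is Var .

abbreviation zz :: "'n::finite \<Rightarrow> 'n sphere_alg" where "zz i \<equiv> coord (Z i)"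
abbreviation zs :: "'n::finite \<Rightarrow> 'n sphere_alg" where "zs i \<equiv> coord (Zs i)"

text \<open>In the numeral type \<open>4\<close> the index \<open>4\<close> equals \<open>0\<close>, so that the four indices are \<open>1, 2, 3, 4\<close>;
  likewise for \<open>2\<close>. The generators of \<open>O(SU(2))\<close> are \<open>w\<^sub>i = zz i\<close> and \<open>w\<^sub>i\<^sup>* = zs i\<close> at index type \<open>2\<close>:
  the relation \<open>w\<^sub>1 w\<^sub>1\<^sup>* + w\<^sub>2 w\<^sub>2\<^sup>* = 1\<close> says that the defining matrix has determinant one.\<close>

type_synonym OS7 = "4 sphere_alg"
type_synonym OSU2 = "2 sphere_alg"

definition zmat :: "OS7 list list" where
  "zmat = [[zz 1, - zs 2], [zz 2, zs 1], [zz 3, - zs 4], [zz 4, zs 3]]"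

definition wmat :: "OSU2 list list" where
  "wmat = [[zz 1, - zs 2], [zz 2, zs 1]]"

definition coaction :: "OS7 \<Rightarrow> (OS7, OSU2) tensor" where
  "coaction = (THE d. algebra_map d \<and>
     (\<forall>i<4. \<forall>j<2. d (zmat ! i ! j) = (\<Sum>k<2. (zmat ! i ! k) \<otimes>\<^sub>C (wmat ! k ! j))))"

definition OS4 :: "OS7 set" where
  "OS4 = {b. coaction b = b \<otimes>\<^sub>C 1}"

text \<open>\<open>vector_field v\<close> is the derivation \<open>\<Sum>\<^sub>\<mu> (v(z\<^sub>\<mu>) \<partial>\<^sub>\<mu> + v(z\<^sub>\<mu>\<^sup>*) \<partial>\<^sub>\<mu>\<^sup>*)\<close>. It is only meaningful when this
  derivation of the polynomial algebra respects the sphere relation, as it does in all uses below.\<close>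

definition vector_field :: "(4 gen \<Rightarrow> OS7) \<Rightarrow> OS7 \<Rightarrow> OS7" where
  "vector_field v = (THE d. derivation d \<and> (\<forall>g. d (coord g) = v g))"

abbreviation rt2 :: complex where "rt2 \<equiv> complex_of_real (sqrt 2)"

definition H1 :: "OS7 \<Rightarrow> OS7" where
  "H1 = (\<lambda>a. (1/2) *\<^sub>C vector_field ((\<lambda>_. 0)
     (Z 1 := zz 1, Zs 1 := - zs 1, Z 2 := - zz 2, Zs 2 := zs 2,
      Z 3 := - zz 3, Zs 3 := zs 3, Z 4 := zz 4, Zs 4 := - zs 4)) a)"

definition H2 :: "OS7 \<Rightarrow> OS7" where
  "H2 = (\<lambda>a. (1/2) *\<^sub>C vector_field ((\<lambda>_. 0)
     (Z 1 := - zz 1, Zs 1 := zs 1, Z 2 := zz 2, Zs 2 := - zs 2,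
      Z 3 := - zz 3, Zs 3 := zs 3, Z 4 := zz 4, Zs 4 := - zs 4)) a)"

text \<open>In names, \<open>m\<close> stands for the minus sign of the index that follows it.\<close>

definition E_1_0 :: "OS7 \<Rightarrow> OS7" where
  "E_1_0 = (\<lambda>a. (1/rt2) *\<^sub>C vector_field ((\<lambda>_. 0)
     (Z 3 := zz 1, Zs 1 := - zs 3, Z 2 := - zz 4, Zs 4 := zs 2)) a)"

definition E_m1_0 :: "OS7 \<Rightarrow> OS7" where
  "E_m1_0 = (\<lambda>a. (1/rt2) *\<^sub>C vector_field ((\<lambda>_. 0)
     (Z 1 := zz 3, Zs 3 := - zs 1, Z 4 := - zz 2, Zs 2 := zs 4)) a)"

definition E_0_1 :: "OS7 \<Rightarrow> OS7" where
  "E_0_1 = (\<lambda>a. (1/rt2) *\<^sub>C vector_field ((\<lambda>_. 0)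
     (Z 3 := zz 2, Zs 2 := - zs 3, Z 1 := zz 4, Zs 4 := - zs 1)) a)"

definition E_0_m1 :: "OS7 \<Rightarrow> OS7" where
  "E_0_m1 = (\<lambda>a. (1/rt2) *\<^sub>C vector_field ((\<lambda>_. 0)
     (Z 4 := zz 1, Zs 1 := - zs 4, Z 2 := zz 3, Zs 3 := - zs 2)) a)"

definition E_1_1 :: "OS7 \<Rightarrow> OS7" where
  "E_1_1 = vector_field ((\<lambda>_. 0)(Z 3 := - zz 4, Zs 4 := zs 3))"

definition E_m1_m1 :: "OS7 \<Rightarrow> OS7" where
  "E_m1_m1 = vector_field ((\<lambda>_. 0)(Zs 3 := zs 4, Z 4 := - zz 3))"

definition E_1_m1 :: "OS7 \<Rightarrow> OS7" where
  "E_1_m1 = vector_field ((\<lambda>_. 0)(Z 2 := - zz 1, Zs 1 := zs 2))"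

definition E_m1_1 :: "OS7 \<Rightarrow> OS7" where
  "E_m1_1 = vector_field ((\<lambda>_. 0)(Z 1 := - zz 2, Zs 2 := zs 1))"

text \<open>The generators of the subalgebra \<open>OS4\<close>; a final \<open>s\<close> stands for the star.\<close>

definition al :: OS7 where "al = 2 *\<^sub>C (zz 1 * zs 3 + zs 2 * zz 4)"
definition als :: OS7 where "als = 2 *\<^sub>C (zs 1 * zz 3 + zz 2 * zs 4)"
definition be :: OS7 where "be = 2 *\<^sub>C (zz 2 * zs 3 - zs 1 * zz 4)"
definition bes :: OS7 where "bes = 2 *\<^sub>C (zs 2 * zz 3 - zz 1 * zs 4)"
definition xx :: OS7 where "xx = zz 1 * zs 1 + zz 2 * zs 2 - zz 3 * zs 3 - zz 4 * zs 4"

type_synonym weight = "real \<times> real"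

definition Roots :: "weight set" where
  "Roots = {(1, 0), (-1, 0), (0, 1), (0, -1), (1, 1), (1, -1), (-1, 1), (-1, -1)}"

definition K :: "nat \<Rightarrow> OS7 \<Rightarrow> OS7" where
  "K j = (\<lambda>a.
     if j = 1 then (2 *\<^sub>C xx) * H2 a + (rt2 *\<^sub>C bes) * E_0_1 a + (rt2 *\<^sub>C be) * E_0_m1 a
     else if j = 2 then (2 *\<^sub>C xx) * H1 a + (rt2 *\<^sub>C als) * E_1_0 a + (rt2 *\<^sub>C al) * E_m1_0 a
     else 0)"

definition W :: "weight \<Rightarrow> OS7 \<Rightarrow> OS7" where
  "W r = (\<lambda>a.
     if r = (0, 1) then rt2 *\<^sub>C (be * H1 a + als * E_1_1 a + al * E_m1_1 a)
     else if r = (0, -1) then rt2 *\<^sub>C (bes * H1 a + als * E_1_m1 a + al * E_m1_m1 a)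
     else if r = (1, 0) then rt2 *\<^sub>C (al * H2 a - bes * E_1_1 a + be * E_1_m1 a)
     else if r = (-1, 0) then rt2 *\<^sub>C (als * H2 a + bes * E_m1_1 a - be * E_m1_m1 a)
     else if r = (1, 1) then (2 *\<^sub>C xx) * E_1_1 a + (rt2 *\<^sub>C al) * E_0_1 a - (rt2 *\<^sub>C be) * E_1_0 a
     else if r = (-1, -1) then
       (2 *\<^sub>C xx) * E_m1_m1 a + (rt2 *\<^sub>C als) * E_0_m1 a - (rt2 *\<^sub>C bes) * E_m1_0 a
     else if r = (1, -1) then
       - ((2 *\<^sub>C xx) * E_1_m1 a) + (rt2 *\<^sub>C bes) * E_1_0 a + (rt2 *\<^sub>C al) * E_0_m1 a
     else if r = (-1, 1) then
       - ((2 *\<^sub>C xx) * E_m1_1 a) + (rt2 *\<^sub>C be) * E_m1_0 a + (rt2 *\<^sub>C als) * E_0_1 a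
     else 0)"

definition commutator :: "(OS7 \<Rightarrow> OS7) \<Rightarrow> (OS7 \<Rightarrow> OS7) \<Rightarrow> OS7 \<Rightarrow> OS7" where
  "commutator u v = (\<lambda>a. u (v a) - v (u a))"

section \<open>Weights and the twist\<close>

definition weight_space :: "weight \<Rightarrow> OS7 set" where
  "weight_space m = {a. H1 a = of_real (fst m) *\<^sub>C a \<and> H2 a = of_real (snd m) *\<^sub>C a}"

text \<open>\<open>O(S\<^sup>7)\<close> is the direct sum of its weight spaces; \<open>wpart a m\<close> is the component of \<open>a\<close> of weight \<open>m\<close>.\<close>

definition wpart :: "OS7 \<Rightarrow> weight \<Rightarrow> OS7" where
  "wpart a = (THE f. (\<forall>m. f m \<in> weight_space m) \<and> finite {m. f m \<noteq> 0} \<and> Sum_any f = a)"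

definition weight_map :: "weight \<Rightarrow> (OS7 \<Rightarrow> OS7) \<Rightarrow> bool" where
  "weight_map r u \<longleftrightarrow> clinear u \<and>
     commutator H1 u = (\<lambda>a. of_real (fst r) *\<^sub>C u a) \<and>
     commutator H2 u = (\<lambda>a. of_real (snd r) *\<^sub>C u a)"

text \<open>A linear map \<open>u\<close> is the pointwise finite sum of its components \<open>mpart u r\<close>, which have weight
  \<open>r\<close> for the action \<open>H\<^sub>j \<triangleright> u = [H\<^sub>j, u]\<close>.\<close>

definition mpart :: "(OS7 \<Rightarrow> OS7) \<Rightarrow> weight \<Rightarrow> OS7 \<Rightarrow> OS7" where
  "mpart u = (THE f. (\<forall>r. weight_map r (f r)) \<and>
     (\<forall>a. finite {r. f r a \<noteq> 0} \<and> Sum_any (\<lambda>r. f r a) = u a))"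

definition wedge :: "weight \<Rightarrow> weight \<Rightarrow> real" where
  "wedge r s = fst r * snd s - snd r * fst s"

text \<open>The scalars by which the inverse twist and the triangular structure \<open>R\<close>, its square, act on
  \<open>x \<otimes> y\<close> for \<open>x\<close> of weight \<open>r\<close> and \<open>y\<close> of weight \<open>s\<close>.\<close>

definition Fbar :: "real \<Rightarrow> weight \<Rightarrow> weight \<Rightarrow> complex" where
  "Fbar \<theta> r s = exp (- (of_real (pi * \<theta> * wedge r s) * \<i>))"

definition Rmat :: "real \<Rightarrow> weight \<Rightarrow> weight \<Rightarrow> complex" where
  "Rmat \<theta> r s = (Fbar \<theta> r s)\<^sup>2"

text \<open>\<open>weight_exp c\<^sub>1 c\<^sub>2\<close> is the operator \<open>exp (c\<^sub>1 H\<^sub>1 + c\<^sub>2 H\<^sub>2)\<close>.\<close>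

definition weight_exp :: "complex \<Rightarrow> complex \<Rightarrow> OS7 \<Rightarrow> OS7" where
  "weight_exp c1 c2 a =
     Sum_any (\<lambda>m. exp (c1 * of_real (fst m) + c2 * of_real (snd m)) *\<^sub>C wpart a m)"

definition tprod :: "OS7 \<Rightarrow> real \<Rightarrow> OS7 \<Rightarrow> OS7" ("(_ \<star>\<^bsub>_\<^esub> _)" [71, 0, 70] 70) where
  "a \<star>\<^bsub>\<theta>\<^esub> a' = Sum_any (\<lambda>s. Sum_any (\<lambda>m. Fbar \<theta> s m *\<^sub>C (wpart a s * wpart a' m)))"

definition tmod :: "real \<Rightarrow> OS7 \<Rightarrow> (OS7 \<Rightarrow> OS7) \<Rightarrow> OS7 \<Rightarrow> OS7" where
  "tmod \<theta> b u = (\<lambda>a. b \<star>\<^bsub>\<theta>\<^esub> u a)"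

text \<open>The first leg of \<open>Fbar\<close> acts on the map and the second on its argument.\<close>

definition Dtwist :: "real \<Rightarrow> (OS7 \<Rightarrow> OS7) \<Rightarrow> OS7 \<Rightarrow> OS7" where
  "Dtwist \<theta> u = (\<lambda>a. Sum_any (\<lambda>r. Sum_any (\<lambda>m. Fbar \<theta> r m *\<^sub>C mpart u r (wpart a m))))"

section \<open>Infinitesimal gauge transformations of the twisted bundle\<close>

text \<open>In the braided Leibniz rule and the braided bracket, the first leg of \<open>R\<close> acts on \<open>u\<close>.\<close>

definition aut :: "real \<Rightarrow> (OS7 \<Rightarrow> OS7) set" where
  "aut \<theta> = {u. clinear u \<and>
     (\<forall>a. coaction (u a) = tensor_map u id (coaction a)) \<and>
     (\<forall>a a'. u (a \<star>\<^bsub>\<theta>\<^esub> a') = u a \<star>\<^bsub>\<theta>\<^esub> a' +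
        Sum_any (\<lambda>m. Sum_any (\<lambda>r. Rmat \<theta> r m *\<^sub>C (wpart a m \<star>\<^bsub>\<theta>\<^esub> mpart u r a')))) \<and>
     (\<forall>b\<in>OS4. u b = 0)}"

definition tbracket :: "real \<Rightarrow> (OS7 \<Rightarrow> OS7) \<Rightarrow> (OS7 \<Rightarrow> OS7) \<Rightarrow> OS7 \<Rightarrow> OS7" where
  "tbracket \<theta> u u' = (\<lambda>a. u (u' a) -
     Sum_any (\<lambda>s. Sum_any (\<lambda>r. Rmat \<theta> r s *\<^sub>C mpart u' s (mpart u r a))))"

definition module_generated :: "real \<Rightarrow> (OS7 \<Rightarrow> OS7) set \<Rightarrow> (OS7 \<Rightarrow> OS7) set" where
  "module_generated \<theta> G = {(\<lambda>a. \<Sum>g\<in>T. tmod \<theta> (c g) g a) | c T. finite T \<and> T \<subseteq> G \<and> c ` T \<subseteq> OS4}"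

definition Kt :: "real \<Rightarrow> nat \<Rightarrow> OS7 \<Rightarrow> OS7" where
  "Kt \<theta> j = Dtwist \<theta> (K j)"

definition Wt :: "real \<Rightarrow> weight \<Rightarrow> OS7 \<Rightarrow> OS7" where
  "Wt \<theta> r = Dtwist \<theta> (W r)"

end

theory Submission
  imports Defs
begin

text \<open>The twist is governed by a torus. The operators \<open>H\<^sub>1\<close>, \<open>H\<^sub>2\<close> grade \<open>O(S\<^sup>7)\<close> by weights, and for a fixed
  weight \<open>s\<close> the scalars \<open>Fbar \<theta> s m\<close> on the vectors of weight \<open>m\<close> form an algebra automorphism
  \<open>torus \<theta> s\<close> that commutes with the coaction. For \<open>a\<close> of weight \<open>m\<close> the twisted product with \<open>a'\<close> is
  \<open>a (torus m a')\<close>, the twist of a map is \<open>D(u)(a) = torus (- m) (u a)\<close>, and the braiding replaces \<open>u\<close>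
  by its conjugate under \<open>torus (2 m)\<close>. In this form the braided Leibniz rule for \<open>D(u)\<close> on weight
  vectors becomes the Leibniz rule for \<open>u\<close>: the torus elements act on weight vectors by scalars, and
  these cancel. Hence \<open>D\<close> maps the untwisted gauge algebra onto \<open>aut \<theta>\<close>, with the twist for \<open>- \<theta>\<close> as
  inverse (\<open>aut_eq_Dtwist_image\<close>). The same comparison of scalars gives the brackets of the generators
  (\<open>tbracket_Dtwist\<close>) and, for \<open>u\<close> of weight \<open>r\<close>, the identity \<open>D(c u) = (torus r c) \<bullet> D(u)\<close>
  (\<open>Dtwist_mult_left\<close>), so that generators of the untwisted module give generators of the twisted one.

  For the untwisted module let \<open>M\<close> be the \<open>4 \<times> 2\<close> matrix \<open>zmat\<close> with adjoint \<open>M\<^sup>\<dagger>\<close>. Then \<open>M\<^sup>\<dagger>M = 1\<close> and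
  \<open>M M\<^sup>\<dagger> = (1 + Q) / 2\<close>, where the entries of \<open>Q\<close> are the generators of \<open>O(S\<^sup>4)\<close> up to sign. The
  derivations \<open>H\<^sub>j\<close> and \<open>E\<^sub>r\<close> multiply \<open>M\<close> from the left by matrices \<open>T\<^sub>i\<close>, a basis of the symplectic Lie
  algebra, and \<open>K\<^sub>j\<close>, \<open>W\<^sub>r\<close> act up to scalars as \<open>M \<mapsto> (1 + Q) T\<^sub>i M\<close> (\<open>generator_coord\<close>).
  If a derivation satisfies \<open>Q (D M) = D M\<close>, then \<open>D M = M X\<close> with \<open>X = M\<^sup>\<dagger> (D M)\<close>; such an infinitesimal
  right multiplication factors through the coaction and kills every coinvariant
  (\<open>derivation_kills_OS4\<close>). Thus the generators are vertical. Conversely, let \<open>D\<close> be equivariant and vertical. Applying \<open>D\<close> to \<open>Q M = M\<close> gives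
  \<open>Q (D M) = D M\<close>. The matrix \<open>(D M) M\<^sup>\<dagger>\<close> is symplectic with coinvariant entries, so it is a combination
  \<open>\<Sum> c\<^sub>i T\<^sub>i\<close> with \<open>c\<^sub>i \<in> O(S\<^sup>4)\<close>, and \<open>2 D M = (1 + Q) D M = \<Sum> c\<^sub>i (1 + Q) T\<^sub>i M\<close>
  (\<open>gauge_algebra_generated\<close>).

  The bracket of module elements comes from the braided Leibniz rule: \<open>X\<close> passes a coinvariant \<open>b'\<close> at
  the cost of a conjugation, and in the second half of the bracket all braiding factors cancel except
  for that between \<open>X\<close> and \<open>b'\<close> (\<open>braided_summand\<close>).\<close>

section \<open>Linear maps and coordinate algebras\<close>

lemmas scaleC_simps [simp] =
  complex_algebra.scale_zero_left complex_algebra.scale_zero_right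
  complex_algebra.scale_minus_left complex_algebra.scale_minus_right
  scaleC_scaleC scaleC_one mult_scaleC_left

lemma mult_scaleC_right [simp]: "a * (c *\<^sub>C b) = c *\<^sub>C (a * b)"
  for a b :: "'a::comm_complex_algebra"
  by (metis mult.commute mult_scaleC_left)

lemma clinear_iff:
  "clinear f \<longleftrightarrow> (\<forall>x y. f (x + y) = f x + f y) \<and> (\<forall>c x. f (c *\<^sub>C x) = c *\<^sub>C f x)"
  by (simp add: clinear_def Vector_Spaces.linear_iff complex_algebra.vector_space_axioms)

lemma clinearI:
  assumes "\<And>x y. f (x + y) = f x + f y" and "\<And>c x. f (c *\<^sub>C x) = c *\<^sub>C f x"
  shows "clinear f"
  using assms by (simp add: clinear_iff)

context
  fixes f :: "'a::comm_complex_algebra \<Rightarrow> 'b::comm_complex_algebra"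
  assumes f: "clinear f"
begin

lemma clinear_add: "f (x + y) = f x + f y"
  using f by (simp add: clinear_iff)

lemma clinear_scaleC: "f (c *\<^sub>C x) = c *\<^sub>C f x"
  using f by (simp add: clinear_iff)

lemma clinear_zero: "f 0 = 0"
  using clinear_scaleC[of 0 0] by simp

lemma clinear_minus: "f (- x) = - f x"
  using clinear_scaleC[of "-1" x] by simp

lemma clinear_diff: "f (x - y) = f x - f y"
  using clinear_add[of x "- y"] clinear_minus[of y] by simp

lemma clinear_sum: "f (sum g S) = (\<Sum>i\<in>S. f (g i))"
  by (induction S rule: infinite_finite_induct) (auto simp: clinear_zero clinear_add)

lemma clinear_Sum_any:
  assumes "finite {i. g i \<noteq> 0}"
  shows "f (Sum_any g) = Sum_any (\<lambda>i. f (g i))"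
proof -
  have "Sum_any (\<lambda>i. f (g i)) = (\<Sum>i | g i \<noteq> 0. f (g i))"
    by (rule Sum_any.expand_superset) (use assms clinear_zero in auto)
  then show ?thesis by (simp add: Sum_any.expand_set clinear_sum)
qed

end

lemma clinear_comp: "clinear f \<Longrightarrow> clinear g \<Longrightarrow> clinear (\<lambda>x. f (g x))"
  by (simp add: clinear_iff)

lemma clinear_id: "clinear id" and clinear_ident: "clinear (\<lambda>x. x)"
  by (simp_all add: clinear_iff)

lemma clinear_plus: "clinear f \<Longrightarrow> clinear g \<Longrightarrow> clinear (\<lambda>x. f x + g x)"
  by (simp add: clinear_iff scaleC_add_right ac_simps)

lemma clinear_uminus: "clinear f \<Longrightarrow> clinear (\<lambda>x. - f x)"
  by (simp add: clinear_iff ac_simps)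

lemma clinear_subtract: "clinear f \<Longrightarrow> clinear g \<Longrightarrow> clinear (\<lambda>x. f x - g x)"
  using clinear_plus[of f "\<lambda>x. - g x"] clinear_uminus[of g] by simp

lemma clinear_scale: "clinear f \<Longrightarrow> clinear (\<lambda>x. c *\<^sub>C f x)"
  by (simp add: clinear_iff scaleC_add_right ac_simps)

lemma clinear_mult_left: "clinear f \<Longrightarrow> clinear (\<lambda>x. a * f x)"
  by (simp add: clinear_iff distrib_left)

lemma clinear_mult_right: "clinear f \<Longrightarrow> clinear (\<lambda>x. f x * a)"
  by (simp add: clinear_iff distrib_right)

lemma clinear_zero_map: "clinear (\<lambda>x. 0)"
  by (simp add: clinear_iff)

lemma clinear_sum_map: "(\<And>i. i \<in> S \<Longrightarrow> clinear (f i)) \<Longrightarrow> clinear (\<lambda>x. \<Sum>i\<in>S. f i x)"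
  by (induction S rule: infinite_finite_induct) (auto simp: clinear_zero_map clinear_plus)

lemmas clinear_intros = clinear_comp clinear_ident clinear_plus clinear_uminus clinear_subtract
  clinear_scale clinear_mult_left clinear_mult_right clinear_zero_map clinear_sum_map

lemma poly_mapping_additive_induct [case_names zero single add]:
  assumes "P 0" and "\<And>k v. P (Poly_Mapping.single k v)" and "\<And>p q. P p \<Longrightarrow> P q \<Longrightarrow> P (p + q)"
  shows "P (p :: 'a \<Rightarrow>\<^sub>0 'b::comm_monoid_add)"
proof -
  have "p = (\<Sum>k\<in>Poly_Mapping.keys p. Poly_Mapping.single k (Poly_Mapping.lookup p k))"
    by (rule poly_mapping_eqI)
      (auto simp: lookup_sum lookup_single when_def in_keys_iff sum.delta)
  moreover have "P (\<Sum>k\<in>S. Poly_Mapping.single k (Poly_Mapping.lookup p k))" if "finite S" for S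
    using that by (induction S) (use assms in auto)
  ultimately show ?thesis by (metis finite_keys)
qed

text \<open>Coordinate algebras and tensor products are both quotients of monoid algebras. A function on
  the monoid extends linearly to the monoid algebra, and the extension of a homomorphism is
  multiplicative.\<close>

definition mlift :: "('m \<Rightarrow> 'a::comm_complex_algebra) \<Rightarrow> ('m \<Rightarrow>\<^sub>0 complex) \<Rightarrow> 'a" where
  "mlift \<phi> p = (\<Sum>m\<in>Poly_Mapping.keys p. Poly_Mapping.lookup p m *\<^sub>C \<phi> m)"

lemma mlift_superset:
  assumes "finite S" "Poly_Mapping.keys p \<subseteq> S"
  shows "mlift \<phi> p = (\<Sum>m\<in>S. Poly_Mapping.lookup p m *\<^sub>C \<phi> m)"
  unfolding mlift_def
  by (rule sum.mono_neutral_left) (use assms in \<open>auto simp: in_keys_iff\<close>)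

lemma mlift_add: "mlift \<phi> (p + q) = mlift \<phi> p + mlift \<phi> q"
proof -
  let ?S = "Poly_Mapping.keys p \<union> Poly_Mapping.keys q"
  have "mlift \<phi> r = (\<Sum>m\<in>?S. Poly_Mapping.lookup r m *\<^sub>C \<phi> m)"
    if "r = p \<or> r = q \<or> r = p + q" for r
    by (rule mlift_superset) (use that keys_add[of p q] in auto)
  then show ?thesis
    by (simp add: lookup_add scaleC_add_left sum.distrib)
qed

lemma mlift_zero: "mlift \<phi> 0 = 0"
  by (simp add: mlift_def)

lemma mlift_diff: "mlift \<phi> (p - q) = mlift \<phi> p - mlift \<phi> q"
  using mlift_add[of \<phi> "p - q" q] by (simp add: algebra_simps)

lemma mlift_sum: "mlift \<phi> (sum p S) = (\<Sum>i\<in>S. mlift \<phi> (p i))"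
  by (induction S rule: infinite_finite_induct) (auto simp: mlift_zero mlift_add)

lemma mlift_single: "mlift \<phi> (Poly_Mapping.single m c) = c *\<^sub>C \<phi> m"
  by (simp add: mlift_def)

lemma mlift_scale: "mlift \<phi> (Poly_Mapping.single 0 c * p) = c *\<^sub>C mlift \<phi> p"
  by (induction p rule: poly_mapping_additive_induct)
    (simp_all add: mlift_zero mlift_single mult_single distrib_left mlift_add scaleC_add_right)

lemma mlift_mult:
  assumes "\<And>m n. \<phi> (m + n) = \<phi> m * \<phi> n"
  shows "mlift \<phi> (p * q) = mlift \<phi> p * mlift \<phi> q"
proof (induction p rule: poly_mapping_additive_induct)
  case (single k v)
  show ?case
    by (induction q rule: poly_mapping_additive_induct)
      (simp_all add: mlift_zero mlift_single mult_single distrib_left mlift_add assms ac_simps)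
qed (simp_all add: mlift_zero distrib_right mlift_add)

instance gen :: (finite) finite
proof
  have "(UNIV :: 'a gen set) = range Z \<union> range Zs"
    by (metis UNIV_eq_I UnCI gen.exhaust rangeI)
  moreover have "finite (range Z \<union> range Zs :: 'a gen set)" by simp
  ultimately show "finite (UNIV :: 'a gen set)" by (simp only:)
qed

definition monomial_value :: "('n::finite gen \<Rightarrow> 'a::comm_complex_algebra) \<Rightarrow> ('n gen \<Rightarrow>\<^sub>0 nat) \<Rightarrow> 'a"
  where "monomial_value c m = (\<Prod>g\<in>UNIV. c g ^ Poly_Mapping.lookup m g)"

lemma monomial_value_add: "monomial_value c (m + n) = monomial_value c m * monomial_value c n"
  by (simp add: monomial_value_def lookup_add power_add prod.distrib)

lemma monomial_value_zero: "monomial_value c 0 = 1"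
  by (simp add: monomial_value_def)

lemma monomial_value_single: "monomial_value c (Poly_Mapping.single g k) = c g ^ k"
proof -
  have "(\<Prod>h\<in>UNIV. c h ^ Poly_Mapping.lookup (Poly_Mapping.single g k) h)
      = (\<Prod>h\<in>UNIV. if h = g then c g ^ k else 1)"
    by (rule prod.cong) (auto simp: lookup_single when_def)
  then show ?thesis by (simp add: monomial_value_def)
qed

text \<open>Evaluation at elements that violate the sphere relation does not descend to the quotient; \<open>0\<close> is a
  default value for this case.\<close>

lift_definition sphere_hom ::
    "('n::finite gen \<Rightarrow> 'a::comm_complex_algebra) \<Rightarrow> 'n sphere_alg \<Rightarrow> 'a"
  is "\<lambda>c p. if (\<Sum>i\<in>UNIV. c (Z i) * c (Zs i)) = 1 then mlift (monomial_value c) p else 0"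
proof -
  fix c :: "'n gen \<Rightarrow> 'a" and p q :: "'n sphere_poly"
  assume "sphere_eq p q"
  then obtain k where k: "p - q = sphere_relator * k" unfolding sphere_eq_def by blast
  let ?L = "mlift (monomial_value c)"
  have "?L p - ?L q = ?L sphere_relator * ?L k"
    by (metis k mlift_diff mlift_mult monomial_value_add)
  also have "?L sphere_relator = (\<Sum>i\<in>UNIV. c (Z i) * c (Zs i)) - 1"
    by (simp add: sphere_relator_def mlift_diff mlift_sum Var_def mlift_mult monomial_value_add
        mlift_single monomial_value_single monomial_value_zero flip: single_one)
  finally show "(if (\<Sum>i\<in>UNIV. c (Z i) * c (Zs i)) = 1 then ?L p else 0) =
      (if (\<Sum>i\<in>UNIV. c (Z i) * c (Zs i)) = 1 then ?L q else 0)"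
    by auto
qed

text \<open>An algebra map out of the coordinate algebra is a choice of images of the generators that
  satisfies the sphere relation.\<close>

lemma
  fixes c :: "'n::finite gen \<Rightarrow> 'a::comm_complex_algebra"
  assumes rel: "(\<Sum>i\<in>UNIV. c (Z i) * c (Zs i)) = 1"
  shows algebra_map_sphere_hom: "algebra_map (sphere_hom c)"
    and sphere_hom_coord: "sphere_hom c (coord g) = c g"
proof -
  show "algebra_map (sphere_hom c)"
    unfolding algebra_map_def clinear_iff
  proof (intro conjI allI)
    show "sphere_hom c (x + y) = sphere_hom c x + sphere_hom c y" for x y
      using rel by transfer (simp add: mlift_add)
    show "sphere_hom c (k *\<^sub>C x) = k *\<^sub>C sphere_hom c x" for k x
      using rel by transfer (simp add: mlift_scale)
    show "sphere_hom c 1 = 1"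
      using rel by transfer (simp add: mlift_single monomial_value_zero flip: single_one)
    show "sphere_hom c (x * y) = sphere_hom c x * sphere_hom c y" for x y
      using rel by transfer (simp add: mlift_mult monomial_value_add)
  qed
  show "sphere_hom c (coord g) = c g"
    using rel by transfer (simp add: Var_def mlift_single monomial_value_single)
qed

text \<open>The coordinates generate the algebra.\<close>

lemma sphere_alg_induct [case_names coord one add scale mult]:
  fixes a :: "'n::finite sphere_alg"
  assumes coord: "\<And>g. P (coord g)" and one: "P 1"
    and add: "\<And>a b. P a \<Longrightarrow> P b \<Longrightarrow> P (a + b)"
    and scale: "\<And>c a. P a \<Longrightarrow> P (c *\<^sub>C a)"
    and mult: "\<And>a b. P a \<Longrightarrow> P b \<Longrightarrow> P (a * b)"
  shows "P a"
proof -
  have power: "P (coord g ^ k)" for g k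
    by (induction k) (auto intro: one mult coord)
  have coord_abs: "coord g = abs_sphere_alg (Poly_Mapping.single (Poly_Mapping.single g 1) 1)" for g
    by (simp add: coord.abs_eq Var_def)
  have power_abs: "coord g ^ k = abs_sphere_alg (Poly_Mapping.single (Poly_Mapping.single g k) 1)"
    for g k
  proof (induction k)
    case 0
    show ?case by (simp add: one_sphere_alg.abs_eq)
  next
    case (Suc k)
    then show ?case
      by (simp add: coord_abs times_sphere_alg.abs_eq mult_single flip: single_add)
  qed
  have monomial: "P (abs_sphere_alg (Poly_Mapping.single m 1))" for m
  proof (induction m rule: poly_mapping_additive_induct)
    case zero
    show ?case using one by (simp add: one_sphere_alg.abs_eq)
  next
    case (single g k)
    show ?case by (metis power power_abs)
  next
    case (add m n)
    then have "P (abs_sphere_alg (Poly_Mapping.single m 1) * abs_sphere_alg (Poly_Mapping.single n 1))"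
      by (rule mult)
    then show ?case by (simp add: times_sphere_alg.abs_eq mult_single)
  qed
  have "P (abs_sphere_alg p)" for p
  proof (induction p rule: poly_mapping_additive_induct)
    case zero
    show ?case using scale[OF one, of 0] by (simp add: zero_sphere_alg.abs_eq)
  next
    case (single m c)
    have "c *\<^sub>C abs_sphere_alg (Poly_Mapping.single m 1) = abs_sphere_alg (Poly_Mapping.single m c)"
      by (simp add: scaleC_sphere_alg.abs_eq mult_single)
    then show ?case by (metis scale monomial)
  next
    case (add p q)
    then show ?case using assms(3) by (metis plus_sphere_alg.abs_eq)
  qed
  then show ?thesis by (metis Quotient_abs_rep Quotient_sphere_alg)
qed

lemma algebra_map_clinear: "algebra_map f \<Longrightarrow> clinear f"
  and algebra_map_one: "algebra_map f \<Longrightarrow> f 1 = 1"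
  and algebra_map_mult: "algebra_map f \<Longrightarrow> f (a * b) = f a * f b"
  by (simp_all add: algebra_map_def)

lemma algebra_map_comp: "algebra_map f \<Longrightarrow> algebra_map g \<Longrightarrow> algebra_map (\<lambda>x. f (g x))"
  by (simp add: algebra_map_def clinear_comp)

lemma algebra_map_eqI:
  fixes f g :: "'n::finite sphere_alg \<Rightarrow> 'b::comm_complex_algebra"
  assumes "algebra_map f" "algebra_map g" "\<And>h. f (coord h) = g (coord h)"
  shows "f = g"
proof
  show "f a = g a" for a
    by (induction a rule: sphere_alg_induct)
      (use assms in \<open>simp_all add: algebra_map_def clinear_iff\<close>)
qed

lemma sphere_relation: "(\<Sum>i\<in>UNIV. zz i * zs i) = (1 :: 'n::finite sphere_alg)"
proof -
  have "sphere_eq ((\<Sum>i\<in>UNIV. Var (Z i) * Var (Zs i)) :: 'n sphere_poly) 1"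
    by (simp add: sphere_eq_def sphere_relator_def)
  then have "abs_sphere_alg (\<Sum>i\<in>UNIV. Var (Z i) * Var (Zs i)) = (1 :: 'n sphere_alg)"
    by (simp add: one_sphere_alg.abs_eq sphere_alg.abs_eq_iff)
  moreover have "abs_sphere_alg (\<Sum>i\<in>S. Var (Z i) * Var (Zs i)) = (\<Sum>i\<in>S. zz i * zs i)"
    for S :: "'n set"
  proof (induction S rule: infinite_finite_induct)
    case (insert i S)
    then show ?case
      by (simp add: coord.abs_eq times_sphere_alg.abs_eq flip: plus_sphere_alg.abs_eq)
  qed (simp_all add: zero_sphere_alg.abs_eq)
  ultimately show ?thesis by simp
qed


section \<open>Derivations and dual numbers\<close>

text \<open>A derivation \<open>d\<close> of \<open>A\<close> is the same thing as an algebra map \<open>a \<mapsto> a + \<epsilon> d a\<close> into the dual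
  numbers over \<open>A\<close>. Hence universal properties for algebra maps produce derivations.\<close>

datatype 'a dual = Dual (std_part: 'a) (inf_part: 'a)

instantiation dual :: (comm_complex_algebra) comm_complex_algebra
begin

definition "0 = Dual 0 0"
definition "1 = Dual 1 0"
definition "x + y = Dual (std_part x + std_part y) (inf_part x + inf_part y)"
definition "- x = Dual (- std_part x) (- inf_part x)"
definition "x - y = Dual (std_part x - std_part y) (inf_part x - inf_part y)"
definition "x * y = Dual (std_part x * std_part y) (std_part x * inf_part y + inf_part x * std_part y)"
definition "c *\<^sub>C x = Dual (c *\<^sub>C std_part x) (c *\<^sub>C inf_part x)"

lemmas dual_defs = zero_dual_def one_dual_def plus_dual_def uminus_dual_def minus_dual_def
  times_dual_def scaleC_dual_def

instance
proof
  fix a b c :: "'a dual" and k l :: complex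
  show "a + b + c = a + (b + c)" "a + b = b + a" "0 + a = a" "- a + a = 0" "a - b = a + - b"
    by (simp_all add: dual_defs ac_simps)
  show "a * b * c = a * (b * c)" "a * b = b * a" "1 * a = a" "(a + b) * c = a * c + b * c"
    by (simp_all add: dual_defs algebra_simps)
  show "k *\<^sub>C (a + b) = k *\<^sub>C a + k *\<^sub>C b" "k *\<^sub>C (l *\<^sub>C a) = (k * l) *\<^sub>C a"
    "(k + l) *\<^sub>C a = k *\<^sub>C a + l *\<^sub>C a" "1 *\<^sub>C a = a" "(k *\<^sub>C a) * b = k *\<^sub>C (a * b)"
    by (simp_all add: dual_defs scaleC_add_left scaleC_add_right)
qed

end

lemma std_part_simps [simp]:
  "std_part 0 = 0" "std_part 1 = 1" "std_part (x + y) = std_part x + std_part y"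
  "std_part (- x) = - std_part x" "std_part (x - y) = std_part x - std_part y"
  "std_part (x * y) = std_part x * std_part y" "std_part (c *\<^sub>C x) = c *\<^sub>C std_part x"
  by (simp_all add: dual_defs)

lemma inf_part_simps [simp]:
  "inf_part 0 = 0" "inf_part 1 = 0" "inf_part (x + y) = inf_part x + inf_part y"
  "inf_part (- x) = - inf_part x" "inf_part (x - y) = inf_part x - inf_part y"
  "inf_part (x * y) = std_part x * inf_part y + inf_part x * std_part y"
  "inf_part (c *\<^sub>C x) = c *\<^sub>C inf_part x"
  by (simp_all add: dual_defs)

lemma std_part_sum: "std_part (sum f S) = (\<Sum>i\<in>S. std_part (f i))"
  and inf_part_sum: "inf_part (sum f S) = (\<Sum>i\<in>S. inf_part (f i))"
  by (induction S rule: infinite_finite_induct) auto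

lemma derivation_clinear: "derivation d \<Longrightarrow> clinear d"
  and derivation_mult: "derivation d \<Longrightarrow> d (a * b) = d a * b + a * d b"
  by (simp_all add: derivation_def)

lemma derivation_one: "derivation d \<Longrightarrow> d 1 = 0"
  using derivation_mult[of d 1 1] by simp

lemma derivation_algebra_map: "derivation d \<Longrightarrow> algebra_map (\<lambda>a. Dual a (d a))"
  by (frule derivation_one)
    (simp add: algebra_map_def derivation_def clinear_iff dual_defs ac_simps)

lemma derivation_eqI:
  fixes d e :: "'n::finite sphere_alg \<Rightarrow> 'n sphere_alg"
  assumes "derivation d" "derivation e" "\<And>g. d (coord g) = e (coord g)"
  shows "d = e"
proof -
  have "(\<lambda>a. Dual a (d a)) = (\<lambda>a. Dual a (e a))"
    by (rule algebra_map_eqI) (use assms derivation_algebra_map in auto)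
  then show ?thesis by (metis dual.inject ext)
qed

text \<open>The sphere relation for \<open>z + \<epsilon> v(z)\<close> holds in the dual numbers exactly if the derivative of the
  relation along \<open>v\<close> vanishes.\<close>

lemma derivation_exists:
  fixes v :: "'n::finite gen \<Rightarrow> 'n sphere_alg"
  assumes "(\<Sum>i\<in>UNIV. zz i * v (Zs i) + v (Z i) * zs i) = 0"
  shows "\<exists>d. derivation d \<and> (\<forall>g. d (coord g) = v g)"
proof -
  define c where "c g = Dual (coord g) (v g)" for g
  have "(\<Sum>i\<in>UNIV. c (Z i) * c (Zs i)) = 1"
    by (rule dual.expand)
      (use assms sphere_relation[where 'n='n] in \<open>simp add: c_def std_part_sum inf_part_sum\<close>)
  note hom = algebra_map_sphere_hom[OF this] sphere_hom_coord[OF this]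
  let ?\<phi> = "sphere_hom c"
  have "(\<lambda>a. std_part (?\<phi> a)) = (\<lambda>a. a)"
  proof (rule algebra_map_eqI)
    show "algebra_map (\<lambda>a. std_part (?\<phi> a))"
      using hom(1) by (simp add: algebra_map_def clinear_iff)
    show "algebra_map (\<lambda>a. a :: 'n sphere_alg)"
      by (simp add: algebra_map_def clinear_iff)
  qed (simp add: hom c_def)
  then have std: "std_part (?\<phi> a) = a" for a by metis
  have "derivation (\<lambda>a. inf_part (?\<phi> a))"
    using hom(1) by (simp add: derivation_def algebra_map_def clinear_iff std ac_simps)
  then show ?thesis by (metis c_def hom(2) dual.sel(2))
qed

lemma
  assumes "(\<Sum>i\<in>UNIV. zz i * v (Zs i) + v (Z i) * zs i) = 0"
  shows derivation_vector_field: "derivation (vector_field v)"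
    and vector_field_coord: "vector_field v (coord g) = v g"
proof -
  obtain d where d: "derivation d" "\<And>g. d (coord g) = v g"
    using derivation_exists[OF assms] by blast
  have "derivation (vector_field v) \<and> (\<forall>g. vector_field v (coord g) = v g)"
    unfolding vector_field_def
    by (rule theI[of _ d]) (use d derivation_eqI in \<open>auto, metis\<close>)
  then show "derivation (vector_field v)" "vector_field v (coord g) = v g" by auto
qed

lemma derivation_zero_map: "derivation (\<lambda>a. 0)"
  by (simp add: derivation_def clinear_zero_map)

lemma derivation_add: "derivation d \<Longrightarrow> derivation e \<Longrightarrow> derivation (\<lambda>a. d a + e a)"
  by (simp add: derivation_def clinear_plus algebra_simps)

lemma derivation_uminus: "derivation d \<Longrightarrow> derivation (\<lambda>a. - d a)"
  by (simp add: derivation_def clinear_uminus)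

lemma derivation_diff: "derivation d \<Longrightarrow> derivation e \<Longrightarrow> derivation (\<lambda>a. d a - e a)"
  by (simp add: derivation_def clinear_subtract algebra_simps)

lemma derivation_scale: "derivation d \<Longrightarrow> derivation (\<lambda>a. c *\<^sub>C d a)"
  by (simp add: derivation_def clinear_scale scaleC_add_right)

lemma derivation_mult_left: "derivation d \<Longrightarrow> derivation (\<lambda>a. b * d a)"
  by (simp add: derivation_def clinear_mult_left algebra_simps)

lemmas derivation_intros = derivation_zero_map derivation_add derivation_uminus derivation_diff
  derivation_scale derivation_mult_left

lemma derivation_commutator: "derivation d \<Longrightarrow> derivation e \<Longrightarrow> derivation (commutator d e)"
  by (simp add: derivation_def commutator_def clinear_iff algebra_simps)


section \<open>Tensor products\<close>

definition bilinear_map ::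
    "('a::comm_complex_algebra \<Rightarrow> 'b::comm_complex_algebra \<Rightarrow> 'c::comm_complex_algebra) \<Rightarrow> bool" where
  "bilinear_map \<phi> \<longleftrightarrow> (\<forall>a. clinear (\<phi> a)) \<and> (\<forall>b. clinear (\<lambda>a. \<phi> a b))"

text \<open>A monomial times a bilinearity relation is again a bilinearity relation, so the ideal that the
  relations generate is already their linear span.\<close>

lemma mlift_tensor_relators:
  assumes \<phi>: "bilinear_map \<phi>" and p: "p \<in> ring_module.span tensor_relators"
  shows "mlift (case_mpair \<phi>) p = 0"
proof -
  let ?L = "mlift (case_mpair \<phi>)"
  have bil: "\<phi> (x + y) b = \<phi> x b + \<phi> y b" "\<phi> (c *\<^sub>C x) b = c *\<^sub>C \<phi> x b"
    "\<phi> x (b + b') = \<phi> x b + \<phi> x b'" "\<phi> x (c *\<^sub>C b) = c *\<^sub>C \<phi> x b" for x y b b' c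
    using \<phi> by (simp_all add: bilinear_map_def clinear_iff)
  have "\<forall>k. ?L (k * p) = 0"
    using p
  proof (induction p rule: ring_module.span_induct)
    case base
    show ?case
    proof (rule ring_module.subspaceI)
      show "c * x \<in> {x. \<forall>k. ?L (k * x) = 0}" if "x \<in> {x. \<forall>k. ?L (k * x) = 0}" for c x
        using that by (simp flip: mult.assoc)
    qed (simp_all add: mlift_zero distrib_left mlift_add)
  next
    case (step r)
    have "?L (Poly_Mapping.single m c * r) = 0" for m c
    proof (cases m)
      case (MPair x y)
      then show ?thesis
        using step
        by (auto simp: tensor_relators_def ftens_def distrib_left right_diff_distrib mult_single
            mlift_diff mlift_add mlift_single zero_mpair_def bil scaleC_add_right ac_simps)
    qed
    moreover have "?L (k * r) = 0" if "\<And>m c. ?L (Poly_Mapping.single m c * r) = 0" for k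
      by (induction k rule: poly_mapping_additive_induct)
        (simp_all add: that mlift_zero distrib_right mlift_add)
    ultimately show ?case by blast
  qed
  then show ?thesis by (metis mult_1)
qed

lift_definition tensor_lift ::
    "('a::comm_complex_algebra \<Rightarrow> 'b::comm_complex_algebra \<Rightarrow> 'c::comm_complex_algebra) \<Rightarrow>
     ('a, 'b) tensor \<Rightarrow> 'c"
  is "\<lambda>\<phi> p. if bilinear_map \<phi> then mlift (case_mpair \<phi>) p else 0"
  by (simp add: tensor_eq_def) (metis eq_iff_diff_eq_0 mlift_diff mlift_tensor_relators)

lemma
  assumes "bilinear_map \<phi>"
  shows clinear_tensor_lift: "clinear (tensor_lift \<phi>)"
    and tensor_lift_tens: "tensor_lift \<phi> (a \<otimes>\<^sub>C b) = \<phi> a b"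
proof -
  show "clinear (tensor_lift \<phi>)"
  proof (rule clinearI)
    show "tensor_lift \<phi> (x + y) = tensor_lift \<phi> x + tensor_lift \<phi> y" for x y
      using assms by transfer (simp add: mlift_add)
    show "tensor_lift \<phi> (c *\<^sub>C x) = c *\<^sub>C tensor_lift \<phi> x" for c x
      using assms by transfer (simp add: mlift_scale)
  qed
  show "tensor_lift \<phi> (a \<otimes>\<^sub>C b) = \<phi> a b"
    using assms by transfer (simp add: ftens_def mlift_single)
qed

lemma abs_tensor_eqI: "p - q \<in> tensor_relators \<Longrightarrow> abs_tensor p = abs_tensor q"
  by (simp add: tensor.abs_eq_iff tensor_eq_def ring_module.span_base)

lemma tens_add_left: "(a + a') \<otimes>\<^sub>C b = a \<otimes>\<^sub>C b + a' \<otimes>\<^sub>C b"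
  unfolding tens.abs_eq plus_tensor.abs_eq
  by (rule abs_tensor_eqI, unfold diff_diff_eq[symmetric], unfold tensor_relators_def) blast

lemma tens_add_right: "a \<otimes>\<^sub>C (b + b') = a \<otimes>\<^sub>C b + a \<otimes>\<^sub>C b'"
  unfolding tens.abs_eq plus_tensor.abs_eq
  by (rule abs_tensor_eqI, unfold diff_diff_eq[symmetric], unfold tensor_relators_def) blast

lemma tens_scale_left: "(c *\<^sub>C a) \<otimes>\<^sub>C b = c *\<^sub>C (a \<otimes>\<^sub>C b)"
  unfolding tens.abs_eq scaleC_tensor.abs_eq
  by (rule abs_tensor_eqI, unfold tensor_relators_def) blast

lemma tens_scale_right: "a \<otimes>\<^sub>C (c *\<^sub>C b) = c *\<^sub>C (a \<otimes>\<^sub>C b)"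
  unfolding tens.abs_eq scaleC_tensor.abs_eq
  by (rule abs_tensor_eqI, unfold tensor_relators_def) blast

lemma clinear_tens_left: "clinear (\<lambda>a. a \<otimes>\<^sub>C b)" and clinear_tens_right: "clinear (\<lambda>b. a \<otimes>\<^sub>C b)"
  by (auto intro!: clinearI simp: tens_add_left tens_add_right tens_scale_left tens_scale_right)

lemmas tens_simps =
  clinear_zero[OF clinear_tens_left] clinear_minus[OF clinear_tens_left]
  clinear_zero[OF clinear_tens_right] clinear_minus[OF clinear_tens_right]
  tens_add_left tens_add_right tens_scale_left tens_scale_right

lemma tens_mult: "(a \<otimes>\<^sub>C b) * (a' \<otimes>\<^sub>C b') = (a * a') \<otimes>\<^sub>C (b * b')"
  by transfer (simp add: ftens_def mult_single equivp_reflp[OF equivp_tensor_eq])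

lemma one_tens: "1 = 1 \<otimes>\<^sub>C 1"
  by transfer (simp add: ftens_def equivp_reflp[OF equivp_tensor_eq] flip: single_one zero_mpair_def)

text \<open>Scalars can be moved into the first factor, so every tensor is a sum of pure tensors.\<close>

lemma tensor_induct [case_names tens add]:
  fixes t :: "('a::comm_complex_algebra, 'b::comm_complex_algebra) tensor"
  assumes tens: "\<And>a b. P (a \<otimes>\<^sub>C b)" and add: "\<And>s t. P s \<Longrightarrow> P t \<Longrightarrow> P (s + t)"
  shows "P t"
proof -
  have "P (abs_tensor p)" for p
  proof (induction p rule: poly_mapping_additive_induct)
    case zero
    show ?case using tens[of 0 0] by (simp add: zero_tensor.abs_eq tens_simps)
  next
    case (single m c)
    obtain a b where m: "m = MPair a b" by (cases m)
    have "c *\<^sub>C (a \<otimes>\<^sub>C b) = abs_tensor (Poly_Mapping.single m c)"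
      by (simp add: tens.abs_eq scaleC_tensor.abs_eq ftens_def mult_single m)
    then show ?case by (metis tens tens_scale_left)
  next
    case (add p q)
    then show ?case using assms(2) by (metis plus_tensor.abs_eq)
  qed
  then show ?thesis by (metis Quotient_abs_rep Quotient_tensor)
qed

lemma clinear_tensor_eqI:
  assumes "clinear f" "clinear g" "\<And>a b. f (a \<otimes>\<^sub>C b) = g (a \<otimes>\<^sub>C b)"
  shows "f = g"
proof
  show "f t = g t" for t
    by (induction t rule: tensor_induct) (use assms in \<open>auto simp: clinear_iff\<close>)
qed

lemma
  assumes f: "clinear f" and g: "clinear g"
  shows clinear_tensor_map: "clinear (tensor_map f g)"
    and tensor_map_tens: "tensor_map f g (a \<otimes>\<^sub>C b) = f a \<otimes>\<^sub>C g b"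
proof -
  have "bilinear_map (\<lambda>a b. f a \<otimes>\<^sub>C g b)"
    unfolding bilinear_map_def
    using clinear_comp[OF clinear_tens_left f] clinear_comp[OF clinear_tens_right g] by blast
  note lift = clinear_tensor_lift[OF this] tensor_lift_tens[OF this]
  have "clinear (tensor_map f g) \<and> (\<forall>a b. tensor_map f g (a \<otimes>\<^sub>C b) = f a \<otimes>\<^sub>C g b)"
    unfolding tensor_map_def
    by (rule theI[of _ "tensor_lift (\<lambda>a b. f a \<otimes>\<^sub>C g b)"])
      (use lift in \<open>auto intro!: clinear_tensor_eqI\<close>)
  then show "clinear (tensor_map f g)" "tensor_map f g (a \<otimes>\<^sub>C b) = f a \<otimes>\<^sub>C g b" by auto
qed

definition first_leg ::
    "('a \<Rightarrow> 'c) \<Rightarrow> ('a::comm_complex_algebra, 'b::comm_complex_algebra) tensor \<Rightarrow>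
     ('c::comm_complex_algebra, 'b) tensor" where
  "first_leg f = tensor_map f id"

lemma clinear_first_leg: "clinear f \<Longrightarrow> clinear (first_leg f)"
  unfolding first_leg_def by (rule clinear_tensor_map[OF _ clinear_id])

lemma first_leg_tens: "clinear f \<Longrightarrow> first_leg f (a \<otimes>\<^sub>C b) = f a \<otimes>\<^sub>C b"
  unfolding first_leg_def by (simp only: tensor_map_tens[OF _ clinear_id] id_apply)

lemmas first_leg_plus = clinear_add[OF clinear_first_leg]

lemma first_leg_comp:
  assumes "clinear f" "clinear g"
  shows "first_leg (\<lambda>a. f (g a)) t = first_leg f (first_leg g t)"
  by (induction t rule: tensor_induct)
    (simp_all add: assms first_leg_tens clinear_comp first_leg_plus)

lemma first_leg_add:
  assumes "clinear f" "clinear g"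
  shows "first_leg (\<lambda>a. f a + g a) t = first_leg f t + first_leg g t"
  by (induction t rule: tensor_induct)
    (simp_all add: assms first_leg_tens clinear_plus first_leg_plus tens_simps)

lemma first_leg_scale:
  assumes "clinear f"
  shows "first_leg (\<lambda>a. c *\<^sub>C f a) t = c *\<^sub>C first_leg f t"
  by (induction t rule: tensor_induct)
    (simp_all add: assms first_leg_tens clinear_scale first_leg_plus tens_simps
      scaleC_add_right)

lemma first_leg_mult_left:
  assumes "clinear f"
  shows "first_leg (\<lambda>a. b * f a) t = (b \<otimes>\<^sub>C 1) * first_leg f t"
  by (induction t rule: tensor_induct)
    (simp_all add: assms first_leg_tens clinear_mult_left first_leg_plus tens_mult
      distrib_left)

lemma first_leg_derivation:
  fixes s t :: "('a::comm_complex_algebra, 'b::comm_complex_algebra) tensor"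
  assumes "derivation d"
  shows "first_leg d (s * t) = first_leg d s * t + s * first_leg d t"
proof -
  note d = derivation_clinear[OF assms]
  have tens: "first_leg d ((a \<otimes>\<^sub>C b) * t) = first_leg d (a \<otimes>\<^sub>C b) * t + (a \<otimes>\<^sub>C b) * first_leg d t"
    for a and b :: 'b and t
    by (induction t rule: tensor_induct)
      (simp_all add: first_leg_tens[OF d] tens_mult derivation_mult[OF assms] tens_simps
        distrib_left distrib_right first_leg_plus[OF d])
  show ?thesis
    by (induction s rule: tensor_induct)
      (simp_all add: tens distrib_right first_leg_plus[OF d])
qed

lemma first_leg_derivation_one: "derivation d \<Longrightarrow> first_leg d 1 = 0"
  by (simp add: one_tens first_leg_tens derivation_clinear derivation_one tens_simps)


section \<open>The coaction\<close>

lemma exhaust_2: "(x :: 2) = 1 \<or> x = 2"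
proof (induct x)
  case (of_int z)
  then have "z = 0 \<or> z = 1" by fastforce
  then show ?case by auto
qed

lemma exhaust_4: "(x :: 4) = 1 \<or> x = 2 \<or> x = 3 \<or> x = 4"
proof (induct x)
  case (of_int z)
  then have "z = 0 \<or> z = 1 \<or> z = 2 \<or> z = 3" by fastforce
  then show ?case by auto
qed

lemma sum_UNIV_2: "sum f (UNIV :: 2 set) = f 1 + f 2"
proof -
  have "UNIV = {1, 2 :: 2}" using exhaust_2 by auto
  show ?thesis unfolding \<open>UNIV = {1, 2 :: 2}\<close> by simp
qed

lemma sum_UNIV_4: "sum f (UNIV :: 4 set) = f 1 + f 2 + f 3 + f 4"
proof -
  have "UNIV = {1, 2, 3, 4 :: 4}" using exhaust_4 by auto
  show ?thesis unfolding \<open>UNIV = {1, 2, 3, 4 :: 4}\<close> by (simp add: ac_simps)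
qed

lemma all_gen4: "(\<forall>g :: 4 gen. P g) \<longleftrightarrow>
    P (Z 1) \<and> P (Z 2) \<and> P (Z 3) \<and> P (Z 4) \<and> P (Zs 1) \<and> P (Zs 2) \<and> P (Zs 3) \<and> P (Zs 4)"
  by (metis exhaust_4 gen.exhaust)

lemma sphere_relation_2: "zz 1 * zs 1 + zz 2 * zs 2 = (1 :: OSU2)"
  using sphere_relation[where 'n = 2] by (simp add: sum_UNIV_2)

lemma sphere_relation_4: "zz 1 * zs 1 + zz 2 * zs 2 + zz 3 * zs 3 + zz 4 * zs 4 = (1 :: OS7)"
  using sphere_relation[where 'n = 4] by (simp add: sum_UNIV_4)

text \<open>The matrix \<open>zmat\<close> has the shape \<open>(v(z\<^sub>1), - v(z\<^sub>2\<^sup>*)), (v(z\<^sub>2), v(z\<^sub>1\<^sup>*)), \<dots>\<close> with \<open>v = coord\<close>. The right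
  multiplication by \<open>wmat\<close> is written for all matrices of this shape, because derivations
  and the module operations below produce such matrices.\<close>

definition coaction_rows :: "(4 gen \<Rightarrow> OS7) \<Rightarrow> 4 gen \<Rightarrow> (OS7, OSU2) tensor" where
  "coaction_rows v = (\<lambda>_. 0)
     (Z 1 := v (Z 1) \<otimes>\<^sub>C zz 1 - v (Zs 2) \<otimes>\<^sub>C zz 2, Zs 2 := v (Z 1) \<otimes>\<^sub>C zs 2 + v (Zs 2) \<otimes>\<^sub>C zs 1,
      Z 2 := v (Z 2) \<otimes>\<^sub>C zz 1 + v (Zs 1) \<otimes>\<^sub>C zz 2, Zs 1 := v (Zs 1) \<otimes>\<^sub>C zs 1 - v (Z 2) \<otimes>\<^sub>C zs 2,
      Z 3 := v (Z 3) \<otimes>\<^sub>C zz 1 - v (Zs 4) \<otimes>\<^sub>C zz 2, Zs 4 := v (Z 3) \<otimes>\<^sub>C zs 2 + v (Zs 4) \<otimes>\<^sub>C zs 1,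
      Z 4 := v (Z 4) \<otimes>\<^sub>C zz 1 + v (Zs 3) \<otimes>\<^sub>C zz 2, Zs 3 := v (Zs 3) \<otimes>\<^sub>C zs 1 - v (Z 4) \<otimes>\<^sub>C zs 2)"

text \<open>The determinant of rows 1 and 2 of \<open>zmat\<close> is \<open>z\<^sub>1 z\<^sub>1\<^sup>* + z\<^sub>2 z\<^sub>2\<^sup>*\<close>, that of rows 3 and 4 is \<open>z\<^sub>3 z\<^sub>3\<^sup>* + z\<^sub>4 z\<^sub>4\<^sup>*\<close>;
  right multiplication by a matrix of determinant one preserves them.\<close>

lemma coaction_rows_relation: "(\<Sum>i\<in>UNIV. coaction_rows coord (Z i) * coaction_rows coord (Zs i)) = 1"
proof -
  have minor: "(a \<otimes>\<^sub>C zz 1 - d \<otimes>\<^sub>C zz 2) * (c \<otimes>\<^sub>C zs 1 - b \<otimes>\<^sub>C zs 2)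
      + (b \<otimes>\<^sub>C zz 1 + c \<otimes>\<^sub>C zz 2) * (a \<otimes>\<^sub>C zs 2 + d \<otimes>\<^sub>C zs 1)
      = (a * c + b * d) \<otimes>\<^sub>C (1 :: OSU2)" for a b c d :: OS7
    unfolding sphere_relation_2[symmetric] by (simp add: algebra_simps tens_mult tens_simps)
  have "(\<Sum>i\<in>UNIV. coaction_rows coord (Z i) * coaction_rows coord (Zs i))
      = (zz 1 * zs 1 + zz 2 * zs 2) \<otimes>\<^sub>C 1 + (zz 3 * zs 3 + zz 4 * zs 4) \<otimes>\<^sub>C 1"
    unfolding minor[symmetric] by (simp add: sum_UNIV_4 coaction_rows_def)
  also have "\<dots> = (zz 1 * zs 1 + zz 2 * zs 2 + zz 3 * zs 3 + zz 4 * zs 4) \<otimes>\<^sub>C 1"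
    by (simp only: tens_add_left add.assoc)
  finally show ?thesis by (simp add: sphere_relation_4 one_tens)
qed

text \<open>Each generator is up to sign exactly one entry of \<open>zmat\<close>.\<close>

lemma coaction_matrix_iff:
  assumes "clinear d"
  shows "(\<forall>i<4. \<forall>j<2. d (zmat ! i ! j) = (\<Sum>k<2. (zmat ! i ! k) \<otimes>\<^sub>C (wmat ! k ! j)))
    \<longleftrightarrow> (\<forall>g. d (coord g) = coaction_rows coord g)"
proof -
  have neg: "- a = b \<longleftrightarrow> a = - b" for a b :: "(OS7, OSU2) tensor"
    by (rule minus_equation_iff[of a b, THEN trans]) (rule eq_commute)
  show ?thesis
    by (simp add: all_gen4 zmat_def wmat_def coaction_rows_def eval_nat_numeral less_Suc_eq
        all_conj_distrib tens_simps clinear_minus[OF assms] neg)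
      (auto simp: algebra_simps)
qed

lemma coaction_unique:
  "algebra_map coaction \<and>
     (\<forall>i<4. \<forall>j<2. coaction (zmat ! i ! j) = (\<Sum>k<2. (zmat ! i ! k) \<otimes>\<^sub>C (wmat ! k ! j)))"
  unfolding coaction_def
proof (rule theI[of _ "sphere_hom (coaction_rows coord)"])
  note hom = algebra_map_sphere_hom[OF coaction_rows_relation]
    sphere_hom_coord[OF coaction_rows_relation]
  let ?matrix = "\<lambda>d. \<forall>i<4. \<forall>j<2. d (zmat ! i ! j) = (\<Sum>k<2. (zmat ! i ! k) \<otimes>\<^sub>C (wmat ! k ! j))"
  show "algebra_map (sphere_hom (coaction_rows coord)) \<and> ?matrix (sphere_hom (coaction_rows coord))"
    using hom coaction_matrix_iff algebra_map_clinear by blast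
  fix d assume d: "algebra_map d \<and> ?matrix d"
  then have "d (coord g) = coaction_rows coord g" for g
    using coaction_matrix_iff algebra_map_clinear by blast
  then show "d = sphere_hom (coaction_rows coord)"
    using d hom by (intro algebra_map_eqI) auto
qed

lemma algebra_map_coaction: "algebra_map coaction"
  using coaction_unique by blast

lemma clinear_coaction: "clinear coaction"
  by (rule algebra_map_clinear[OF algebra_map_coaction])

lemma coaction_coord: "coaction (coord g) = coaction_rows coord g"
  using coaction_unique coaction_matrix_iff[OF clinear_coaction] by blast

lemmas coaction_gens = coaction_coord[of "Z 1"] coaction_coord[of "Z 2"] coaction_coord[of "Z 3"]
  coaction_coord[of "Z 4"] coaction_coord[of "Zs 1"] coaction_coord[of "Zs 2"]
  coaction_coord[of "Zs 3"] coaction_coord[of "Zs 4"]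

lemmas coaction_z = coaction_gens[unfolded coaction_rows_def, simplified]

lemmas coaction_simps =
  clinear_add[OF clinear_coaction] clinear_diff[OF clinear_coaction]
  clinear_minus[OF clinear_coaction] clinear_scaleC[OF clinear_coaction]
  clinear_zero[OF clinear_coaction]
  algebra_map_mult[OF algebra_map_coaction] algebra_map_one[OF algebra_map_coaction]

lemma OS4_iff: "b \<in> OS4 \<longleftrightarrow> coaction b = b \<otimes>\<^sub>C 1"
  by (simp add: OS4_def)

lemma OS4_zero: "0 \<in> OS4"
  by (simp add: OS4_iff coaction_simps tens_simps)

lemma OS4_add: "a \<in> OS4 \<Longrightarrow> b \<in> OS4 \<Longrightarrow> a + b \<in> OS4"
  by (simp add: OS4_iff coaction_simps tens_simps)

lemma OS4_scale: "b \<in> OS4 \<Longrightarrow> c *\<^sub>C b \<in> OS4"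
  by (simp add: OS4_iff coaction_simps tens_simps)

lemma OS4_minus: "b \<in> OS4 \<Longrightarrow> - b \<in> OS4"
  by (simp add: OS4_iff coaction_simps tens_simps)

lemma OS4_diff: "a \<in> OS4 \<Longrightarrow> b \<in> OS4 \<Longrightarrow> a - b \<in> OS4"
  using OS4_add[of a "- b"] OS4_minus[of b] by simp

lemma OS4_mult: "a \<in> OS4 \<Longrightarrow> b \<in> OS4 \<Longrightarrow> a * b \<in> OS4"
  by (simp add: OS4_iff coaction_simps tens_mult)

lemma OS4_sum: "(\<And>i. i \<in> S \<Longrightarrow> f i \<in> OS4) \<Longrightarrow> sum f S \<in> OS4"
  by (induction S rule: infinite_finite_induct) (auto simp: OS4_zero OS4_add)

lemmas OS4_intros = OS4_zero OS4_add OS4_scale OS4_minus OS4_diff OS4_mult OS4_sum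

definition equivariant :: "(OS7 \<Rightarrow> OS7) \<Rightarrow> bool" where
  "equivariant u \<longleftrightarrow> (\<forall>a. coaction (u a) = first_leg u (coaction a))"

lemma equivariantD: "equivariant u \<Longrightarrow> coaction (u a) = first_leg u (coaction a)"
  by (simp add: equivariant_def)

lemma equivariant_derivationI:
  assumes d: "derivation d"
    and coord: "\<And>g. coaction (d (coord g)) = first_leg d (coaction (coord g))"
  shows "equivariant d"
  unfolding equivariant_def
proof
  fix a
  note lin = derivation_clinear[OF d]
  show "coaction (d a) = first_leg d (coaction a)"
  proof (induction a rule: sphere_alg_induct)
    case (coord g)
    show ?case by (rule assms(2))
  next
    case one
    show ?case
      by (simp add: derivation_one[OF d] coaction_simps first_leg_derivation_one[OF d])
  next
    case (add a b)
    then show ?case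
      by (simp add: clinear_add[OF lin] coaction_simps first_leg_plus[OF lin])
  next
    case (scale c a)
    then show ?case
      by (simp add: clinear_scaleC[OF lin] coaction_simps clinear_scaleC[OF clinear_first_leg[OF lin]])
  next
    case (mult a b)
    then show ?case
      by (simp add: derivation_mult[OF d] coaction_simps first_leg_derivation[OF d])
  qed
qed

lemma equivariant_comp:
  "clinear u \<Longrightarrow> clinear v \<Longrightarrow> equivariant u \<Longrightarrow> equivariant v \<Longrightarrow> equivariant (\<lambda>a. u (v a))"
  by (simp add: equivariant_def first_leg_comp)

lemma equivariant_add:
  "clinear u \<Longrightarrow> clinear v \<Longrightarrow> equivariant u \<Longrightarrow> equivariant v \<Longrightarrow> equivariant (\<lambda>a. u a + v a)"
  by (simp add: equivariant_def first_leg_add coaction_simps)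

lemma equivariant_scale:
  "clinear u \<Longrightarrow> equivariant u \<Longrightarrow> equivariant (\<lambda>a. c *\<^sub>C u a)"
  by (simp add: equivariant_def first_leg_scale coaction_simps)

lemma equivariant_mult_left:
  "clinear u \<Longrightarrow> equivariant u \<Longrightarrow> b \<in> OS4 \<Longrightarrow> equivariant (\<lambda>a. b * u a)"
  by (simp add: equivariant_def first_leg_mult_left coaction_simps OS4_iff)


section \<open>The weight grading\<close>

lemma H1_field: "(\<Sum>i\<in>UNIV. zz i * v (Zs i) + v (Z i) * zs i) = 0"
  if "v = (\<lambda>_. 0)
     (Z 1 := zz 1, Zs 1 := - zs 1, Z 2 := - zz 2, Zs 2 := zs 2,
      Z 3 := - zz 3, Zs 3 := zs 3, Z 4 := zz 4, Zs 4 := - zs (4 :: 4))"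
  by (simp add: that sum_UNIV_4)

lemma H2_field: "(\<Sum>i\<in>UNIV. zz i * v (Zs i) + v (Z i) * zs i) = 0"
  if "v = (\<lambda>_. 0)
     (Z 1 := - zz 1, Zs 1 := zs 1, Z 2 := zz 2, Zs 2 := - zs 2,
      Z 3 := - zz 3, Zs 3 := zs 3, Z 4 := zz 4, Zs 4 := - zs (4 :: 4))"
  by (simp add: that sum_UNIV_4)

lemma derivation_H1: "derivation H1"
  unfolding H1_def by (rule derivation_scale[OF derivation_vector_field[OF H1_field[OF refl]]])

lemma derivation_H2: "derivation H2"
  unfolding H2_def by (rule derivation_scale[OF derivation_vector_field[OF H2_field[OF refl]]])

lemmas clinear_H1 = derivation_clinear[OF derivation_H1]
lemmas clinear_H2 = derivation_clinear[OF derivation_H2]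

definition coord_weight :: "4 gen \<Rightarrow> weight" where
  "coord_weight = (\<lambda>_. 0)
     (Z 1 := (1/2, -1/2), Zs 1 := (-1/2, 1/2), Z 2 := (-1/2, 1/2), Zs 2 := (1/2, -1/2),
      Z 3 := (-1/2, -1/2), Zs 3 := (1/2, 1/2), Z 4 := (1/2, 1/2), Zs 4 := (-1/2, -1/2))"

lemma coord_in_weight_space: "coord g \<in> weight_space (coord_weight g)"
proof -
  have "\<forall>g. coord g \<in> weight_space (coord_weight g)"
    unfolding all_gen4 weight_space_def H1_def H2_def
    by (simp add: vector_field_coord[OF H1_field[OF refl]] vector_field_coord[OF H2_field[OF refl]]
        coord_weight_def)
  then show ?thesis ..
qed

lemma weight_space_zero: "0 \<in> weight_space m"
  by (simp add: weight_space_def clinear_zero[OF clinear_H1] clinear_zero[OF clinear_H2])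

lemma weight_space_add: "a \<in> weight_space m \<Longrightarrow> b \<in> weight_space m \<Longrightarrow> a + b \<in> weight_space m"
  by (simp add: weight_space_def clinear_add[OF clinear_H1] clinear_add[OF clinear_H2] scaleC_add_right)

lemma weight_space_scale: "a \<in> weight_space m \<Longrightarrow> c *\<^sub>C a \<in> weight_space m"
  by (simp add: weight_space_def clinear_scaleC[OF clinear_H1] clinear_scaleC[OF clinear_H2] mult.commute)

lemma weight_space_minus: "a \<in> weight_space m \<Longrightarrow> - a \<in> weight_space m"
  using weight_space_scale[of a m "-1"] by simp

lemma weight_space_diff: "a \<in> weight_space m \<Longrightarrow> b \<in> weight_space m \<Longrightarrow> a - b \<in> weight_space m"
  using weight_space_add[of a m "- b"] weight_space_minus[of b m] by simp

lemma weight_space_one: "1 \<in> weight_space 0"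
  by (simp add: weight_space_def derivation_one[OF derivation_H1] derivation_one[OF derivation_H2])

lemma weight_space_mult:
  "a \<in> weight_space m \<Longrightarrow> b \<in> weight_space n \<Longrightarrow> a * b \<in> weight_space (m + n)"
  by (simp add: weight_space_def derivation_mult[OF derivation_H1] derivation_mult[OF derivation_H2]
      scaleC_add_left)

text \<open>Eigenvectors of \<open>H\<^sub>1\<close> and \<open>H\<^sub>2\<close> for different weights are independent: apply \<open>H\<^sub>j - m\<^sub>j\<close> to
  remove the summand of weight \<open>m\<close>.\<close>

lemma weight_spaces_independent:
  assumes "finite S" "\<And>m. m \<in> S \<Longrightarrow> f m \<in> weight_space m" "sum f S = 0"
  shows "\<forall>m\<in>S. f m = 0"
  using assms
proof (induction S arbitrary: f rule: finite_induct)
  case (insert m0 S)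
  have f: "f m \<in> weight_space m" if "m \<in> insert m0 S" for m
    using insert.prems(1) that by blast
  have sum0: "f m0 = - sum f S"
    using insert.prems(2) insert.hyps by (simp add: eq_neg_iff_add_eq_0)
  have diff_zero: "\<forall>m\<in>S. of_real (p m - p m0) *\<^sub>C f m = 0"
    if "clinear h" and h: "\<And>m. m \<in> insert m0 S \<Longrightarrow> h (f m) = of_real (p m) *\<^sub>C f m" for h and p :: "weight \<Rightarrow> real"
  proof (rule insert.IH)
    show "of_real (p m - p m0) *\<^sub>C f m \<in> weight_space m" if "m \<in> S" for m
      using f that by (simp add: weight_space_scale)
    have "(\<Sum>m\<in>S. of_real (p m) *\<^sub>C f m) = h (sum f S)"
      by (simp add: clinear_sum[OF that(1)] h)
    also have "\<dots> = of_real (p m0) *\<^sub>C sum f S"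
      using h[of m0] sum0 by (simp add: clinear_minus[OF that(1)])
    finally show "(\<Sum>m\<in>S. of_real (p m - p m0) *\<^sub>C f m) = 0"
      by (simp add: complex_algebra.scale_left_diff_distrib sum_subtractf
          complex_algebra.scale_sum_right)
  qed
  have "f m = 0" if "m \<in> S" for m
  proof -
    have "of_real (fst m - fst m0) *\<^sub>C f m = 0" "of_real (snd m - snd m0) *\<^sub>C f m = 0"
      using diff_zero[OF clinear_H1, of fst] diff_zero[OF clinear_H2, of snd] f that
      by (auto simp: weight_space_def)
    moreover have "m \<noteq> m0" using that insert.hyps by auto
    ultimately show ?thesis by (auto simp: prod_eq_iff simp del: of_real_diff)
  qed
  then show ?case using sum0 by simp
qed simp

definition weight_decomposition :: "OS7 \<Rightarrow> (weight \<Rightarrow> OS7) \<Rightarrow> bool" where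
  "weight_decomposition a f \<longleftrightarrow>
     (\<forall>m. f m \<in> weight_space m) \<and> finite {m. f m \<noteq> 0} \<and> Sum_any f = a"

lemma weight_decomposition_unique:
  assumes f: "weight_decomposition a f" and g: "weight_decomposition a g"
  shows "f = g"
proof
  fix m
  define S where "S = {m. f m \<noteq> 0} \<union> {m. g m \<noteq> 0}"
  have fin: "finite S"
    unfolding S_def using f g weight_decomposition_def by blast
  have sum: "Sum_any f = sum f S" "Sum_any g = sum g S"
    unfolding S_def by (rule Sum_any.expand_superset[OF fin[unfolded S_def]], blast)+
  have zero: "\<forall>m\<in>S. f m - g m = 0"
  proof (rule weight_spaces_independent[OF fin])
    show "f m - g m \<in> weight_space m" for m
      using f g by (simp only: weight_decomposition_def weight_space_diff)
    have "sum f S = sum g S"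
      using f g sum unfolding weight_decomposition_def by metis
    then show "(\<Sum>m\<in>S. f m - g m) = 0"
      by (simp add: sum_subtractf)
  qed
  show "f m = g m"
  proof (cases "m \<in> S")
    case True
    then have "f m - g m = 0" using zero by blast
    then show ?thesis by simp
  next
    case False
    then show ?thesis by (simp add: S_def)
  qed
qed

lemma finite_support_add:
  fixes f g :: "'i \<Rightarrow> 'a::comm_monoid_add"
  assumes "finite {i. f i \<noteq> 0}" "finite {i. g i \<noteq> 0}"
  shows "finite {i. f i + g i \<noteq> 0}"
  by (rule finite_subset[OF _ finite_UnI[OF assms]]) auto

lemma finite_support_mono:
  "finite {i. f i \<noteq> 0} \<Longrightarrow> (\<And>i. f i = 0 \<Longrightarrow> g i = 0) \<Longrightarrow> finite {i. g i \<noteq> 0}"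
  by (erule rev_finite_subset) auto

lemma weight_decomposition_add:
  assumes "weight_decomposition a f" "weight_decomposition b g"
  shows "weight_decomposition (a + b) (\<lambda>m. f m + g m)"
  unfolding weight_decomposition_def
proof (intro conjI allI)
  show "finite {m. f m + g m \<noteq> 0}"
    using assms by (simp add: weight_decomposition_def finite_support_add)
  show "f m + g m \<in> weight_space m" for m
    using assms by (simp only: weight_decomposition_def weight_space_add)
  show "Sum_any (\<lambda>m. f m + g m) = a + b"
    using assms by (simp add: weight_decomposition_def Sum_any.distrib)
qed

lemma weight_decomposition_homogeneous:
  assumes "a \<in> weight_space k"
  shows "weight_decomposition a (\<lambda>m. if m = k then a else 0)"
  unfolding weight_decomposition_def
proof (intro conjI allI)
  show "finite {m. (if m = k then a else 0) \<noteq> 0}"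
    by (rule finite_subset[of _ "{k}"]) auto
  show "(if m = k then a else 0) \<in> weight_space m" for m
    using assms weight_space_zero by simp
qed simp

text \<open>The coordinates are weight vectors and products of weight vectors are weight vectors, so the weight
  vectors span the algebra.\<close>

lemma homogeneous_induct [case_names homogeneous add]:
  assumes hom: "\<And>m a. a \<in> weight_space m \<Longrightarrow> P a"
    and add: "\<And>a b. P a \<Longrightarrow> P b \<Longrightarrow> P (a + b)"
  shows "P a"
proof -
  let ?S = "complex_algebra.span (\<Union>m. weight_space m)"
  have spanI: "b \<in> ?S" if "b \<in> weight_space m" for b m
    using that by (blast intro: complex_algebra.span_base)
  have mult: "b * c \<in> ?S" if "b \<in> ?S" "c \<in> ?S" for b c
    using that(1)
  proof (induction b rule: complex_algebra.span_induct_alt)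
    case base
    show ?case by (simp add: complex_algebra.span_zero)
  next
    case (step k x y)
    have "x * c \<in> ?S"
      using that(2)
    proof (induction c rule: complex_algebra.span_induct_alt)
      case base
      show ?case by (simp add: complex_algebra.span_zero)
    next
      case (step l y z)
      then obtain m n where "x \<in> weight_space m" "y \<in> weight_space n"
        using \<open>x \<in> (\<Union>m. weight_space m)\<close> by blast
      then have "l *\<^sub>C (x * y) \<in> ?S"
        by (intro complex_algebra.span_scale spanI[of _ "m + n"] weight_space_mult)
      then show ?case
        using step by (simp add: distrib_left complex_algebra.span_add)
    qed
    then show ?case
      using step by (simp add: distrib_right complex_algebra.span_add complex_algebra.span_scale)
  qed
  have "a \<in> ?S" for a
    by (induction a rule: sphere_alg_induct)
      (auto intro: mult spanI coord_in_weight_space weight_space_one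
        complex_algebra.span_add complex_algebra.span_scale)
  then show ?thesis
  proof (induction a rule: complex_algebra.span_induct_alt)
    case base
    show ?case using hom weight_space_zero by blast
  next
    case (step c x y)
    then show ?case by (blast intro: add hom weight_space_scale)
  qed
qed

lemma weight_decomposition_wpart: "weight_decomposition a (wpart a)"
proof -
  have "\<exists>f. weight_decomposition a f"
    by (induction a rule: homogeneous_induct)
      (blast intro: weight_decomposition_homogeneous weight_decomposition_add)+
  then obtain f where f: "weight_decomposition a f" ..
  then show ?thesis
    unfolding wpart_def weight_decomposition_def[symmetric]
    by (rule theI[where P = "weight_decomposition a"]) (rule weight_decomposition_unique[OF _ f])
qed

lemma wpart_eqI: "weight_decomposition a f \<Longrightarrow> wpart a = f"
  by (rule weight_decomposition_unique[OF weight_decomposition_wpart])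

lemma wpart_in_weight_space: "wpart a m \<in> weight_space m"
  and finite_wpart: "finite {m. wpart a m \<noteq> 0}"
  and Sum_any_wpart: "Sum_any (wpart a) = a"
  using weight_decomposition_wpart[of a] unfolding weight_decomposition_def by blast+

lemma wpart_homogeneous: "a \<in> weight_space k \<Longrightarrow> wpart a m = (if m = k then a else 0)"
  using wpart_eqI[OF weight_decomposition_homogeneous] by metis

lemma wpart_add: "wpart (a + b) m = wpart a m + wpart b m"
  using wpart_eqI[OF weight_decomposition_add[OF weight_decomposition_wpart weight_decomposition_wpart]]
  by metis

lemma clinear_wpart: "clinear (\<lambda>a. wpart a m)"
proof (rule clinearI)
  show "wpart (c *\<^sub>C a) m = c *\<^sub>C wpart a m" for c a
    by (induction a rule: homogeneous_induct)
      (simp_all add: wpart_homogeneous wpart_homogeneous[OF weight_space_scale] wpart_add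
        scaleC_add_right)
qed (rule wpart_add)

lemma clinear_weight_eqI:
  assumes "clinear f" "clinear g" "\<And>m a. a \<in> weight_space m \<Longrightarrow> f a = g a"
  shows "f a = g a"
proof (induction a rule: homogeneous_induct)
  case (add a b)
  then show ?case using assms(1,2) by (simp add: clinear_iff)
qed (rule assms(3))

lemma finite_wpart_image:
  assumes "\<And>m. clinear (L m)"
  shows "finite {m. L m (wpart a m) \<noteq> 0}"
  by (rule finite_support_mono[OF finite_wpart[of a]]) (simp add: clinear_zero[OF assms])

text \<open>The twisted operations apply to each weight component of their argument its own linear map. The
  result is linear, and on a weight vector only one of the maps remains.\<close>

lemma
  assumes L: "\<And>m. clinear (L m)"
  shows clinear_on_weights: "clinear (\<lambda>a. Sum_any (\<lambda>m. L m (wpart a m)))"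
    and on_weights_homogeneous: "a \<in> weight_space k \<Longrightarrow> Sum_any (\<lambda>m. L m (wpart a m)) = L k a"
proof -
  show hom: "Sum_any (\<lambda>m. L m (wpart a m)) = L k a" if "a \<in> weight_space k" for a k
  proof -
    have "Sum_any (\<lambda>m. L m (wpart a m)) = (\<Sum>m\<in>{k}. L m (wpart a m))"
      by (rule Sum_any.expand_superset)
        (auto simp: wpart_homogeneous[OF that] clinear_zero[OF L] split: if_splits)
    then show ?thesis by (simp add: wpart_homogeneous[OF that])
  qed
  have add: "Sum_any (\<lambda>m. L m (wpart (a + b) m))
      = Sum_any (\<lambda>m. L m (wpart a m)) + Sum_any (\<lambda>m. L m (wpart b m))" for a b
    by (simp add: wpart_add clinear_add[OF L] Sum_any.distrib finite_wpart_image[OF L])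
  show "clinear (\<lambda>a. Sum_any (\<lambda>m. L m (wpart a m)))"
  proof (rule clinearI)
    show "Sum_any (\<lambda>m. L m (wpart (c *\<^sub>C a) m)) = c *\<^sub>C Sum_any (\<lambda>m. L m (wpart a m))" for c a
      by (induction a rule: homogeneous_induct)
        (simp_all add: hom hom[OF weight_space_scale] clinear_scaleC[OF L] add scaleC_add_right)
  qed (rule add)
qed


section \<open>The torus action\<close>

lemma wedge_add_left: "wedge (r + s) m = wedge r m + wedge s m"
  and wedge_add_right: "wedge r (m + n) = wedge r m + wedge r n"
  and wedge_minus_left: "wedge (- r) m = wedge m r"
  and wedge_minus_right: "wedge r (- m) = wedge m r"
  by (simp_all add: wedge_def algebra_simps)

lemma Fbar_add_left: "Fbar \<theta> (r + s) m = Fbar \<theta> r m * Fbar \<theta> s m"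
  unfolding Fbar_def wedge_add_left exp_add[symmetric]
  by (simp only: distrib_left distrib_right of_real_add minus_add_distrib)

lemma Fbar_add_right: "Fbar \<theta> r (m + n) = Fbar \<theta> r m * Fbar \<theta> r n"
  unfolding Fbar_def wedge_add_right exp_add[symmetric]
  by (simp only: distrib_left distrib_right of_real_add minus_add_distrib)

lemma Fbar_zero [simp]: "Fbar \<theta> 0 m = 1" "Fbar \<theta> m 0 = 1"
  by (simp_all add: Fbar_def wedge_def)

lemma Fbar_self [simp]: "Fbar \<theta> m m = 1"
  by (simp add: Fbar_def wedge_def)

lemma Fbar_minus_left: "Fbar \<theta> (- r) m = Fbar \<theta> m r"
  and Fbar_minus_right: "Fbar \<theta> r (- m) = Fbar \<theta> m r"
  by (simp_all only: Fbar_def wedge_minus_left wedge_minus_right)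

lemma Fbar_diff_left: "Fbar \<theta> (r - s) m = Fbar \<theta> r m * Fbar \<theta> m s"
  using Fbar_add_left[of \<theta> r "- s" m] by (simp add: Fbar_minus_left)

lemma Fbar_minus_param: "Fbar (- \<theta>) r m = Fbar \<theta> m r"
proof -
  have "wedge r m = - wedge m r" by (simp add: wedge_def)
  then show ?thesis by (simp add: Fbar_def)
qed

lemma Fbar_swap [simp]: "Fbar \<theta> r s * Fbar \<theta> s r = 1"
  by (metis Fbar_add_left Fbar_minus_left Fbar_zero(1) add.right_inverse)

lemma Rmat_Fbar: "Rmat \<theta> r s = Fbar \<theta> r (s + s)"
  by (simp add: Rmat_def Fbar_add_right power2_eq_square)

text \<open>With its first leg evaluated at the weight \<open>s\<close>, the inverse twist becomes an element of the torus
  generated by \<open>H\<^sub>1\<close> and \<open>H\<^sub>2\<close>. It acts by algebra automorphisms, and all twisted operations are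
  expressed by it.\<close>

definition torus :: "real \<Rightarrow> weight \<Rightarrow> OS7 \<Rightarrow> OS7" where
  "torus \<theta> s a = Sum_any (\<lambda>m. Fbar \<theta> s m *\<^sub>C wpart a m)"

lemma clinear_torus: "clinear (torus \<theta> s)"
  using clinear_on_weights[of "\<lambda>m a. Fbar \<theta> s m *\<^sub>C a"]
  by (simp add: torus_def[abs_def] clinear_scale clinear_ident)

lemma torus_homogeneous: "a \<in> weight_space m \<Longrightarrow> torus \<theta> s a = Fbar \<theta> s m *\<^sub>C a"
  using on_weights_homogeneous[of "\<lambda>m a. Fbar \<theta> s m *\<^sub>C a"]
  by (simp add: torus_def clinear_scale clinear_ident)

lemma torus_in_weight_space: "a \<in> weight_space m \<Longrightarrow> torus \<theta> s a \<in> weight_space m"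
  by (simp add: torus_homogeneous weight_space_scale)

lemmas torus_add = clinear_add[OF clinear_torus]
lemmas torus_scale = clinear_scaleC[OF clinear_torus]

lemma torus_mult: "torus \<theta> s (a * b) = torus \<theta> s a * torus \<theta> s b"
proof (induction a rule: homogeneous_induct)
  case (homogeneous m a)
  note a = this
  show ?case
  proof (induction b rule: homogeneous_induct)
    case (homogeneous n b)
    then show ?case
      using a weight_space_mult[OF a homogeneous]
      by (simp add: torus_homogeneous Fbar_add_right)
  qed (simp add: torus_add distrib_left)
qed (simp add: torus_add distrib_right)

lemma torus_torus: "torus \<theta> s (torus \<theta> r a) = torus \<theta> (s + r) a"
  by (induction a rule: homogeneous_induct)
    (simp_all add: torus_homogeneous torus_scale Fbar_add_left torus_add mult.commute)

lemma torus_zero [simp]: "torus \<theta> 0 a = a"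
  by (induction a rule: homogeneous_induct) (simp_all add: torus_homogeneous torus_add)

lemma torus_minus_cancel [simp]: "torus \<theta> (- s) (torus \<theta> s a) = a" "torus \<theta> s (torus \<theta> (- s) a) = a"
  by (simp_all add: torus_torus)

lemma torus_minus_param: "torus (- \<theta>) s a = torus \<theta> (- s) a"
  by (induction a rule: homogeneous_induct)
    (simp_all add: torus_homogeneous torus_add Fbar_minus_param Fbar_minus_left)

lemma torus_self: "a \<in> weight_space m \<Longrightarrow> torus \<theta> m a = a"
  by (simp add: torus_homogeneous)

text \<open>The coaction intertwines \<open>H\<^sub>j\<close> with \<open>H\<^sub>j \<otimes> id\<close>, because \<open>H\<^sub>j\<close> acts on the matrix \<open>zmat\<close> by a left
  multiplication. Hence the coaction preserves weights, counted in the first tensor factor.\<close>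

lemma equivariant_H1: "equivariant H1" and equivariant_H2: "equivariant H2"
proof -
  have "\<forall>g. H1 (coord g) = of_real (fst (coord_weight g)) *\<^sub>C coord g"
    "\<forall>g. H2 (coord g) = of_real (snd (coord_weight g)) *\<^sub>C coord g"
    using coord_in_weight_space by (auto simp: weight_space_def)
  note H = this[unfolded all_gen4 coord_weight_def, simplified]
  have "\<forall>g. coaction (H1 (coord g)) = first_leg H1 (coaction (coord g))"
    unfolding all_gen4
    by (simp add: H coaction_simps coaction_z clinear_add[OF clinear_first_leg[OF clinear_H1]]
        clinear_diff[OF clinear_first_leg[OF clinear_H1]] first_leg_tens[OF clinear_H1] tens_simps
        complex_algebra.scale_right_diff_distrib scaleC_add_right)
  moreover have "\<forall>g. coaction (H2 (coord g)) = first_leg H2 (coaction (coord g))"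
    unfolding all_gen4
    by (simp add: H coaction_simps coaction_z clinear_add[OF clinear_first_leg[OF clinear_H2]]
        clinear_diff[OF clinear_first_leg[OF clinear_H2]] first_leg_tens[OF clinear_H2] tens_simps
        complex_algebra.scale_right_diff_distrib scaleC_add_right)
  ultimately show "equivariant H1" "equivariant H2"
    by (auto intro!: equivariant_derivationI derivation_H1 derivation_H2)
qed

lemma
  shows wpart_H1: "wpart (H1 a) n = of_real (fst n) *\<^sub>C wpart a n"
    and wpart_H2: "wpart (H2 a) n = of_real (snd n) *\<^sub>C wpart a n"
proof -
  have 1: "wpart (of_real x *\<^sub>C a) n = of_real y *\<^sub>C wpart a n"
    if "a \<in> weight_space m" "n = m \<Longrightarrow> x = y" for a x y m
    using that by (auto simp: wpart_homogeneous clinear_scaleC[OF clinear_wpart])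
  show "wpart (H1 a) n = of_real (fst n) *\<^sub>C wpart a n"
    by (rule clinear_weight_eqI[of "\<lambda>a. wpart (H1 a) n"])
      (auto intro!: clinear_comp[OF clinear_wpart clinear_H1] clinear_scale clinear_wpart 1
        simp: weight_space_def)
  show "wpart (H2 a) n = of_real (snd n) *\<^sub>C wpart a n"
    by (rule clinear_weight_eqI[of "\<lambda>a. wpart (H2 a) n"])
      (auto intro!: clinear_comp[OF clinear_wpart clinear_H2] clinear_scale clinear_wpart 1
        simp: weight_space_def)
qed

lemma first_leg_wpart_sum:
  fixes t :: "(OS7, 'b::comm_complex_algebra) tensor"
  shows "finite {n. first_leg (\<lambda>b. wpart b n) t \<noteq> 0} \<and> Sum_any (\<lambda>n. first_leg (\<lambda>b. wpart b n) t) = t"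
proof (induction t rule: tensor_induct)
  case (tens a b)
  have "Sum_any (\<lambda>n. wpart a n \<otimes>\<^sub>C b) = Sum_any (wpart a) \<otimes>\<^sub>C b"
    by (simp add: clinear_Sum_any[OF clinear_tens_left] finite_wpart)
  moreover have "finite {n. wpart a n \<otimes>\<^sub>C b \<noteq> 0}"
    by (rule finite_support_mono[OF finite_wpart[of a]]) (simp add: tens_simps)
  ultimately show ?case by (simp add: first_leg_tens clinear_wpart Sum_any_wpart)
next
  case (add s t)
  then show ?case
    by (simp add: first_leg_plus clinear_wpart Sum_any.distrib finite_support_add)
qed

text \<open>The map \<open>H\<^sub>j \<otimes> id\<close> multiplies the coaction of \<open>a\<close> by \<open>k\<^sub>j\<close>, but its component of weight \<open>n\<close> by \<open>n\<^sub>j\<close>.\<close>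

lemma coaction_homogeneous:
  assumes a: "a \<in> weight_space k"
  shows "first_leg (\<lambda>b. wpart b n) (coaction a) = (if n = k then coaction a else 0)"
proof -
  have vanish: "first_leg (\<lambda>b. wpart b n) (coaction a) = 0" if "n \<noteq> k" for n
  proof -
    let ?t = "first_leg (\<lambda>b. wpart b n) (coaction a)"
    have eigen: "(c - c') *\<^sub>C ?t = 0"
      if h: "clinear h" "equivariant h" and "h a = c' *\<^sub>C a" "\<And>b. wpart (h b) n = c *\<^sub>C wpart b n" for h c c'
    proof -
      have "c *\<^sub>C ?t = first_leg (\<lambda>b. wpart (h b) n) (coaction a)"
        by (simp add: that first_leg_scale clinear_wpart)
      also have "\<dots> = first_leg (\<lambda>b. wpart b n) (first_leg h (coaction a))"
        by (rule first_leg_comp[OF clinear_wpart h(1)])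
      also have "first_leg h (coaction a) = c' *\<^sub>C coaction a"
        by (simp add: equivariantD[OF h(2), symmetric] that coaction_simps)
      finally show ?thesis
        by (simp add: clinear_scaleC[OF clinear_first_leg[OF clinear_wpart]]
            complex_algebra.scale_left_diff_distrib)
    qed
    \<comment> \<open>The weights differ in one of their coordinates.\<close>
    have "(of_real (fst n) - of_real (fst k)) *\<^sub>C ?t = 0"
      by (rule eigen[OF clinear_H1 equivariant_H1 _ wpart_H1]) (use a in \<open>simp add: weight_space_def\<close>)
    moreover have "(of_real (snd n) - of_real (snd k)) *\<^sub>C ?t = 0"
      by (rule eigen[OF clinear_H2 equivariant_H2 _ wpart_H2]) (use a in \<open>simp add: weight_space_def\<close>)
    ultimately show ?thesis using that by (auto simp: prod_eq_iff)
  qed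
  have "coaction a = Sum_any (\<lambda>n. first_leg (\<lambda>b. wpart b n) (coaction a))"
    by (simp add: first_leg_wpart_sum)
  also have "\<dots> = (\<Sum>n\<in>{k}. first_leg (\<lambda>b. wpart b n) (coaction a))"
    by (rule Sum_any.expand_superset) (use vanish in auto)
  finally show ?thesis using vanish by simp
qed

text \<open>The coaction of a vector of weight \<open>k\<close> lies in the tensors whose first factor has weight \<open>k\<close>, where
  \<open>v\<close> and \<open>u k\<close> agree.\<close>

lemma equivariant_on_weightsI:
  assumes v: "clinear v" and u: "\<And>k. clinear (u k)" "\<And>k. equivariant (u k)"
    and agree: "\<And>k a. a \<in> weight_space k \<Longrightarrow> v a = u k a"
  shows "equivariant v"
  unfolding equivariant_def
proof
  fix a
  show "coaction (v a) = first_leg v (coaction a)"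
  proof (rule clinear_weight_eqI[of "\<lambda>a. coaction (v a)"])
    show "clinear (\<lambda>a. coaction (v a))" "clinear (\<lambda>a. first_leg v (coaction a))"
      by (simp_all add: clinear_comp clinear_coaction clinear_first_leg v)
    fix k a assume a: "a \<in> weight_space k"
    have first_leg_wpart: "first_leg w (coaction a) = first_leg (\<lambda>b. w (wpart b k)) (coaction a)"
      if "clinear w" for w
      using coaction_homogeneous[OF a, of k] by (simp add: first_leg_comp[OF that clinear_wpart])
    have "coaction (v a) = first_leg (u k) (coaction a)"
      by (simp add: agree[OF a] equivariantD[OF u(2)])
    then show "coaction (v a) = first_leg v (coaction a)"
      by (simp add: first_leg_wpart[OF v] first_leg_wpart[OF u(1)] agree[OF wpart_in_weight_space])
  qed
qed

lemma equivariant_ident: "equivariant (\<lambda>a. a)"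
proof -
  have "first_leg (\<lambda>a. a) t = t" for t :: "(OS7, OSU2) tensor"
    by (induction t rule: tensor_induct) (simp_all add: first_leg_tens first_leg_plus clinear_ident)
  then show ?thesis by (simp add: equivariant_def)
qed

lemma equivariant_wpart: "equivariant (\<lambda>a. wpart a m)"
proof (rule equivariant_on_weightsI)
  show "clinear (\<lambda>a. (if m = k then 1 else 0) *\<^sub>C a)" "equivariant (\<lambda>a. (if m = k then 1 else 0) *\<^sub>C a)" for k
    using equivariant_scale[OF clinear_ident equivariant_ident] by (auto simp: clinear_intros)
  show "wpart a m = (if m = k then 1 else 0) *\<^sub>C a" if "a \<in> weight_space k" for a k
    using that by (simp add: wpart_homogeneous)
qed (rule clinear_wpart)

lemma equivariant_torus: "equivariant (torus \<theta> s)"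
proof (rule equivariant_on_weightsI)
  show "clinear (\<lambda>a. Fbar \<theta> s k *\<^sub>C a)" "equivariant (\<lambda>a. Fbar \<theta> s k *\<^sub>C a)" for k
    using equivariant_scale[OF clinear_ident equivariant_ident] by (auto simp: clinear_intros)
  show "torus \<theta> s a = Fbar \<theta> s k *\<^sub>C a" if "a \<in> weight_space k" for a k
    using that by (rule torus_homogeneous)
qed (rule clinear_torus)

lemma OS4_equivariant_image:
  assumes "clinear u" "equivariant u" "b \<in> OS4"
  shows "u b \<in> OS4"
  using assms equivariantD[OF assms(2)] by (simp add: OS4_iff first_leg_tens)

lemmas OS4_wpart = OS4_equivariant_image[OF clinear_wpart equivariant_wpart]
lemmas OS4_torus = OS4_equivariant_image[OF clinear_torus equivariant_torus]


section \<open>Weight components of linear maps\<close>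

text \<open>The commutators with \<open>H\<^sub>j\<close> prescribe by how much the map shifts the eigenvalues of \<open>H\<^sub>j\<close>.\<close>

lemma weight_map_iff:
  "weight_map r u \<longleftrightarrow> clinear u \<and> (\<forall>m. \<forall>a\<in>weight_space m. u a \<in> weight_space (m + r))"
proof (intro iffI conjI allI ballI; (elim conjE)?)
  assume u: "weight_map r u"
  then show lin: "clinear u" by (simp add: weight_map_def)
  fix m a assume a: "a \<in> weight_space m"
  have eigen: "h (u a) = (x + y) *\<^sub>C u a"
    if "commutator h u = (\<lambda>a. y *\<^sub>C u a)" "h a = x *\<^sub>C a" for h x y
  proof -
    have "h (u a) - u (h a) = y *\<^sub>C u a"
      using that(1) by (metis commutator_def)
    then have "h (u a) = x *\<^sub>C u a + y *\<^sub>C u a"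
      by (simp add: that(2) clinear_scaleC[OF lin] algebra_simps)
    then show ?thesis by (simp add: scaleC_add_left)
  qed
  show "u a \<in> weight_space (m + r)"
    using u a eigen[of H1 _ "of_real (fst m)"] eigen[of H2 _ "of_real (snd m)"]
    by (simp add: weight_map_def weight_space_def)
next
  assume lin: "clinear u" and w: "\<forall>m. \<forall>a\<in>weight_space m. u a \<in> weight_space (m + r)"
  have eigen: "commutator h u = (\<lambda>a. y *\<^sub>C u a)"
    if h: "clinear h"
      and eig: "\<And>m a. a \<in> weight_space m \<Longrightarrow> h a = x m *\<^sub>C a \<and> h (u a) = (x m + y) *\<^sub>C u a" for h x y
  proof
    show "commutator h u a = y *\<^sub>C u a" for a
    proof (rule clinear_weight_eqI[of "commutator h u"])
      show "clinear (commutator h u)" "clinear (\<lambda>a. y *\<^sub>C u a)"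
        unfolding commutator_def
        by (intro clinear_subtract clinear_comp[OF lin] clinear_comp[OF h] clinear_scale lin h)+
      show "commutator h u a = y *\<^sub>C u a" if "a \<in> weight_space m" for m a
        using eig[OF that]
        by (simp add: commutator_def clinear_scaleC[OF lin] scaleC_add_left)
    qed
  qed
  have "h a = x m *\<^sub>C a \<and> h (u a) = (x m + y) *\<^sub>C u a"
    if a: "a \<in> weight_space m" and h: "h = H1 \<and> x = (\<lambda>m. of_real (fst m)) \<and> y = of_real (fst r) \<or>
      h = H2 \<and> x = (\<lambda>m. of_real (snd m)) \<and> y = of_real (snd r)" for m a h x y
  proof -
    have "u a \<in> weight_space (m + r)" using w a by blast
    then show ?thesis using a h by (auto simp: weight_space_def)
  qed
  note eig = this
  show "weight_map r u"
    unfolding weight_map_def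
  proof (intro conjI lin)
    show "commutator H1 u = (\<lambda>a. of_real (fst r) *\<^sub>C u a)"
      by (rule eigen[OF clinear_H1, of "\<lambda>m. of_real (fst m)"], rule eig) simp_all
    show "commutator H2 u = (\<lambda>a. of_real (snd r) *\<^sub>C u a)"
      by (rule eigen[OF clinear_H2, of "\<lambda>m. of_real (snd m)"], rule eig) simp_all
  qed
qed

lemma weight_map_clinear: "weight_map r u \<Longrightarrow> clinear u"
  by (simp add: weight_map_def)

lemma weight_mapD: "weight_map r u \<Longrightarrow> a \<in> weight_space m \<Longrightarrow> u a \<in> weight_space (m + r)"
  using weight_map_iff by blast

lemma weight_map_zero: "weight_map r (\<lambda>a. 0)"
  using weight_map_iff clinear_zero_map weight_space_zero by blast

definition map_decomposition :: "(OS7 \<Rightarrow> OS7) \<Rightarrow> (weight \<Rightarrow> OS7 \<Rightarrow> OS7) \<Rightarrow> bool" where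
  "map_decomposition u f \<longleftrightarrow> (\<forall>r. weight_map r (f r)) \<and>
     (\<forall>a. finite {r. f r a \<noteq> 0} \<and> Sum_any (\<lambda>r. f r a) = u a)"

lemma finite_support_shift:
  fixes f :: "weight \<Rightarrow> 'a::zero"
  shows "finite {n. f n \<noteq> 0} \<Longrightarrow> finite {r. f (r + m) \<noteq> 0}"
  using finite_vimageI[of "{n. f n \<noteq> 0}" "\<lambda>r. r + m"] by (simp add: vimage_def)

lemma Sum_any_shift: "Sum_any (\<lambda>r. f (r + m)) = Sum_any f" for m :: weight
proof -
  have "bij (\<lambda>r. r + m)" by (rule bij_betw_byWitness[of _ "\<lambda>r. r - m"]) auto
  then show ?thesis by (intro Sum_any.reindex_cong[symmetric]) (auto simp: fun_eq_iff)
qed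

text \<open>The components of \<open>u\<close> are unique, because on a vector of weight \<open>m\<close> the component of weight \<open>r\<close> has
  to produce the part of \<open>u a\<close> of weight \<open>m + r\<close>.\<close>

lemma map_decomposition_homogeneous:
  assumes f: "map_decomposition u f" and a: "a \<in> weight_space m"
  shows "f r a = wpart (u a) (m + r)"
proof -
  have f_weight: "weight_map r (f r)" and f_fin: "finite {r. f r a \<noteq> 0}"
    and f_sum: "Sum_any (\<lambda>r. f r a) = u a" for r
    using f unfolding map_decomposition_def by blast+
  have "weight_decomposition (u a) (\<lambda>n. f (n - m) a)"
    unfolding weight_decomposition_def
  proof (intro conjI allI)
    show "f (n - m) a \<in> weight_space n" for n
      using weight_mapD[OF f_weight a, of "n - m"] by simp
    show "finite {n. f (n - m) a \<noteq> 0}"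
      using finite_support_shift[OF f_fin, of "- m"] by simp
    show "Sum_any (\<lambda>n. f (n - m) a) = u a"
      using f_sum Sum_any_shift[of "\<lambda>r. f r a" "- m"] by simp
  qed
  from wpart_eqI[OF this] show ?thesis by simp
qed

lemma mpart_eqI:
  assumes "map_decomposition u f"
  shows "mpart u = f"
  unfolding mpart_def map_decomposition_def[symmetric]
proof (rule the_equality[where P = "map_decomposition u", OF assms])
  fix g assume g: "map_decomposition u g"
  have lin: "clinear (f r)" "clinear (g r)" for r
    using assms g unfolding map_decomposition_def by (blast intro: weight_map_clinear)+
  have "g r a = f r a" for r a
    by (rule clinear_weight_eqI[OF lin(2,1)])
      (simp add: map_decomposition_homogeneous[OF g] map_decomposition_homogeneous[OF assms])
  then show "g = f" by blast
qed

lemma map_decomposition_mpart: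
  assumes u: "clinear u"
  shows "map_decomposition u (mpart u)"
proof -
  let ?f = "\<lambda>r a. Sum_any (\<lambda>m. wpart (u (wpart a m)) (m + r))"
  have lin: "clinear (\<lambda>a. wpart (u a) (m + r))" for m r
    by (rule clinear_comp[OF clinear_wpart u])
  note f = on_weights_homogeneous[of "\<lambda>m a. wpart (u a) (m + r)" for r, OF lin]
  have f_lin: "clinear (?f r)" for r
    by (rule clinear_on_weights[of "\<lambda>m a. wpart (u a) (m + r)", OF lin])
  have decomp: "map_decomposition u ?f"
    unfolding map_decomposition_def
  proof (intro conjI allI)
    show "weight_map r (?f r)" for r
      unfolding weight_map_iff using f_lin by (simp add: f wpart_in_weight_space)
    have sum: "finite {r. ?f r a \<noteq> 0} \<and> Sum_any (\<lambda>r. ?f r a) = u a" for a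
    proof (induction a rule: homogeneous_induct)
      case (homogeneous m a)
      show ?case
        unfolding f[OF homogeneous]
        using finite_support_shift[OF finite_wpart[of "u a"], of m]
          Sum_any_shift[of "wpart (u a)" m] Sum_any_wpart[of "u a"]
        by (simp add: add.commute)
    next
      case (add a b)
      then show ?case
        by (simp add: clinear_add[OF f_lin] clinear_add[OF u] finite_support_add Sum_any.distrib)
    qed
    show "finite {r. ?f r a \<noteq> 0}" "Sum_any (\<lambda>r. ?f r a) = u a" for a
      using sum by blast+
  qed
  show ?thesis unfolding mpart_eqI[OF decomp] by (rule decomp)
qed

context
  fixes u :: "OS7 \<Rightarrow> OS7"
  assumes u: "clinear u"
begin

lemma weight_map_mpart: "weight_map r (mpart u r)"
  and finite_mpart: "finite {r. mpart u r a \<noteq> 0}"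
  and Sum_any_mpart: "Sum_any (\<lambda>r. mpart u r a) = u a"
  using map_decomposition_mpart[OF u] unfolding map_decomposition_def by blast+

lemmas clinear_mpart = weight_map_clinear[OF weight_map_mpart]
lemmas mpart_in_weight_space = weight_mapD[OF weight_map_mpart]

end

lemma mpart_weight_map:
  assumes "weight_map r u"
  shows "mpart u s a = (if s = r then u a else 0)"
proof -
  have "map_decomposition u (\<lambda>s a. if s = r then u a else 0)"
    unfolding map_decomposition_def
  proof (intro conjI allI)
    show "weight_map s (\<lambda>a. if s = r then u a else 0)" for s
      using assms weight_map_zero by (cases "s = r") auto
    show "finite {s. (if s = r then u a else 0) \<noteq> 0}" for a
      by (rule finite_subset[of _ "{r}"]) auto
  qed simp
  then show ?thesis by (simp add: mpart_eqI)
qed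

lemma mpart_add:
  assumes u: "clinear u" and v: "clinear v"
  shows "mpart (\<lambda>a. u a + v a) r a = mpart u r a + mpart v r a"
proof -
  have "map_decomposition (\<lambda>a. u a + v a) (\<lambda>r a. mpart u r a + mpart v r a)"
    unfolding map_decomposition_def
  proof (intro conjI allI)
    show "weight_map r (\<lambda>a. mpart u r a + mpart v r a)" for r
      unfolding weight_map_iff
      by (auto intro: clinear_plus clinear_mpart u v weight_space_add mpart_in_weight_space)
  qed (simp_all add: finite_support_add finite_mpart Sum_any.distrib Sum_any_mpart u v)
  then show ?thesis by (simp add: mpart_eqI)
qed

text \<open>Letting a torus element act on all weight components of a map conjugates the map.\<close>

lemma Sum_any_Fbar_mpart:
  assumes u: "clinear u"
  shows "Sum_any (\<lambda>r. Fbar \<theta> r m *\<^sub>C mpart u r a) = torus \<theta> (- m) (u (torus \<theta> m a))"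
proof (induction a rule: homogeneous_induct)
  case (homogeneous k a)
  have part: "Fbar \<theta> m k *\<^sub>C torus \<theta> (- m) (mpart u r a) = Fbar \<theta> r m *\<^sub>C mpart u r a" for r
    by (simp add: torus_homogeneous[OF mpart_in_weight_space[OF u homogeneous]] Fbar_minus_left
        Fbar_add_left)
  have "torus \<theta> (- m) (u (torus \<theta> m a)) = Fbar \<theta> m k *\<^sub>C torus \<theta> (- m) (Sum_any (\<lambda>r. mpart u r a))"
    by (simp add: torus_homogeneous[OF homogeneous] clinear_scaleC[OF u] torus_scale Sum_any_mpart[OF u])
  also have "\<dots> = Sum_any (\<lambda>r. Fbar \<theta> m k *\<^sub>C torus \<theta> (- m) (mpart u r a))"
    by (rule clinear_Sum_any[OF clinear_scale[OF clinear_torus] finite_mpart[OF u]])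
  finally show ?case by (simp only: part)
next
  case (add a b)
  have "finite {r. Fbar \<theta> r m *\<^sub>C mpart u r a \<noteq> 0}" for a
    by (rule finite_support_mono[OF finite_mpart[OF u, of a]]) simp
  then show ?case
    using add
    by (simp add: clinear_add[OF clinear_mpart[OF u]] torus_add clinear_add[OF u] scaleC_add_right
        Sum_any.distrib)
qed

lemma Sum_any_swap_support:
  fixes f :: "'i \<Rightarrow> 'j \<Rightarrow> 'a::comm_monoid_add"
  assumes J: "finite J" "\<And>i j. j \<notin> J \<Longrightarrow> f i j = 0" and I: "\<And>j. finite {i. f i j \<noteq> 0}"
  shows "Sum_any (\<lambda>i. Sum_any (\<lambda>j. f i j)) = Sum_any (\<lambda>j. Sum_any (\<lambda>i. f i j))"
proof (rule Sum_any.swap)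
  show "finite ((\<Union>j\<in>J. {i. f i j \<noteq> 0}) \<times> J)" using J I by blast
  show "{i. \<exists>j. f i j \<noteq> 0} \<times> {j. \<exists>i. f i j \<noteq> 0} \<subseteq> (\<Union>j\<in>J. {i. f i j \<noteq> 0}) \<times> J"
    using J(2) by blast
qed


section \<open>The twist as a torus action\<close>

text \<open>The sum over the weights of \<open>u\<close> conjugates \<open>u\<close> by \<open>torus \<theta> m\<close>, and \<open>torus \<theta> m\<close> fixes the vectors of
  weight \<open>m\<close>.\<close>

lemma Dtwist_torus:
  assumes u: "clinear u"
  shows "Dtwist \<theta> u a = Sum_any (\<lambda>m. torus \<theta> (- m) (u (wpart a m)))"
proof -
  have "Dtwist \<theta> u a = Sum_any (\<lambda>m. Sum_any (\<lambda>r. Fbar \<theta> r m *\<^sub>C mpart u r (wpart a m)))"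
    unfolding Dtwist_def
  proof (rule Sum_any_swap_support[OF finite_wpart[of a]])
    show "Fbar \<theta> r m *\<^sub>C mpart u r (wpart a m) = 0" if "m \<notin> {m. wpart a m \<noteq> 0}" for r m
      using that by (simp add: clinear_zero[OF clinear_mpart[OF u]])
    show "finite {r. Fbar \<theta> r m *\<^sub>C mpart u r (wpart a m) \<noteq> 0}" for m
      by (rule finite_support_mono[OF finite_mpart[OF u, of "wpart a m"]]) simp
  qed
  then show ?thesis
    by (simp add: Sum_any_Fbar_mpart[OF u] torus_self[OF wpart_in_weight_space])
qed

lemma
  assumes u: "clinear u"
  shows clinear_Dtwist: "clinear (Dtwist \<theta> u)"
    and Dtwist_homogeneous: "a \<in> weight_space m \<Longrightarrow> Dtwist \<theta> u a = torus \<theta> (- m) (u a)"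
proof -
  have lin: "clinear (\<lambda>a. torus \<theta> (- m) (u a))" for m
    by (rule clinear_comp[OF clinear_torus u])
  show "clinear (Dtwist \<theta> u)"
    using clinear_on_weights[of "\<lambda>m a. torus \<theta> (- m) (u a)", OF lin]
    by (simp add: Dtwist_torus[OF u, abs_def])
  show "Dtwist \<theta> u a = torus \<theta> (- m) (u a)" if "a \<in> weight_space m"
    using on_weights_homogeneous[of "\<lambda>m a. torus \<theta> (- m) (u a)", OF lin that]
    by (simp add: Dtwist_torus[OF u])
qed

lemma Dtwist_weight_map:
  assumes u: "weight_map r u" and a: "a \<in> weight_space m"
  shows "Dtwist \<theta> u a = Fbar \<theta> r m *\<^sub>C u a"
  by (simp add: Dtwist_homogeneous[OF weight_map_clinear[OF u] a] torus_homogeneous[OF weight_mapD[OF u a]]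
      Fbar_minus_left Fbar_add_left)

lemma weight_map_Dtwist:
  assumes u: "weight_map r u"
  shows "weight_map r (Dtwist \<theta> u)"
  unfolding weight_map_iff
  using clinear_Dtwist[OF weight_map_clinear[OF u]]
  by (simp add: Dtwist_weight_map[OF u] weight_space_scale weight_mapD[OF u])

lemma Dtwist_minus_Dtwist:
  assumes u: "clinear u"
  shows "Dtwist \<theta> (Dtwist (- \<theta>) u) = u"
proof
  show "Dtwist \<theta> (Dtwist (- \<theta>) u) a = u a" for a
    by (rule clinear_weight_eqI[OF clinear_Dtwist[OF clinear_Dtwist[OF u]] u])
      (simp add: Dtwist_homogeneous[OF clinear_Dtwist[OF u]] Dtwist_homogeneous[OF u] torus_minus_param)
qed

lemma Dtwist_sum:
  assumes u: "\<And>i. i \<in> I \<Longrightarrow> clinear (u i)"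
  shows "Dtwist \<theta> (\<lambda>a. \<Sum>i\<in>I. u i a) = (\<lambda>a. \<Sum>i\<in>I. Dtwist \<theta> (u i) a)"
proof
  have lin: "clinear (\<lambda>a. \<Sum>i\<in>I. u i a)" by (intro clinear_sum_map u)
  show "Dtwist \<theta> (\<lambda>a. \<Sum>i\<in>I. u i a) a = (\<Sum>i\<in>I. Dtwist \<theta> (u i) a)" for a
    by (rule clinear_weight_eqI[OF clinear_Dtwist[OF lin]])
      (auto simp: Dtwist_homogeneous[OF lin] Dtwist_homogeneous[OF u] clinear_sum[OF clinear_torus]
        intro!: clinear_sum_map clinear_Dtwist u)
qed

lemma tprod_torus: "a \<star>\<^bsub>\<theta>\<^esub> b = Sum_any (\<lambda>s. wpart a s * torus \<theta> s b)"
proof -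
  have "finite {m. Fbar \<theta> s m *\<^sub>C wpart b m \<noteq> 0}" for s
    by (rule finite_support_mono[OF finite_wpart[of b]]) simp
  then have "wpart a s * torus \<theta> s b = Sum_any (\<lambda>m. wpart a s * Fbar \<theta> s m *\<^sub>C wpart b m)" for s
    unfolding torus_def by (rule clinear_Sum_any[OF clinear_mult_left[OF clinear_ident]])
  then show ?thesis by (simp add: tprod_def)
qed

lemma clinear_tprod_left: "clinear (\<lambda>a. a \<star>\<^bsub>\<theta>\<^esub> b)"
  unfolding tprod_torus
  by (rule clinear_on_weights) (rule clinear_mult_right[OF clinear_ident])

lemma tprod_homogeneous_left: "a \<in> weight_space s \<Longrightarrow> a \<star>\<^bsub>\<theta>\<^esub> b = a * torus \<theta> s b"
  unfolding tprod_torus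
  by (rule on_weights_homogeneous) (rule clinear_mult_right[OF clinear_ident])

lemmas tprod_add_left = clinear_add[OF clinear_tprod_left]
lemmas tprod_scale_left = clinear_scaleC[OF clinear_tprod_left]
lemmas tprod_zero_left = clinear_zero[OF clinear_tprod_left]

lemma clinear_tprod_right: "clinear (\<lambda>b. a \<star>\<^bsub>\<theta>\<^esub> b)"
proof (induction a rule: homogeneous_induct)
  case (homogeneous m a)
  then show ?case
    by (simp add: tprod_homogeneous_left clinear_mult_left clinear_torus)
qed (simp add: tprod_add_left clinear_plus)

lemmas tprod_add_right = clinear_add[OF clinear_tprod_right]
lemmas tprod_diff_right = clinear_diff[OF clinear_tprod_right]
lemmas tprod_scale_right = clinear_scaleC[OF clinear_tprod_right]
lemmas tprod_zero_right = clinear_zero[OF clinear_tprod_right]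

lemma tprod_homogeneous_right: "b \<in> weight_space m \<Longrightarrow> a \<star>\<^bsub>\<theta>\<^esub> b = torus \<theta> (- m) a * b"
  by (induction a rule: homogeneous_induct)
    (simp_all add: tprod_homogeneous_left torus_homogeneous Fbar_minus_left tprod_add_left torus_add
      distrib_right)

text \<open>The automorphisms \<open>torus \<theta> s\<close> preserve weights, hence they are automorphisms of the twisted product
  as well.\<close>

lemma torus_tprod: "torus \<theta> s (a \<star>\<^bsub>\<theta>\<^esub> b) = torus \<theta> s a \<star>\<^bsub>\<theta>\<^esub> torus \<theta> s b"
proof (induction a rule: homogeneous_induct)
  case (homogeneous m a)
  show ?case
    using tprod_homogeneous_left[OF torus_in_weight_space[OF homogeneous]]
    by (simp add: tprod_homogeneous_left[OF homogeneous] torus_mult torus_torus add.commute)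
qed (simp add: tprod_add_left torus_add)

lemma tprod_in_weight_space:
  "a \<in> weight_space m \<Longrightarrow> b \<in> weight_space n \<Longrightarrow> a \<star>\<^bsub>\<theta>\<^esub> b \<in> weight_space (m + n)"
  by (simp add: tprod_homogeneous_left weight_space_mult torus_in_weight_space)

lemma tprod_assoc: "(a \<star>\<^bsub>\<theta>\<^esub> b) \<star>\<^bsub>\<theta>\<^esub> c = a \<star>\<^bsub>\<theta>\<^esub> (b \<star>\<^bsub>\<theta>\<^esub> c)"
proof (induction a rule: homogeneous_induct)
  case (homogeneous m a)
  note a = this
  show ?case
  proof (induction b rule: homogeneous_induct)
    case (homogeneous n b)
    show ?case
      unfolding tprod_homogeneous_left[OF tprod_in_weight_space[OF a homogeneous]]
      unfolding tprod_homogeneous_left[OF a] tprod_homogeneous_left[OF homogeneous]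
      by (simp only: torus_mult torus_torus mult.assoc)
  qed (simp add: tprod_add_left tprod_add_right)
qed (simp add: tprod_add_left)

section \<open>Twisting the gauge algebra\<close>

text \<open>The gauge algebra of the bundle before twisting.\<close>

definition gauge_algebra :: "(OS7 \<Rightarrow> OS7) set" where
  "gauge_algebra = {u. derivation u \<and> equivariant u \<and> (\<forall>b\<in>OS4. u b = 0)}"

text \<open>Since \<open>R\<close> is the square of the inverse twist, it conjugates by \<open>torus \<theta> (m + m)\<close>.\<close>

lemma braided_Leibniz_sum:
  assumes u: "clinear u"
  shows "Sum_any (\<lambda>m. Sum_any (\<lambda>r. Rmat \<theta> r m *\<^sub>C (wpart a m \<star>\<^bsub>\<theta>\<^esub> mpart u r a')))
    = Sum_any (\<lambda>m. wpart a m \<star>\<^bsub>\<theta>\<^esub> torus \<theta> (- (m + m)) (u (torus \<theta> (m + m) a')))"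
proof -
  have "finite {r. Fbar \<theta> r m *\<^sub>C mpart u r a' \<noteq> 0}" for m
    by (rule finite_support_mono[OF finite_mpart[OF u, of a']]) simp
  then have "Sum_any (\<lambda>r. b \<star>\<^bsub>\<theta>\<^esub> (Fbar \<theta> r m *\<^sub>C mpart u r a'))
      = b \<star>\<^bsub>\<theta>\<^esub> torus \<theta> (- m) (u (torus \<theta> m a'))" for b m
    by (simp add: Sum_any_Fbar_mpart[OF u, symmetric] clinear_Sum_any[OF clinear_tprod_right])
  then show ?thesis by (simp add: Rmat_Fbar tprod_scale_right)
qed

text \<open>On homogeneous \<open>a\<close> the braided Leibniz rule can be written with the untwisted product in
  place of \<open>a \<bullet> a'\<close>.\<close>

lemma aut_iff:
  "u \<in> aut \<theta> \<longleftrightarrow> clinear u \<and> equivariant u \<and> (\<forall>b\<in>OS4. u b = 0) \<and>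
     (\<forall>m. \<forall>a\<in>weight_space m. \<forall>y.
        u (a * y) = u a \<star>\<^bsub>\<theta>\<^esub> torus \<theta> (- m) y + a * torus \<theta> (- m) (u (torus \<theta> m y)))"
proof (cases "clinear u")
  case u: True
  have braided: "(\<forall>a a'. u (a \<star>\<^bsub>\<theta>\<^esub> a') = u a \<star>\<^bsub>\<theta>\<^esub> a' +
        Sum_any (\<lambda>m. Sum_any (\<lambda>r. Rmat \<theta> r m *\<^sub>C (wpart a m \<star>\<^bsub>\<theta>\<^esub> mpart u r a'))))
    \<longleftrightarrow> (\<forall>m. \<forall>a\<in>weight_space m. \<forall>y.
        u (a * y) = u a \<star>\<^bsub>\<theta>\<^esub> torus \<theta> (- m) y + a * torus \<theta> (- m) (u (torus \<theta> m y)))"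
    (is "?L \<longleftrightarrow> ?R")
    unfolding braided_Leibniz_sum[OF u]
  proof (intro iffI allI ballI)
    note on_w = on_weights_homogeneous[of "\<lambda>m a. a \<star>\<^bsub>\<theta>\<^esub> c m" for c, OF clinear_tprod_left]
      clinear_on_weights[of "\<lambda>m a. a \<star>\<^bsub>\<theta>\<^esub> c m" for c, OF clinear_tprod_left]
    {
      fix m a y
      assume L: "\<forall>a a'. u (a \<star>\<^bsub>\<theta>\<^esub> a') = u a \<star>\<^bsub>\<theta>\<^esub> a' +
          Sum_any (\<lambda>m. wpart a m \<star>\<^bsub>\<theta>\<^esub> torus \<theta> (- (m + m)) (u (torus \<theta> (m + m) a')))"
        and a: "a \<in> weight_space m"
      show "u (a * y) = u a \<star>\<^bsub>\<theta>\<^esub> torus \<theta> (- m) y + a * torus \<theta> (- m) (u (torus \<theta> m y))"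
        using L[rule_format, of a "torus \<theta> (- m) y"]
        by (simp add: on_w(1)[OF a] tprod_homogeneous_left[OF a] torus_torus)
    next
      fix a a'
      assume R: "\<forall>m. \<forall>a\<in>weight_space m. \<forall>y.
          u (a * y) = u a \<star>\<^bsub>\<theta>\<^esub> torus \<theta> (- m) y + a * torus \<theta> (- m) (u (torus \<theta> m y))"
      show "u (a \<star>\<^bsub>\<theta>\<^esub> a') = u a \<star>\<^bsub>\<theta>\<^esub> a' +
          Sum_any (\<lambda>m. wpart a m \<star>\<^bsub>\<theta>\<^esub> torus \<theta> (- (m + m)) (u (torus \<theta> (m + m) a')))"
      proof (rule clinear_weight_eqI[of "\<lambda>a. u (a \<star>\<^bsub>\<theta>\<^esub> a')"])
        show "clinear (\<lambda>a. u (a \<star>\<^bsub>\<theta>\<^esub> a'))"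
          by (rule clinear_comp[OF u clinear_tprod_left])
        show "clinear (\<lambda>a. u a \<star>\<^bsub>\<theta>\<^esub> a' +
            Sum_any (\<lambda>m. wpart a m \<star>\<^bsub>\<theta>\<^esub> torus \<theta> (- (m + m)) (u (torus \<theta> (m + m) a'))))"
          by (intro clinear_plus clinear_comp[OF clinear_tprod_left u] on_w(2))
        fix m a assume a: "a \<in> weight_space m"
        show "u (a \<star>\<^bsub>\<theta>\<^esub> a') = u a \<star>\<^bsub>\<theta>\<^esub> a' +
            Sum_any (\<lambda>m. wpart a m \<star>\<^bsub>\<theta>\<^esub> torus \<theta> (- (m + m)) (u (torus \<theta> (m + m) a')))"
          using R[rule_format, OF a, of "torus \<theta> m a'"]
          by (simp add: on_w(1)[OF a] tprod_homogeneous_left[OF a] torus_torus)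
      qed
    }
  qed
  show ?thesis
    unfolding aut_def mem_Collect_eq braided equivariant_def first_leg_def by blast
qed (simp add: aut_def)

context
  fixes \<theta> :: real and u :: "OS7 \<Rightarrow> OS7"
  assumes u: "u \<in> aut \<theta>"
begin

lemma aut_clinear: "clinear u"
  and aut_equivariant: "equivariant u"
  and aut_OS4: "b \<in> OS4 \<Longrightarrow> u b = 0"
  and aut_mult: "a \<in> weight_space m \<Longrightarrow>
    u (a * y) = u a \<star>\<^bsub>\<theta>\<^esub> torus \<theta> (- m) y + a * torus \<theta> (- m) (u (torus \<theta> m y))"
  using u unfolding aut_iff by blast+

lemma aut_tprod_OS4:
  assumes b: "b \<in> OS4" "b \<in> weight_space k"
  shows "u (b \<star>\<^bsub>\<theta>\<^esub> y) = b \<star>\<^bsub>\<theta>\<^esub> torus \<theta> (- (k + k)) (u (torus \<theta> (k + k) y))"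
  using aut_mult[OF b(2), of "torus \<theta> k y"]
  by (simp add: tprod_homogeneous_left[OF b(2)] aut_OS4[OF b(1)] tprod_zero_left torus_torus)

end

lemma equivariant_Dtwist:
  assumes "clinear u" "equivariant u"
  shows "equivariant (Dtwist \<theta> u)"
proof (rule equivariant_on_weightsI[OF clinear_Dtwist[OF assms(1)]])
  show "clinear (\<lambda>a. torus \<theta> (- k) (u a))" for k
    by (rule clinear_comp[OF clinear_torus assms(1)])
  show "equivariant (\<lambda>a. torus \<theta> (- k) (u a))" for k
    by (rule equivariant_comp[OF clinear_torus assms(1) equivariant_torus assms(2)])
qed (rule Dtwist_homogeneous[OF assms(1)])

lemma Dtwist_kills_OS4:
  assumes "clinear u" "\<And>b. b \<in> OS4 \<Longrightarrow> u b = 0" "b \<in> OS4"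
  shows "Dtwist \<theta> u b = 0"
  by (simp add: Dtwist_torus[OF assms(1)] assms(2)[OF OS4_wpart[OF assms(3)]] clinear_zero[OF clinear_torus])

text \<open>For \<open>a\<close> of weight \<open>m\<close> and \<open>y\<close> of weight \<open>n\<close>, apply the torus element \<open>- (m + n)\<close>, respectively
  its inverse, to the Leibniz rule for \<open>a y\<close>. It acts on \<open>a\<close> and on \<open>y\<close> by inverse scalars, and these
  are the scalars that occur in the product and in the braiding.\<close>

lemma Dtwist_gauge_algebra:
  assumes "u \<in> gauge_algebra"
  shows "Dtwist \<theta> u \<in> aut \<theta>"
proof -
  have der: "derivation u" and equi: "equivariant u" and vert: "\<And>b. b \<in> OS4 \<Longrightarrow> u b = 0"
    using assms by (auto simp: gauge_algebra_def)
  note u = derivation_clinear[OF der]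
  let ?D = "Dtwist \<theta> u"
  have "?D (a * y) = ?D a \<star>\<^bsub>\<theta>\<^esub> torus \<theta> (- m) y + a * torus \<theta> (- m) (?D (torus \<theta> m y))"
    if a: "a \<in> weight_space m" for m a y
  proof (rule clinear_weight_eqI[of "\<lambda>y. ?D (a * y)"])
    show "clinear (\<lambda>y. ?D (a * y))"
      by (intro clinear_comp[OF clinear_Dtwist[OF u]] clinear_mult_left clinear_ident)
    show "clinear (\<lambda>y. ?D a \<star>\<^bsub>\<theta>\<^esub> torus \<theta> (- m) y + a * torus \<theta> (- m) (?D (torus \<theta> m y)))"
      by (intro clinear_plus clinear_mult_left clinear_comp[OF clinear_tprod_right]
          clinear_comp[OF clinear_torus] clinear_comp[OF clinear_Dtwist[OF u]] clinear_torus)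
    fix n y assume y: "y \<in> weight_space n"
    have "?D (a * y) = torus \<theta> (- (m + n)) (u a) * torus \<theta> (- (m + n)) y
        + torus \<theta> (- (m + n)) a * torus \<theta> (- (m + n)) (u y)"
      by (simp only: Dtwist_homogeneous[OF u weight_space_mult[OF a y]] derivation_mult[OF der]
          torus_add torus_mult)
    moreover have "torus \<theta> (- (m + n)) y = torus \<theta> (- m) y"
      "torus \<theta> (- (m + n)) a = Fbar \<theta> m n *\<^sub>C a"
      by (simp_all add: torus_homogeneous[OF y] torus_homogeneous[OF a] Fbar_minus_left Fbar_diff_left)
    moreover have "?D a \<star>\<^bsub>\<theta>\<^esub> torus \<theta> (- m) y = torus \<theta> (- (m + n)) (u a) * torus \<theta> (- m) y"
      by (simp add: tprod_homogeneous_right[OF torus_in_weight_space[OF y]]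
          Dtwist_homogeneous[OF u a] torus_torus add.commute)
    moreover have "torus \<theta> (- m) (?D (torus \<theta> m y)) = Fbar \<theta> m n *\<^sub>C torus \<theta> (- (m + n)) (u y)"
      by (simp add: torus_homogeneous[OF y] clinear_scaleC[OF clinear_Dtwist[OF u]]
          Dtwist_homogeneous[OF u y] torus_scale torus_torus)
    ultimately show "?D (a * y)
        = ?D a \<star>\<^bsub>\<theta>\<^esub> torus \<theta> (- m) y + a * torus \<theta> (- m) (?D (torus \<theta> m y))"
      by simp
  qed
  then show ?thesis
    unfolding aut_iff
    using clinear_Dtwist[OF u] equivariant_Dtwist[OF u equi] Dtwist_kills_OS4[OF u vert] by blast
qed

lemma Dtwist_minus_aut:
  assumes "u \<in> aut \<theta>"
  shows "Dtwist (- \<theta>) u \<in> gauge_algebra"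
proof -
  note u = aut_clinear[OF assms]
  let ?D = "Dtwist (- \<theta>) u"
  have D: "?D a = torus \<theta> m (u a)" if "a \<in> weight_space m" for a m
    by (simp add: Dtwist_homogeneous[OF u that] torus_minus_param)
  have "?D (a * y) = ?D a * y + a * ?D y" for a y
  proof (rule clinear_weight_eqI[of "\<lambda>a. ?D (a * y)"])
    show "clinear (\<lambda>a. ?D (a * y))" "clinear (\<lambda>a. ?D a * y + a * ?D y)"
      by (intro clinear_comp[OF clinear_Dtwist[OF u]] clinear_plus clinear_mult_right clinear_ident
          clinear_Dtwist[OF u])+
    fix m a assume a: "a \<in> weight_space m"
    show "?D (a * y) = ?D a * y + a * ?D y"
    proof (rule clinear_weight_eqI[of "\<lambda>y. ?D (a * y)"])
      show "clinear (\<lambda>y. ?D (a * y))" "clinear (\<lambda>y. ?D a * y + a * ?D y)"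
        by (intro clinear_comp[OF clinear_Dtwist[OF u]] clinear_plus clinear_mult_left clinear_ident
            clinear_Dtwist[OF u])+
      fix n y assume y: "y \<in> weight_space n"
      have "u (a * y) = torus \<theta> (- n) (u a) * torus \<theta> (- m) y
          + Fbar \<theta> m n *\<^sub>C (a * torus \<theta> (- m) (u y))"
        unfolding aut_mult[OF assms a] tprod_homogeneous_right[OF torus_in_weight_space[OF y]]
        by (simp add: torus_homogeneous[OF y, of \<theta> m] clinear_scaleC[OF u] torus_scale)
      then have "?D (a * y) = torus \<theta> m (u a) * torus \<theta> n y
          + Fbar \<theta> m n *\<^sub>C (torus \<theta> (m + n) a * torus \<theta> n (u y))"
        by (simp add: D[OF weight_space_mult[OF a y]] torus_add torus_mult torus_torus torus_scale)
      moreover have "torus \<theta> (m + n) a = Fbar \<theta> n m *\<^sub>C a"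
        by (simp add: torus_homogeneous[OF a] Fbar_add_left)
      ultimately show "?D (a * y) = ?D a * y + a * ?D y"
        by (simp add: D[OF a] D[OF y] torus_self[OF y])
    qed
  qed
  then show ?thesis
    using clinear_Dtwist[OF u] equivariant_Dtwist[OF u aut_equivariant[OF assms]]
      Dtwist_kills_OS4[OF u aut_OS4[OF assms]]
    by (simp add: gauge_algebra_def derivation_def)
qed

lemma aut_eq_Dtwist_image: "aut \<theta> = Dtwist \<theta> ` gauge_algebra"
proof
  show "Dtwist \<theta> ` gauge_algebra \<subseteq> aut \<theta>" using Dtwist_gauge_algebra by blast
  show "aut \<theta> \<subseteq> Dtwist \<theta> ` gauge_algebra"
    using Dtwist_minus_aut Dtwist_minus_Dtwist[OF aut_clinear] by (metis imageI subsetI)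
qed

text \<open>On a vector of weight \<open>m\<close> the twist acts on \<open>c\<close> by \<open>torus (- m)\<close>, while the twisted product with
  \<open>D(u)(a)\<close>, of weight \<open>m + r\<close>, acts on its left factor by \<open>torus (- (m + r))\<close>.\<close>

lemma Dtwist_mult_left:
  assumes u: "weight_map r u"
  shows "Dtwist \<theta> (\<lambda>a. c * u a) = tmod \<theta> (torus \<theta> r c) (Dtwist \<theta> u)"
proof
  note lin = weight_map_clinear[OF u]
  have lin_c: "clinear (\<lambda>a. c * u a)" by (rule clinear_mult_left[OF lin])
  show "Dtwist \<theta> (\<lambda>a. c * u a) a = tmod \<theta> (torus \<theta> r c) (Dtwist \<theta> u) a" for a
    unfolding tmod_def
  proof (rule clinear_weight_eqI[OF clinear_Dtwist[OF lin_c]])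
    show "clinear (\<lambda>a. torus \<theta> r c \<star>\<^bsub>\<theta>\<^esub> Dtwist \<theta> u a)"
      by (rule clinear_comp[OF clinear_tprod_right clinear_Dtwist[OF lin]])
    fix m a assume a: "a \<in> weight_space m"
    have "Dtwist \<theta> u a \<in> weight_space (m + r)"
      by (rule weight_mapD[OF weight_map_Dtwist[OF u] a])
    then show "Dtwist \<theta> (\<lambda>a. c * u a) a = torus \<theta> r c \<star>\<^bsub>\<theta>\<^esub> Dtwist \<theta> u a"
      by (simp add: tprod_homogeneous_right torus_torus Dtwist_homogeneous[OF lin_c a]
          Dtwist_homogeneous[OF lin a] torus_mult)
  qed
qed


section \<open>The braided bracket\<close>

text \<open>For a fixed weight \<open>r\<close> of \<open>u\<close> the sum over the weights of \<open>u'\<close> is a conjugation.\<close>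

lemma tbracket_swap:
  assumes u: "clinear u" and u': "clinear u'"
  shows "tbracket \<theta> u u' a = u (u' a) -
    Sum_any (\<lambda>r. torus \<theta> (r + r) (u' (torus \<theta> (- (r + r)) (mpart u r a))))"
proof -
  have "Sum_any (\<lambda>s. Sum_any (\<lambda>r. Rmat \<theta> r s *\<^sub>C mpart u' s (mpart u r a)))
      = Sum_any (\<lambda>r. Sum_any (\<lambda>s. Rmat \<theta> r s *\<^sub>C mpart u' s (mpart u r a)))"
  proof (rule Sum_any_swap_support[OF finite_mpart[OF u, of a]])
    show "Rmat \<theta> r s *\<^sub>C mpart u' s (mpart u r a) = 0" if "r \<notin> {r. mpart u r a \<noteq> 0}" for r s
      using that by (simp add: clinear_zero[OF clinear_mpart[OF u']])
    show "finite {s. Rmat \<theta> r s *\<^sub>C mpart u' s (mpart u r a) \<noteq> 0}" for r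
      by (rule finite_support_mono[OF finite_mpart[OF u', of "mpart u r a"]]) simp
  qed
  moreover have "Rmat \<theta> r s = Fbar \<theta> s (- (r + r))" for r s
    by (simp only: Fbar_minus_right Fbar_add_left Rmat_def power2_eq_square)
  ultimately show ?thesis
    by (simp only: tbracket_def Sum_any_Fbar_mpart[OF u'] minus_minus)
qed

text \<open>Both orders of composition carry the scalar \<open>Fbar r s * Fbar (r + s) m\<close> on vectors of weight \<open>m\<close>: for
  \<open>u' \<circ> u\<close> it arises from \<open>Rmat r s\<close> and the factor \<open>Fbar s r\<close> with the order of \<open>r\<close> and \<open>s\<close> exchanged.\<close>

lemma tbracket_Dtwist:
  assumes u: "weight_map r u" and u': "weight_map s u'"
  shows "tbracket \<theta> (Dtwist \<theta> u) (Dtwist \<theta> u') = (\<lambda>a. Fbar \<theta> r s *\<^sub>C Dtwist \<theta> (commutator u u') a)"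
proof
  fix a
  note D = weight_map_Dtwist[OF u, of \<theta>] weight_map_Dtwist[OF u', of \<theta>]
  note lin = D[THEN weight_map_clinear] weight_map_clinear[OF u] weight_map_clinear[OF u']
  have "weight_map (r + s) (commutator u u')"
    unfolding weight_map_iff commutator_def
    using weight_mapD[OF u weight_mapD[OF u']] weight_mapD[OF u' weight_mapD[OF u]]
    by (auto intro!: clinear_subtract clinear_comp[OF lin(3,4)] clinear_comp[OF lin(4,3)]
        weight_space_diff simp: ac_simps)
  note comm = this weight_map_clinear[OF this]
  have bracket: "tbracket \<theta> (Dtwist \<theta> u) (Dtwist \<theta> u') a = Dtwist \<theta> u (Dtwist \<theta> u' a)
      - torus \<theta> (r + r) (Dtwist \<theta> u' (torus \<theta> (- (r + r)) (Dtwist \<theta> u a)))" for a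
  proof -
    have "Sum_any (\<lambda>q. torus \<theta> (q + q) (Dtwist \<theta> u' (torus \<theta> (- (q + q)) (mpart (Dtwist \<theta> u) q a))))
        = (\<Sum>q\<in>{r}. torus \<theta> (q + q) (Dtwist \<theta> u' (torus \<theta> (- (q + q)) (mpart (Dtwist \<theta> u) q a))))"
      by (rule Sum_any.expand_superset)
        (auto simp: mpart_weight_map[OF D(1)] clinear_zero[OF clinear_torus] clinear_zero[OF lin(2)]
          split: if_splits)
    then show ?thesis
      by (simp add: tbracket_swap[OF lin(1,2)] mpart_weight_map[OF D(1)])
  qed
  show "tbracket \<theta> (Dtwist \<theta> u) (Dtwist \<theta> u') a = Fbar \<theta> r s *\<^sub>C Dtwist \<theta> (commutator u u') a"
    unfolding bracket
  proof (rule clinear_weight_eqI[of "\<lambda>a. Dtwist \<theta> u (Dtwist \<theta> u' a)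
        - torus \<theta> (r + r) (Dtwist \<theta> u' (torus \<theta> (- (r + r)) (Dtwist \<theta> u a)))"
        "\<lambda>a. Fbar \<theta> r s *\<^sub>C Dtwist \<theta> (commutator u u') a"])
    show "clinear (\<lambda>a. Dtwist \<theta> u (Dtwist \<theta> u' a)
        - torus \<theta> (r + r) (Dtwist \<theta> u' (torus \<theta> (- (r + r)) (Dtwist \<theta> u a))))"
      by (intro clinear_subtract clinear_comp[OF lin(1)] clinear_comp[OF lin(2)]
          clinear_comp[OF clinear_torus] lin)
    show "clinear (\<lambda>a. Fbar \<theta> r s *\<^sub>C Dtwist \<theta> (commutator u u') a)"
      by (intro clinear_scale clinear_Dtwist comm)
    fix m a assume a: "a \<in> weight_space m"
    note w = weight_mapD[OF u a] weight_mapD[OF u' a]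
    have "Dtwist \<theta> u (Dtwist \<theta> u' a) = (Fbar \<theta> s m * Fbar \<theta> r (m + s)) *\<^sub>C u (u' a)"
      by (simp only: Dtwist_weight_map[OF u' a] clinear_scaleC[OF lin(1)] Dtwist_weight_map[OF u w(2)]
          scaleC_scaleC)
    also have "Fbar \<theta> s m * Fbar \<theta> r (m + s) = Fbar \<theta> r s * Fbar \<theta> (r + s) m"
      by (simp only: Fbar_add_left Fbar_add_right mult.assoc mult.commute mult.left_commute)
    finally have "Dtwist \<theta> u (Dtwist \<theta> u' a) = (Fbar \<theta> r s * Fbar \<theta> (r + s) m) *\<^sub>C u (u' a)" .
    moreover have "torus \<theta> (r + r) (Dtwist \<theta> u' (torus \<theta> (- (r + r)) (Dtwist \<theta> u a)))
        = (Fbar \<theta> r s * Fbar \<theta> (r + s) m) *\<^sub>C u' (u a)"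
    proof -
      have "torus \<theta> (r + r) (Dtwist \<theta> u' (torus \<theta> (- (r + r)) (Dtwist \<theta> u a)))
        = (Fbar \<theta> r m * Fbar \<theta> (- (r + r)) (m + r) * Fbar \<theta> s (m + r) * Fbar \<theta> (r + r) (m + r + s)) *\<^sub>C u' (u a)"
        by (simp only: Dtwist_weight_map[OF u a] torus_scale clinear_scaleC[OF lin(2)]
            torus_homogeneous[OF w(1)] Dtwist_weight_map[OF u' w(1)]
            torus_homogeneous[OF weight_mapD[OF u' w(1)]] scaleC_scaleC mult.assoc)
      also have "Fbar \<theta> r m * Fbar \<theta> (- (r + r)) (m + r) * Fbar \<theta> s (m + r) * Fbar \<theta> (r + r) (m + r + s)
          = Fbar \<theta> r s * Fbar \<theta> (r + s) m"
      proof -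
        have "Fbar \<theta> m r * Fbar \<theta> r m = 1" "Fbar \<theta> s r * Fbar \<theta> r s = 1" by simp_all
        then show ?thesis
          unfolding Fbar_minus_left Fbar_add_left Fbar_add_right Fbar_self by algebra
      qed
      finally show ?thesis .
    qed
    ultimately show "Dtwist \<theta> u (Dtwist \<theta> u' a)
        - torus \<theta> (r + r) (Dtwist \<theta> u' (torus \<theta> (- (r + r)) (Dtwist \<theta> u a)))
        = Fbar \<theta> r s *\<^sub>C Dtwist \<theta> (commutator u u') a"
      unfolding Dtwist_weight_map[OF comm(1) a]
      by (simp add: commutator_def complex_algebra.scale_right_diff_distrib)
  qed
qed


section \<open>Rows of the matrix of generators\<close>

text \<open>Values of a derivation on the generators, and their images under the operations below, form
  matrices of the same shape as \<open>zmat\<close>. The matrix is covariant if the coaction multiplies it by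
  \<open>wmat\<close> from the right.\<close>

definition row_covariant :: "(4 gen \<Rightarrow> OS7) \<Rightarrow> bool" where
  "row_covariant v \<longleftrightarrow> (\<forall>g. coaction (v g) = coaction_rows v g)"

lemma row_covariantD: "row_covariant v \<Longrightarrow> coaction (v g) = coaction_rows v g"
  by (simp add: row_covariant_def)

lemma row_covariant_coord: "row_covariant coord"
  by (simp add: row_covariant_def coaction_coord)

lemma first_leg_coaction_rows:
  assumes "clinear d"
  shows "first_leg d (coaction_rows v g) = coaction_rows (\<lambda>g. d (v g)) g"
proof -
  have "\<forall>g. first_leg d (coaction_rows v g) = coaction_rows (\<lambda>g. d (v g)) g"
    unfolding all_gen4
    by (simp add: coaction_rows_def first_leg_tens[OF assms] clinear_add[OF clinear_first_leg[OF assms]]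
        clinear_diff[OF clinear_first_leg[OF assms]])
  then show ?thesis ..
qed

text \<open>By the Leibniz rule, equivariance of a derivation has to be checked on generators only.\<close>

lemma equivariant_derivation_iff:
  assumes "derivation d"
  shows "equivariant d \<longleftrightarrow> row_covariant (\<lambda>g. d (coord g))"
proof
  assume "equivariant d"
  then show "row_covariant (\<lambda>g. d (coord g))"
    by (simp add: row_covariant_def equivariant_def coaction_coord
        first_leg_coaction_rows[OF derivation_clinear[OF assms]])
next
  assume "row_covariant (\<lambda>g. d (coord g))"
  then show "equivariant d"
    by (intro equivariant_derivationI[OF assms])
      (simp add: row_covariant_def coaction_coord first_leg_coaction_rows[OF derivation_clinear[OF assms]])
qed

lemma coaction_rows_add: "coaction_rows (\<lambda>g. u g + v g) g = coaction_rows u g + coaction_rows v g"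
proof -
  have "\<forall>g. coaction_rows (\<lambda>g. u g + v g) g = coaction_rows u g + coaction_rows v g"
    unfolding all_gen4 by (simp add: coaction_rows_def tens_simps)
  then show ?thesis ..
qed

lemma coaction_rows_mult: "coaction_rows (\<lambda>g. b * v g) g = (b \<otimes>\<^sub>C 1) * coaction_rows v g"
proof -
  have "\<forall>g. coaction_rows (\<lambda>g. b * v g) g = (b \<otimes>\<^sub>C 1) * coaction_rows v g"
    unfolding all_gen4 by (simp add: coaction_rows_def tens_mult algebra_simps)
  then show ?thesis ..
qed

lemma row_covariant_add: "row_covariant u \<Longrightarrow> row_covariant v \<Longrightarrow> row_covariant (\<lambda>g. u g + v g)"
  by (simp add: row_covariant_def coaction_simps coaction_rows_add)

lemma row_covariant_mult: "b \<in> OS4 \<Longrightarrow> row_covariant v \<Longrightarrow> row_covariant (\<lambda>g. b * v g)"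
  by (simp add: row_covariant_def coaction_simps coaction_rows_mult OS4_iff)

lemma row_covariant_scale:
  assumes "row_covariant v"
  shows "row_covariant (\<lambda>g. c *\<^sub>C v g)"
  using row_covariant_mult[of "c *\<^sub>C 1", OF _ assms]
  by (simp add: OS4_iff coaction_simps one_tens tens_simps)

text \<open>The coaction multiplies \<open>2 \<times> 2\<close> minors by the determinant of \<open>wmat\<close>, which is one.\<close>

lemma minor_coinvariant:
  assumes "coaction p = p \<otimes>\<^sub>C zz 1 + q \<otimes>\<^sub>C zz 2" "coaction q = q \<otimes>\<^sub>C zs 1 - p \<otimes>\<^sub>C zs 2"
    and "coaction p' = p' \<otimes>\<^sub>C zz 1 + q' \<otimes>\<^sub>C zz 2" "coaction q' = q' \<otimes>\<^sub>C zs 1 - p' \<otimes>\<^sub>C zs 2"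
  shows "p * q' - q * p' \<in> OS4"
  unfolding OS4_iff sphere_relation_2[symmetric]
  by (simp add: coaction_simps assms algebra_simps tens_mult tens_simps clinear_diff[OF clinear_tens_left])

lemma row_covariant_rows:
  assumes "row_covariant v"
  shows
    "coaction (v (Z 1)) = v (Z 1) \<otimes>\<^sub>C zz 1 + (- v (Zs 2)) \<otimes>\<^sub>C zz 2"
    "coaction (- v (Zs 2)) = (- v (Zs 2)) \<otimes>\<^sub>C zs 1 - v (Z 1) \<otimes>\<^sub>C zs 2"
    "coaction (v (Z 2)) = v (Z 2) \<otimes>\<^sub>C zz 1 + v (Zs 1) \<otimes>\<^sub>C zz 2"
    "coaction (v (Zs 1)) = v (Zs 1) \<otimes>\<^sub>C zs 1 - v (Z 2) \<otimes>\<^sub>C zs 2"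
    "coaction (v (Z 3)) = v (Z 3) \<otimes>\<^sub>C zz 1 + (- v (Zs 4)) \<otimes>\<^sub>C zz 2"
    "coaction (- v (Zs 4)) = (- v (Zs 4)) \<otimes>\<^sub>C zs 1 - v (Z 3) \<otimes>\<^sub>C zs 2"
    "coaction (v (Z 4)) = v (Z 4) \<otimes>\<^sub>C zz 1 + v (Zs 3) \<otimes>\<^sub>C zz 2"
    "coaction (v (Zs 3)) = v (Zs 3) \<otimes>\<^sub>C zs 1 - v (Z 4) \<otimes>\<^sub>C zs 2"
  by (simp_all add: coaction_simps row_covariantD[OF assms] coaction_rows_def tens_simps)

lemma
  assumes v: "row_covariant v"
  shows minors_coinvariant:
    "v (Z 1) * zs 1 + v (Zs 2) * zz 2 \<in> OS4" "v (Z 3) * zs 3 + v (Zs 4) * zz 4 \<in> OS4"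
    "v (Z 3) * zs 1 + v (Zs 4) * zz 2 \<in> OS4" "v (Z 1) * zs 3 + v (Zs 2) * zz 4 \<in> OS4"
    "v (Z 3) * zs 2 - v (Zs 4) * zz 1 \<in> OS4" "v (Z 4) * zs 1 - v (Zs 3) * zz 2 \<in> OS4"
    "v (Z 3) * zs 4 - v (Zs 4) * zz 3 \<in> OS4" "v (Z 4) * zs 3 - v (Zs 3) * zz 4 \<in> OS4"
    "v (Z 2) * zs 1 - v (Zs 1) * zz 2 \<in> OS4" "v (Z 1) * zs 2 - v (Zs 2) * zz 1 \<in> OS4"
proof -
  note z = row_covariant_rows[OF row_covariant_coord]
  note v = row_covariant_rows[OF v]
  show "v (Z 1) * zs 1 + v (Zs 2) * zz 2 \<in> OS4"
    using minor_coinvariant[OF v(1,2) z(3,4)] by simp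
  show "v (Z 3) * zs 3 + v (Zs 4) * zz 4 \<in> OS4"
    using minor_coinvariant[OF v(5,6) z(7,8)] by simp
  show "v (Z 3) * zs 1 + v (Zs 4) * zz 2 \<in> OS4"
    using minor_coinvariant[OF v(5,6) z(3,4)] by simp
  show "v (Z 1) * zs 3 + v (Zs 2) * zz 4 \<in> OS4"
    using minor_coinvariant[OF v(1,2) z(7,8)] by simp
  show "v (Z 3) * zs 2 - v (Zs 4) * zz 1 \<in> OS4"
    using OS4_minus[OF minor_coinvariant[OF v(5,6) z(1,2)]] by simp
  show "v (Z 4) * zs 1 - v (Zs 3) * zz 2 \<in> OS4"
    using minor_coinvariant[OF v(7,8) z(3,4)] by simp
  show "v (Z 3) * zs 4 - v (Zs 4) * zz 3 \<in> OS4"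
    using OS4_minus[OF minor_coinvariant[OF v(5,6) z(5,6)]] by simp
  show "v (Z 4) * zs 3 - v (Zs 3) * zz 4 \<in> OS4"
    using minor_coinvariant[OF v(7,8) z(7,8)] by simp
  show "v (Z 2) * zs 1 - v (Zs 1) * zz 2 \<in> OS4"
    using minor_coinvariant[OF v(3,4) z(3,4)] by simp
  show "v (Z 1) * zs 2 - v (Zs 2) * zz 1 \<in> OS4"
    using OS4_minus[OF minor_coinvariant[OF v(1,2) z(1,2)]] by simp
qed

lemma two_scaleC: "2 *\<^sub>C a = a + a" for a :: "'a::comm_complex_algebra"
  using scaleC_add_left[of 1 1 a] by simp

lemma half_double: "(1 / 2) *\<^sub>C (a + a) = a" for a :: "'a::comm_complex_algebra"
  by (simp flip: two_scaleC)

lemma double_cancel: "a + a = b + b \<Longrightarrow> a = b" for a b :: "'a::comm_complex_algebra"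
  by (metis half_double)

lemma OS4_generators: "al \<in> OS4" "als \<in> OS4" "be \<in> OS4" "bes \<in> OS4" "xx \<in> OS4"
proof -
  note c = minors_coinvariant[OF row_covariant_coord]
  show "al \<in> OS4" unfolding al_def by (intro OS4_scale c)
  have "zz 3 * zs 1 + zs 4 * zz 2 \<in> OS4" by (rule c)
  then show "als \<in> OS4" unfolding als_def by (intro OS4_scale) (simp add: ac_simps)
  have "zz 3 * zs 2 - zs 4 * zz 1 \<in> OS4" by (rule c)
  then show "bes \<in> OS4" unfolding bes_def by (intro OS4_scale) (simp add: ac_simps)
  have "(-1) *\<^sub>C (zz 4 * zs 1 - zs 3 * zz 2) \<in> OS4" by (intro OS4_scale c)
  then show "be \<in> OS4" unfolding be_def by (intro OS4_scale) (simp add: ac_simps)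
  have "(zz 1 * zs 1 + zs 2 * zz 2) - (zz 3 * zs 3 + zs 4 * zz 4) \<in> OS4" by (intro OS4_diff c)
  then show "xx \<in> OS4" unfolding xx_def by (simp add: ac_simps diff_diff_eq)
qed


section \<open>The projector\<close>

text \<open>For \<open>M = zmat\<close> and its adjoint \<open>M\<^sup>\<dagger>\<close> one has \<open>M\<^sup>\<dagger>M = 1\<close>, and \<open>M M\<^sup>\<dagger> = (1 + Q) / 2\<close> where \<open>Q\<close> has
  entries \<open>\<plusminus> x, al, \<dots>\<close>. The following is the left multiplication of a matrix by \<open>Q\<close>.\<close>

definition Q_rows :: "(4 gen \<Rightarrow> OS7) \<Rightarrow> 4 gen \<Rightarrow> OS7" where
  "Q_rows v = (\<lambda>_. 0)
     (Z 1 := xx * v (Z 1) + al * v (Z 3) - bes * v (Z 4),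
      Z 2 := xx * v (Z 2) + be * v (Z 3) + als * v (Z 4),
      Z 3 := als * v (Z 1) + bes * v (Z 2) - xx * v (Z 3),
      Z 4 := al * v (Z 2) - be * v (Z 1) - xx * v (Z 4),
      Zs 1 := xx * v (Zs 1) + als * v (Zs 3) - be * v (Zs 4),
      Zs 2 := xx * v (Zs 2) + bes * v (Zs 3) + al * v (Zs 4),
      Zs 3 := al * v (Zs 1) + be * v (Zs 2) - xx * v (Zs 3),
      Zs 4 := als * v (Zs 2) - bes * v (Zs 1) - xx * v (Zs 4))"

lemmas OS4_gen_defs = al_def als_def be_def bes_def xx_def two_scaleC

text \<open>Equivalently \<open>M M\<^sup>\<dagger> M = M\<close>, which holds because \<open>M\<^sup>\<dagger> M = 1\<close>.\<close>

lemma Q_rows_coord: "Q_rows coord = coord"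
proof -
  have "\<forall>g. Q_rows coord g = coord g * (zz 1 * zs 1 + zz 2 * zs 2 + zz 3 * zs 3 + zz 4 * zs 4)"
    unfolding all_gen4 by (simp add: Q_rows_def OS4_gen_defs algebra_simps)
  then show ?thesis by (simp add: sphere_relation_4 fun_eq_iff)
qed

text \<open>The left-hand side is the square of \<open>\<Sum> z\<^sub>i z\<^sub>i\<^sup>*\<close>.\<close>

lemma sphere4_relation: "al * als + be * bes + xx * xx = 1"
proof -
  have "al * als + be * bes + xx * xx
    = (zz 1 * zs 1 + zz 2 * zs 2 + zz 3 * zs 3 + zz 4 * zs 4)
      * (zz 1 * zs 1 + zz 2 * zs 2 + zz 3 * zs 3 + zz 4 * zs 4)"
    by (simp add: OS4_gen_defs algebra_simps)
  then show ?thesis by (simp add: sphere_relation_4)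
qed

lemma Q_rows_Q_rows: "Q_rows (Q_rows v) = v"
proof -
  have "\<forall>g. Q_rows (Q_rows v) g = (al * als + be * bes + xx * xx) * v g"
    unfolding all_gen4 by (simp add: Q_rows_def algebra_simps)
  then show ?thesis by (simp add: sphere4_relation fun_eq_iff)
qed

lemma Q_rows_add: "Q_rows (\<lambda>g. u g + v g) g = Q_rows u g + Q_rows v g"
proof -
  have "\<forall>g. Q_rows (\<lambda>g. u g + v g) g = Q_rows u g + Q_rows v g"
    unfolding all_gen4 by (simp add: Q_rows_def algebra_simps)
  then show ?thesis ..
qed

lemma Q_rows_mult: "Q_rows (\<lambda>g. b * v g) g = b * Q_rows v g"
proof -
  have "\<forall>g. Q_rows (\<lambda>g. b * v g) g = b * Q_rows v g"
    unfolding all_gen4 by (simp add: Q_rows_def algebra_simps)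
  then show ?thesis ..
qed

lemma Q_rows_scale: "Q_rows (\<lambda>g. c *\<^sub>C v g) g = c *\<^sub>C Q_rows v g"
  using Q_rows_mult[of "c *\<^sub>C 1" v g] by simp

lemma row_covariant_Q_rows:
  assumes "row_covariant v"
  shows "row_covariant (Q_rows v)"
  unfolding row_covariant_def all_gen4
  by (simp add: Q_rows_def coaction_rows_def coaction_simps OS4_generators[unfolded OS4_iff]
      row_covariantD[OF assms] tens_mult tens_simps clinear_diff[OF clinear_tens_left] algebra_simps)

text \<open>A derivation that kills the entries of \<open>Q\<close> satisfies \<open>Q (D M) = D M\<close>, hence \<open>D M = M X\<close> with
  \<open>X = M\<^sup>\<dagger> (D M)\<close>: it acts as an infinitesimal right multiplication. The trace of \<open>X\<close> is the
  derivative of the sphere relation.\<close>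

lemma right_multiplication:
  assumes d: "derivation d" and Q: "Q_rows (\<lambda>g. d (coord g)) = (\<lambda>g. d (coord g))"
  obtains X11 X12 X21 where
    "d (zz 1) = zz 1 * X11 - zs 2 * X21" "d (zs 2) = - zz 1 * X12 - zs 2 * X11"
    "d (zz 2) = zz 2 * X11 + zs 1 * X21" "d (zs 1) = zz 2 * X12 - zs 1 * X11"
    "d (zz 3) = zz 3 * X11 - zs 4 * X21" "d (zs 4) = - zz 3 * X12 - zs 4 * X11"
    "d (zz 4) = zz 4 * X11 + zs 3 * X21" "d (zs 3) = zz 4 * X12 - zs 3 * X11"
proof -
  let ?d = "\<lambda>g. d (coord g)"
  define X11 where "X11 = zs 1 * d (zz 1) + zs 2 * d (zz 2) + zs 3 * d (zz 3) + zs 4 * d (zz 4)"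
  define X22 where "X22 = zz 1 * d (zs 1) + zz 2 * d (zs 2) + zz 3 * d (zs 3) + zz 4 * d (zs 4)"
  define X21 where "X21 = zz 1 * d (zz 2) - zz 2 * d (zz 1) + zz 3 * d (zz 4) - zz 4 * d (zz 3)"
  define X12 where "X12 = zs 2 * d (zs 1) - zs 1 * d (zs 2) + zs 4 * d (zs 3) - zs 3 * d (zs 4)"
  have "d (zz 1 * zs 1 + zz 2 * zs 2 + zz 3 * zs 3 + zz 4 * zs 4) = 0"
    unfolding sphere_relation_4 by (rule derivation_one[OF d])
  then have "X11 + X22 = 0"
    by (simp add: X11_def X22_def clinear_add[OF derivation_clinear[OF d]] derivation_mult[OF d] ac_simps)
  then have X22: "X22 = - X11" by (simp add: eq_neg_iff_add_eq_0 add.commute)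
  \<comment> \<open>Entrywise this is \<open>(1 + Q) (D M) = 2 M X\<close>, where the sphere relation supplies the diagonal of \<open>Q\<close>.\<close>
  have "\<forall>g. ?d g * (zz 1 * zs 1 + zz 2 * zs 2 + zz 3 * zs 3 + zz 4 * zs 4) + Q_rows ?d g
      = (let w = ((\<lambda>_. 0) (Z 1 := zz 1 * X11 - zs 2 * X21, Zs 2 := zs 2 * X22 - zz 1 * X12,
        Z 2 := zz 2 * X11 + zs 1 * X21, Zs 1 := zz 2 * X12 + zs 1 * X22,
        Z 3 := zz 3 * X11 - zs 4 * X21, Zs 4 := zs 4 * X22 - zz 3 * X12,
        Z 4 := zz 4 * X11 + zs 3 * X21, Zs 3 := zz 4 * X12 + zs 3 * X22)) g in w + w)"
    unfolding all_gen4
    by (simp add: Q_rows_def OS4_gen_defs X11_def X22_def X12_def X21_def algebra_simps)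
  then have dX: "\<forall>g. ?d g = ((\<lambda>_. 0) (Z 1 := zz 1 * X11 - zs 2 * X21, Zs 2 := zs 2 * X22 - zz 1 * X12,
        Z 2 := zz 2 * X11 + zs 1 * X21, Zs 1 := zz 2 * X12 + zs 1 * X22,
        Z 3 := zz 3 * X11 - zs 4 * X21, Zs 4 := zs 4 * X22 - zz 3 * X12,
        Z 4 := zz 4 * X11 + zs 3 * X21, Zs 3 := zz 4 * X12 + zs 3 * X22)) g"
    unfolding sphere_relation_4 Q Let_def mult_1_right by (blast intro: double_cancel)
  show ?thesis
    by (rule that[of X11 X21 X12]) (use dX[unfolded all_gen4] in \<open>simp_all add: X22\<close>)
qed

text \<open>An infinitesimal right multiplication factors through the coaction: it is the composition
  of the coaction with the derivation \<open>w \<mapsto> X\<close> at the unit of \<open>SU(2)\<close>. Thus it kills all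
  coinvariants.\<close>

lemma derivation_kills_OS4:
  assumes d: "derivation d" and Q: "Q_rows (\<lambda>g. d (coord g)) = (\<lambda>g. d (coord g))"
    and b: "b \<in> OS4"
  shows "d b = 0"
proof -
  obtain X11 X12 X21 where X:
    "d (zz 1) = zz 1 * X11 - zs 2 * X21" "d (zs 2) = - zz 1 * X12 - zs 2 * X11"
    "d (zz 2) = zz 2 * X11 + zs 1 * X21" "d (zs 1) = zz 2 * X12 - zs 1 * X11"
    "d (zz 3) = zz 3 * X11 - zs 4 * X21" "d (zs 4) = - zz 3 * X12 - zs 4 * X11"
    "d (zz 4) = zz 4 * X11 + zs 3 * X21" "d (zs 3) = zz 4 * X12 - zs 3 * X11"
    using right_multiplication[OF d Q] .
  define c :: "2 gen \<Rightarrow> OS7 dual" where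
    "c = (\<lambda>_. 0) (Z 1 := Dual 1 X11, Z 2 := Dual 0 X21, Zs 1 := Dual 1 (- X11), Zs 2 := Dual 0 (- X12))"
  have c: "c (Z 1) = Dual 1 X11" "c (Z 2) = Dual 0 X21" "c (Zs 1) = Dual 1 (- X11)"
    "c (Zs 2) = Dual 0 (- X12)"
    by (simp_all add: c_def)
  have "(\<Sum>i\<in>UNIV. c (Z i) * c (Zs i)) = 1"
    by (rule dual.expand) (simp add: sum_UNIV_2 c)
  note hom = algebra_map_sphere_hom[OF this] sphere_hom_coord[OF this]
  define \<phi> :: "OS7 \<Rightarrow> OSU2 \<Rightarrow> OS7 dual" where "\<phi> a h = Dual a 0 * sphere_hom c h" for a h
  have "clinear (\<lambda>a. Dual a (0 :: OS7))"
    by (simp add: clinear_iff dual_defs)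
  then have "bilinear_map \<phi>"
    unfolding bilinear_map_def \<phi>_def
    using clinear_mult_left[OF algebra_map_clinear[OF hom(1)]] clinear_mult_right by blast
  note lift = clinear_tensor_lift[OF this] tensor_lift_tens[OF this]
  let ?L = "tensor_lift \<phi>"
  have L_tens: "?L ((a \<otimes>\<^sub>C h) * t) = ?L (a \<otimes>\<^sub>C h) * ?L t" for a h t
  proof (induction t rule: tensor_induct)
    case (tens a' h')
    have "\<phi> (a * a') (h * h') = \<phi> a h * \<phi> a' h'"
      unfolding \<phi>_def
      by (rule dual.expand) (simp add: algebra_map_mult[OF hom(1)] algebra_simps)
    then show ?case by (simp add: tens_mult lift(2))
  qed (simp add: distrib_left clinear_add[OF lift(1)])
  have L_mult: "?L (s * t) = ?L s * ?L t" for s t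
    by (induction s rule: tensor_induct) (simp_all add: L_tens distrib_right clinear_add[OF lift(1)])
  have "?L 1 = 1"
    by (simp add: one_tens lift \<phi>_def algebra_map_one[OF hom(1)] dual_defs)
  then have "algebra_map ?L"
    by (simp add: algebra_map_def lift L_mult)
  then have "algebra_map (\<lambda>a. ?L (coaction a))"
    by (rule algebra_map_comp[OF _ algebra_map_coaction])
  moreover have "\<forall>g. ?L (coaction (coord g)) = Dual (coord g) (d (coord g))"
    unfolding all_gen4 coaction_z
    by (simp add: clinear_add[OF lift(1)] clinear_diff[OF lift(1)] lift(2) \<phi>_def hom(2) c X
        dual_defs algebra_simps)
  ultimately have "(\<lambda>a. ?L (coaction a)) = (\<lambda>a. Dual a (d a))"
    by (intro algebra_map_eqI derivation_algebra_map[OF d]) auto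
  then have "Dual b (d b) = ?L (b \<otimes>\<^sub>C 1)"
    using b by (metis OS4_iff)
  also have "\<dots> = Dual b 0"
    by (simp add: lift(2) \<phi>_def algebra_map_one[OF hom(1)])
  finally show ?thesis by simp
qed


section \<open>Generators of the untwisted gauge algebra\<close>

text \<open>The derivations \<open>H\<^sub>j\<close> and \<open>E\<^sub>r\<close> act on \<open>zmat\<close> as left multiplications by matrices that form a basis of
  the symplectic Lie algebra of rank two. Up to scalars, \<open>act i\<close> is the multiplication by the matrix
  \<open>T\<^sub>i\<close>: that of \<open>H\<^sub>i\<close> for \<open>Inl i\<close>, that of \<open>E\<^sub>r\<close> for \<open>Inr r\<close>.\<close>

definition act :: "nat + weight \<Rightarrow> (4 gen \<Rightarrow> OS7) \<Rightarrow> 4 gen \<Rightarrow> OS7" where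
  "act i v =
    (if i = Inl 1 then (\<lambda>_. 0) (Z 1 := v (Z 1), Zs 1 := - v (Zs 1), Z 2 := - v (Z 2), Zs 2 := v (Zs 2),
       Z 3 := - v (Z 3), Zs 3 := v (Zs 3), Z 4 := v (Z 4), Zs 4 := - v (Zs 4))
     else if i = Inl 2 then (\<lambda>_. 0) (Z 1 := - v (Z 1), Zs 1 := v (Zs 1), Z 2 := v (Z 2), Zs 2 := - v (Zs 2),
       Z 3 := - v (Z 3), Zs 3 := v (Zs 3), Z 4 := v (Z 4), Zs 4 := - v (Zs 4))
     else if i = Inr (1, 0) then
       (\<lambda>_. 0) (Z 3 := v (Z 1), Zs 1 := - v (Zs 3), Z 2 := - v (Z 4), Zs 4 := v (Zs 2))
     else if i = Inr (-1, 0) then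
       (\<lambda>_. 0) (Z 1 := v (Z 3), Zs 3 := - v (Zs 1), Z 4 := - v (Z 2), Zs 2 := v (Zs 4))
     else if i = Inr (0, 1) then
       (\<lambda>_. 0) (Z 3 := v (Z 2), Zs 2 := - v (Zs 3), Z 1 := v (Z 4), Zs 4 := - v (Zs 1))
     else if i = Inr (0, -1) then
       (\<lambda>_. 0) (Z 4 := v (Z 1), Zs 1 := - v (Zs 4), Z 2 := v (Z 3), Zs 3 := - v (Zs 2))
     else if i = Inr (1, 1) then (\<lambda>_. 0) (Z 3 := - v (Z 4), Zs 4 := v (Zs 3))
     else if i = Inr (-1, -1) then (\<lambda>_. 0) (Zs 3 := v (Zs 4), Z 4 := - v (Z 3))
     else if i = Inr (1, -1) then (\<lambda>_. 0) (Z 2 := - v (Z 1), Zs 1 := v (Zs 2))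
     else if i = Inr (-1, 1) then (\<lambda>_. 0) (Z 1 := - v (Z 2), Zs 2 := v (Zs 1))
     else (\<lambda>_. 0))"

definition gauge_index :: "(nat + weight) set" where
  "gauge_index = {Inl 1, Inl 2, Inr (1, 0), Inr (-1, 0), Inr (0, 1), Inr (0, -1), Inr (1, 1), Inr (1, -1),
     Inr (-1, 1), Inr (-1, -1)}"

lemma gauge_index_image: "gauge_index = Inl ` {1, 2} \<union> Inr ` Roots"
  by (auto simp: gauge_index_def Roots_def)

lemma sum_gauge_index:
  "sum f gauge_index = f (Inl 1) + f (Inl 2) + f (Inr (1, 0)) + f (Inr (-1, 0)) + f (Inr (0, 1))
    + f (Inr (0, -1)) + f (Inr (1, 1)) + f (Inr (1, -1)) + f (Inr (-1, 1)) + f (Inr (-1, -1))"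
  by (simp add: gauge_index_def ac_simps)

definition generator :: "nat + weight \<Rightarrow> OS7 \<Rightarrow> OS7" where
  "generator i = (case i of Inl j \<Rightarrow> K j | Inr r \<Rightarrow> W r)"

definition generator_weight :: "nat + weight \<Rightarrow> weight" where
  "generator_weight i = (case i of Inl j \<Rightarrow> 0 | Inr r \<Rightarrow> r)"

lemma scaled_vector_field:
  assumes "u = (\<lambda>a. c *\<^sub>C vector_field v a)" and "v = act i coord"
    and "(\<Sum>i\<in>UNIV. zz i * v (Zs i) + v (Z i) * zs i) = 0"
  shows "derivation u \<and> (\<forall>g. u (coord g) = c *\<^sub>C act i coord g)"
  unfolding assms(1)
  using derivation_scale[OF derivation_vector_field[OF assms(3)]] vector_field_coord[OF assms(3)]
  by (simp add: assms(2))

lemma plain_vector_field: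
  assumes "u = vector_field v" and "v = act i coord"
    and "(\<Sum>i\<in>UNIV. zz i * v (Zs i) + v (Z i) * zs i) = 0"
  shows "derivation u \<and> (\<forall>g. u (coord g) = act i coord g)"
  using scaled_vector_field[of u 1 v i] assms by simp

lemma symplectic_fields:
  "derivation H1 \<and> (\<forall>g. H1 (coord g) = (1/2) *\<^sub>C act (Inl 1) coord g)"
  "derivation H2 \<and> (\<forall>g. H2 (coord g) = (1/2) *\<^sub>C act (Inl 2) coord g)"
  "derivation E_1_0 \<and> (\<forall>g. E_1_0 (coord g) = (1/rt2) *\<^sub>C act (Inr (1, 0)) coord g)"
  "derivation E_m1_0 \<and> (\<forall>g. E_m1_0 (coord g) = (1/rt2) *\<^sub>C act (Inr (-1, 0)) coord g)"
  "derivation E_0_1 \<and> (\<forall>g. E_0_1 (coord g) = (1/rt2) *\<^sub>C act (Inr (0, 1)) coord g)"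
  "derivation E_0_m1 \<and> (\<forall>g. E_0_m1 (coord g) = (1/rt2) *\<^sub>C act (Inr (0, -1)) coord g)"
  "derivation E_1_1 \<and> (\<forall>g. E_1_1 (coord g) = act (Inr (1, 1)) coord g)"
  "derivation E_m1_m1 \<and> (\<forall>g. E_m1_m1 (coord g) = act (Inr (-1, -1)) coord g)"
  "derivation E_1_m1 \<and> (\<forall>g. E_1_m1 (coord g) = act (Inr (1, -1)) coord g)"
  "derivation E_m1_1 \<and> (\<forall>g. E_m1_1 (coord g) = act (Inr (-1, 1)) coord g)"
  by (rule scaled_vector_field[OF H1_def] scaled_vector_field[OF H2_def]
      scaled_vector_field[OF E_1_0_def] scaled_vector_field[OF E_m1_0_def]
      scaled_vector_field[OF E_0_1_def] scaled_vector_field[OF E_0_m1_def]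
      plain_vector_field[OF E_1_1_def] plain_vector_field[OF E_m1_m1_def]
      plain_vector_field[OF E_1_m1_def] plain_vector_field[OF E_m1_1_def];
      simp add: act_def sum_UNIV_4)+


lemmas symplectic_derivations = symplectic_fields[THEN conjunct1]
lemmas symplectic_coord = symplectic_fields[THEN conjunct2, rule_format]

text \<open>The generators of the gauge algebra are, up to scalars, the anticommutators of \<open>Q\<close> with the
  \<open>T\<^sub>i\<close>: for the Clifford matrix \<open>Q\<close>, these anticommutators are again combinations of the \<open>T\<^sub>i\<close>
  with coefficients linear in the entries of \<open>Q\<close>.\<close>

lemma anticommutators:
  "act (Inl 1) (Q_rows v) g + Q_rows (act (Inl 1) v) g =
    - ((xx * act (Inl 2) v g + bes * act (Inr (0, 1)) v g + be * act (Inr (0, -1)) v g)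
     + (xx * act (Inl 2) v g + bes * act (Inr (0, 1)) v g + be * act (Inr (0, -1)) v g))"
  "act (Inl 2) (Q_rows v) g + Q_rows (act (Inl 2) v) g =
    - ((xx * act (Inl 1) v g + als * act (Inr (1, 0)) v g + al * act (Inr (-1, 0)) v g)
     + (xx * act (Inl 1) v g + als * act (Inr (1, 0)) v g + al * act (Inr (-1, 0)) v g))"
  "act (Inr (0, 1)) (Q_rows v) g + Q_rows (act (Inr (0, 1)) v) g =
    - (be * act (Inl 1) v g + ((als * act (Inr (1, 1)) v g + al * act (Inr (-1, 1)) v g)
     + (als * act (Inr (1, 1)) v g + al * act (Inr (-1, 1)) v g)))"
  "act (Inr (0, -1)) (Q_rows v) g + Q_rows (act (Inr (0, -1)) v) g =
    - (bes * act (Inl 1) v g + ((als * act (Inr (1, -1)) v g + al * act (Inr (-1, -1)) v g)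
     + (als * act (Inr (1, -1)) v g + al * act (Inr (-1, -1)) v g)))"
  "act (Inr (1, 0)) (Q_rows v) g + Q_rows (act (Inr (1, 0)) v) g =
    - (al * act (Inl 2) v g + ((be * act (Inr (1, -1)) v g - bes * act (Inr (1, 1)) v g)
     + (be * act (Inr (1, -1)) v g - bes * act (Inr (1, 1)) v g)))"
  "act (Inr (-1, 0)) (Q_rows v) g + Q_rows (act (Inr (-1, 0)) v) g =
    - (als * act (Inl 2) v g + ((bes * act (Inr (-1, 1)) v g - be * act (Inr (-1, -1)) v g)
     + (bes * act (Inr (-1, 1)) v g - be * act (Inr (-1, -1)) v g)))"
  "act (Inr (1, 1)) (Q_rows v) g + Q_rows (act (Inr (1, 1)) v) g =
    - (xx * act (Inr (1, 1)) v g + xx * act (Inr (1, 1)) v g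
      + al * act (Inr (0, 1)) v g - be * act (Inr (1, 0)) v g)"
  "act (Inr (-1, -1)) (Q_rows v) g + Q_rows (act (Inr (-1, -1)) v) g =
    - (xx * act (Inr (-1, -1)) v g + xx * act (Inr (-1, -1)) v g
      + als * act (Inr (0, -1)) v g - bes * act (Inr (-1, 0)) v g)"
  "act (Inr (1, -1)) (Q_rows v) g + Q_rows (act (Inr (1, -1)) v) g =
    - (bes * act (Inr (1, 0)) v g + al * act (Inr (0, -1)) v g
      - (xx * act (Inr (1, -1)) v g + xx * act (Inr (1, -1)) v g))"
  "act (Inr (-1, 1)) (Q_rows v) g + Q_rows (act (Inr (-1, 1)) v) g =
    - (be * act (Inr (-1, 0)) v g + als * act (Inr (0, 1)) v g
      - (xx * act (Inr (-1, 1)) v g + xx * act (Inr (-1, 1)) v g))"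
  by (rule all_gen4[THEN iffD2, rule_format];
      simp add: act_def Q_rows_def algebra_simps)+

definition generator_scale :: "nat + weight \<Rightarrow> complex" where
  "generator_scale i = (case i of Inl j \<Rightarrow> - (1/2) | Inr r \<Rightarrow> if fst r = 0 \<or> snd r = 0 then - (1/rt2) else -1)"

lemma generator_scale_nonzero: "generator_scale i \<noteq> 0"
  by (simp add: generator_scale_def split: sum.split)

lemma generator_coord:
  assumes "i \<in> gauge_index"
  shows "generator i (coord g) = generator_scale i *\<^sub>C (act i coord g + Q_rows (act i coord) g)"
proof -
  have rt2_square: "rt2 * rt2 = 2" by (simp flip: of_real_mult)
  have rt2_half: "(1 / (rt2 * 2)) *\<^sub>C a + (1 / (rt2 * 2)) *\<^sub>C a = (1/rt2) *\<^sub>C a" for a :: OS7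
    by (simp add: field_simps flip: scaleC_add_left)
  have rt2_double: "rt2 *\<^sub>C (a * b) = (1/rt2) *\<^sub>C (a * b) + (1/rt2) *\<^sub>C (a * b)" for a b :: OS7
    using rt2_square by (simp add: field_simps flip: scaleC_add_left)
  note unfold = generator_def generator_scale_def symplectic_coord
    anticommutators[of coord, unfolded Q_rows_coord]
  consider "i = Inl 1" | "i = Inl 2"
    | "i \<in> {Inr (1, 0), Inr (-1, 0), Inr (0, 1), Inr (0, -1)}"
    | "i \<in> {Inr (1, 1), Inr (1, -1), Inr (-1, 1), Inr (-1, -1)}"
    using assms by (auto simp: gauge_index_def)
  then show ?thesis
  proof cases
    case 3
    then show ?thesis
      unfolding insert_iff empty_iff
      by (elim disjE; simp add: unfold W_def scaleC_add_right complex_algebra.scale_right_diff_distrib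
          rt2_half rt2_double)
  next
    case 4
    then show ?thesis
      unfolding insert_iff empty_iff
      by (elim disjE; simp add: unfold W_def two_scaleC distrib_right)
  qed (simp_all add: unfold K_def half_double del: One_nat_def)
qed

lemma derivation_generator:
  assumes "i \<in> gauge_index"
  shows "derivation (generator i)"
  using assms unfolding gauge_index_def insert_iff empty_iff
  by (elim disjE; simp add: generator_def K_def[abs_def] W_def[abs_def] derivation_intros symplectic_derivations)

text \<open>Since \<open>Q\<^sup>2 = 1\<close>, the image of \<open>1 + Q\<close> is fixed by \<open>Q\<close>.\<close>

lemma Q_rows_generator:
  assumes "i \<in> gauge_index"
  shows "Q_rows (\<lambda>g. generator i (coord g)) = (\<lambda>g. generator i (coord g))"
  by (simp add: fun_eq_iff generator_coord[OF assms] Q_rows_scale Q_rows_add Q_rows_Q_rows add.commute)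

lemma row_covariant_act:
  assumes "i \<in> gauge_index" and v: "row_covariant v"
  shows "row_covariant (act i v)"
proof -
  have "row_covariant (act i v)" if "i = j" "j \<in> gauge_index" for j
    using that(2) unfolding gauge_index_def insert_iff empty_iff
    by (elim disjE; simp add: that(1) row_covariant_def all_gen4 act_def coaction_rows_def coaction_simps
        row_covariantD[OF v] tens_simps)
  then show ?thesis using assms(1) by blast
qed

lemma generator_in_gauge_algebra:
  assumes "i \<in> gauge_index"
  shows "generator i \<in> gauge_algebra"
proof -
  have "row_covariant (\<lambda>g. generator i (coord g))"
    using row_covariant_act[OF assms row_covariant_coord]
    by (simp add: generator_coord[OF assms] row_covariant_scale row_covariant_add row_covariant_Q_rows)
  then show ?thesis
    using derivation_generator[OF assms] derivation_kills_OS4[OF _ Q_rows_generator[OF assms]]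
    by (simp add: gauge_algebra_def equivariant_derivation_iff)
qed

text \<open>The commutator with \<open>H\<^sub>j\<close> is a derivation, hence determined by its values on generators.\<close>

lemma weight_map_derivationI:
  assumes d: "derivation d" and w: "\<And>g. d (coord g) \<in> weight_space (coord_weight g + r)"
  shows "weight_map r d"
proof -
  have "commutator h d = (\<lambda>a. c *\<^sub>C d a)"
    if h: "derivation h" and "\<And>g. h (coord g) = x g *\<^sub>C coord g"
      "\<And>g. h (d (coord g)) = (x g + c) *\<^sub>C d (coord g)" for h x c
    by (rule derivation_eqI[OF derivation_commutator[OF h d] derivation_scale[OF d]])
      (simp add: commutator_def that clinear_scaleC[OF derivation_clinear[OF d]] scaleC_add_left)
  note comm = this
  show ?thesis
    unfolding weight_map_def
  proof (intro conjI derivation_clinear[OF d])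
    show "commutator H1 d = (\<lambda>a. of_real (fst r) *\<^sub>C d a)"
      by (rule comm[OF derivation_H1, of "\<lambda>g. of_real (fst (coord_weight g))"])
        (use coord_in_weight_space w in \<open>auto simp: weight_space_def\<close>)
    show "commutator H2 d = (\<lambda>a. of_real (snd r) *\<^sub>C d a)"
      by (rule comm[OF derivation_H2, of "\<lambda>g. of_real (snd (coord_weight g))"])
        (use coord_in_weight_space w in \<open>auto simp: weight_space_def\<close>)
  qed
qed

lemma weight_space_mult_eq:
  "a \<in> weight_space m \<Longrightarrow> b \<in> weight_space n \<Longrightarrow> m + n = k \<Longrightarrow> a * b \<in> weight_space k"
  using weight_space_mult by blast

lemma OS4_generator_weights:
  "al \<in> weight_space (1, 0)" "als \<in> weight_space (-1, 0)" "be \<in> weight_space (0, 1)"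
  "bes \<in> weight_space (0, -1)" "xx \<in> weight_space 0"
proof -
  note w = weight_space_mult_eq[OF coord_in_weight_space coord_in_weight_space]
  show "al \<in> weight_space (1, 0)" "als \<in> weight_space (-1, 0)" "be \<in> weight_space (0, 1)"
    "bes \<in> weight_space (0, -1)" "xx \<in> weight_space 0"
    unfolding al_def als_def be_def bes_def xx_def
    by (intro weight_space_scale weight_space_add weight_space_diff w;
        simp add: coord_weight_def zero_prod_def)+
qed

lemma Q_rows_in_weight_space:
  assumes v: "\<And>g. v g \<in> weight_space (coord_weight g + r)"
  shows "Q_rows v g \<in> weight_space (coord_weight g + r)"
proof -
  have eq: "a * v h \<in> weight_space (coord_weight g + r)"
    if "a \<in> weight_space m" "m + coord_weight h = coord_weight g" for a m h g
    by (rule weight_space_mult_eq[OF that(1) v]) (simp flip: that(2) add: add.assoc)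
  have "\<forall>g. Q_rows v g \<in> weight_space (coord_weight g + r)"
    unfolding all_gen4
    by (simp add: Q_rows_def; intro conjI weight_space_add weight_space_diff;
        (rule eq, rule OS4_generator_weights, simp add: coord_weight_def))
  then show ?thesis ..
qed

lemma act_in_weight_space:
  assumes "i \<in> gauge_index"
  shows "act i coord g \<in> weight_space (coord_weight g + generator_weight i)"
proof -
  have eq: "coord h \<in> weight_space k" "- coord h \<in> weight_space k" if "coord_weight h = k" for h k
    using coord_in_weight_space[of h] weight_space_minus that by blast+
  have "\<forall>g. act i coord g \<in> weight_space (coord_weight g + generator_weight i)"
    using assms unfolding gauge_index_def insert_iff empty_iff all_gen4
    by (elim disjE; simp add: act_def generator_weight_def weight_space_zero;
        intro conjI eq; simp add: coord_weight_def)
  then show ?thesis ..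
qed

lemma weight_map_generator:
  assumes "i \<in> gauge_index"
  shows "weight_map (generator_weight i) (generator i)"
  by (rule weight_map_derivationI[OF derivation_generator[OF assms]])
    (simp add: generator_coord[OF assms] weight_space_scale weight_space_add act_in_weight_space[OF assms]
      Q_rows_in_weight_space)

lemma Q_rows_sum:
  "finite S \<Longrightarrow> Q_rows (\<lambda>g. \<Sum>i\<in>S. c i * v i g) g = (\<Sum>i\<in>S. c i * Q_rows (v i) g)"
proof (induction S rule: finite_induct)
  case empty
  show ?case using Q_rows_mult[of 0 "\<lambda>_. 0"] by simp
qed (simp add: Q_rows_add Q_rows_mult)

lemma derivation_sum: "(\<And>i. i \<in> S \<Longrightarrow> derivation (d i)) \<Longrightarrow> derivation (\<lambda>a. \<Sum>i\<in>S. d i a)"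
  by (induction S rule: infinite_finite_induct) (simp_all add: derivation_intros)

text \<open>The coefficients are twice those of \<open>(D M) M\<^sup>\<dagger>\<close> in the basis \<open>T\<^sub>i\<close>. The entries of this matrix are
  minors of two covariant matrices, hence coinvariant; \<open>M\<^sup>\<dagger>M = 1\<close> gives the expansion of \<open>D M\<close>.\<close>

lemma gauge_algebra_act_expansion:
  assumes D: "D \<in> gauge_algebra"
  obtains c where "\<And>i. i \<in> gauge_index \<Longrightarrow> c i \<in> OS4"
    "\<And>g. (\<Sum>i\<in>gauge_index. c i * act i coord g) = D (coord g) + D (coord g)"
    "Q_rows (\<lambda>g. D (coord g)) = (\<lambda>g. D (coord g))"
proof -
  have d: "derivation D" and equi: "equivariant D" and vert: "\<And>b. b \<in> OS4 \<Longrightarrow> D b = 0"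
    using D by (auto simp: gauge_algebra_def)
  note lin = derivation_clinear[OF d]
  have "\<forall>g. Q_rows (\<lambda>g. D (coord g)) g = D (Q_rows coord g)"
    unfolding all_gen4
    by (simp add: Q_rows_def clinear_add[OF lin] clinear_diff[OF lin] derivation_mult[OF d]
        vert OS4_generators)
  then have Q: "Q_rows (\<lambda>g. D (coord g)) = (\<lambda>g. D (coord g))"
    by (simp add: Q_rows_coord fun_eq_iff)
  have "row_covariant (\<lambda>g. D (coord g))"
    using equi by (simp add: equivariant_derivation_iff[OF d])
  note Y = minors_coinvariant[OF this]
  define Y11 where "Y11 = D (zz 1) * zs 1 + D (zs 2) * zz 2"
  define Y33 where "Y33 = D (zz 3) * zs 3 + D (zs 4) * zz 4"
  define Y31 where "Y31 = D (zz 3) * zs 1 + D (zs 4) * zz 2"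
  define Y13 where "Y13 = D (zz 1) * zs 3 + D (zs 2) * zz 4"
  define Y32 where "Y32 = D (zz 3) * zs 2 - D (zs 4) * zz 1"
  define Y41 where "Y41 = D (zz 4) * zs 1 - D (zs 3) * zz 2"
  define Y34 where "Y34 = D (zz 3) * zs 4 - D (zs 4) * zz 3"
  define Y43 where "Y43 = D (zz 4) * zs 3 - D (zs 3) * zz 4"
  define Y21 where "Y21 = D (zz 2) * zs 1 - D (zs 1) * zz 2"
  define Y12 where "Y12 = D (zz 1) * zs 2 - D (zs 2) * zz 1"
  note Y_defs = Y11_def Y33_def Y31_def Y13_def Y32_def Y41_def Y34_def Y43_def Y21_def Y12_def
  \<comment> \<open>For the symplectic matrix \<open>Y\<close> the diagonal is \<open>(Y11, - Y11, Y33, - Y33)\<close>, and every \<open>T\<^sub>i\<close> off the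
    diagonal is detected by one of its entries.\<close>
  define c :: "nat + weight \<Rightarrow> OS7" where
    "c = (\<lambda>_. 0)(Inl 1 := Y11 - Y33, Inl 2 := - (Y11 + Y33), Inr (1, 0) := Y31 + Y31,
      Inr (-1, 0) := Y13 + Y13, Inr (0, 1) := Y32 + Y32, Inr (0, -1) := Y41 + Y41,
      Inr (1, 1) := - (Y34 + Y34), Inr (-1, -1) := - (Y43 + Y43), Inr (1, -1) := - (Y21 + Y21),
      Inr (-1, 1) := - (Y12 + Y12))"
  have c_OS4: "c i \<in> OS4" for i
    using Y[folded Y_defs]
    by (simp add: c_def OS4_intros)
  obtain X11 X12 X21 where X:
    "D (zz 1) = zz 1 * X11 - zs 2 * X21" "D (zs 2) = - zz 1 * X12 - zs 2 * X11"
    "D (zz 2) = zz 2 * X11 + zs 1 * X21" "D (zs 1) = zz 2 * X12 - zs 1 * X11"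
    "D (zz 3) = zz 3 * X11 - zs 4 * X21" "D (zs 4) = - zz 3 * X12 - zs 4 * X11"
    "D (zz 4) = zz 4 * X11 + zs 3 * X21" "D (zs 3) = zz 4 * X12 - zs 3 * X11"
    using right_multiplication[OF d Q] .
  have "\<forall>g. (\<Sum>i\<in>gauge_index. c i * act i coord g)
      = (D (coord g) + D (coord g)) * (zz 1 * zs 1 + zz 2 * zs 2 + zz 3 * zs 3 + zz 4 * zs 4)"
    unfolding all_gen4 sum_gauge_index
    by (simp add: c_def act_def Y_defs X algebra_simps)
  then have "(\<Sum>i\<in>gauge_index. c i * act i coord g) = D (coord g) + D (coord g)" for g
    by (simp add: sphere_relation_4)
  then show ?thesis using that c_OS4 Q by blast
qed

text \<open>Apply \<open>1 + Q\<close> to the previous expansion.\<close>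

lemma gauge_algebra_generated:
  assumes D: "D \<in> gauge_algebra"
  obtains c where "\<And>i. i \<in> gauge_index \<Longrightarrow> c i \<in> OS4"
    "D = (\<lambda>a. \<Sum>i\<in>gauge_index. c i * generator i a)"
proof -
  have d: "derivation D" using D by (simp add: gauge_algebra_def)
  obtain c where c: "\<And>i. i \<in> gauge_index \<Longrightarrow> c i \<in> OS4"
    and sum: "\<And>g. (\<Sum>i\<in>gauge_index. c i * act i coord g) = D (coord g) + D (coord g)"
    and Q: "Q_rows (\<lambda>g. D (coord g)) = (\<lambda>g. D (coord g))"
    by (rule gauge_algebra_act_expansion[OF D]) blast
  have fin: "finite gauge_index" by (simp add: gauge_index_def)
  define e where "e i = (1 / (4 * generator_scale i)) *\<^sub>C c i" for i
  have e: "e i * generator i (coord g)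
      = (1/4) *\<^sub>C (c i * act i coord g + c i * Q_rows (act i coord) g)" if "i \<in> gauge_index" for i g
    using generator_scale_nonzero[of i]
    by (simp add: e_def generator_coord[OF that] distrib_left scaleC_add_right)
  have "(\<Sum>i\<in>gauge_index. e i * generator i (coord g)) = D (coord g)" for g
  proof -
    have Q_sum: "(\<Sum>i\<in>gauge_index. c i * Q_rows (act i coord) g) = D (coord g) + D (coord g)"
      unfolding Q_rows_sum[OF fin, symmetric] sum by (simp add: Q_rows_add Q)
    have "(\<Sum>i\<in>gauge_index. e i * generator i (coord g))
        = (1/4) *\<^sub>C (\<Sum>i\<in>gauge_index. c i * act i coord g + c i * Q_rows (act i coord) g)"
      by (simp add: e complex_algebra.scale_sum_right)
    also have "\<dots> = (1/4) *\<^sub>C ((D (coord g) + D (coord g)) + (D (coord g) + D (coord g)))"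
      by (simp add: sum.distrib sum Q_sum)
    also have "\<dots> = (1/2) *\<^sub>C ((1/2) *\<^sub>C ((D (coord g) + D (coord g)) + (D (coord g) + D (coord g))))"
      by simp
    also have "\<dots> = D (coord g)" by (simp only: half_double)
    finally show ?thesis .
  qed
  then have "D = (\<lambda>a. \<Sum>i\<in>gauge_index. e i * generator i a)"
    by (intro derivation_eqI[OF d] derivation_sum derivation_mult_left derivation_generator) simp_all
  moreover have "e i \<in> OS4" if "i \<in> gauge_index" for i
    by (simp add: e_def OS4_scale c that)
  ultimately show ?thesis using that by blast
qed


section \<open>Generators of the twisted gauge algebra\<close>

lemma gauge_algebra_sum:
  assumes "finite S" "\<And>i. i \<in> S \<Longrightarrow> u i \<in> gauge_algebra"
  shows "(\<lambda>a. \<Sum>i\<in>S. u i a) \<in> gauge_algebra"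
  using assms
proof (induction S rule: finite_induct)
  case empty
  have "row_covariant (\<lambda>g. 0)"
    using row_covariant_scale[OF row_covariant_coord, of 0] by simp
  then show ?case
    using equivariant_derivation_iff[OF derivation_zero_map]
    by (simp add: gauge_algebra_def derivation_zero_map)
next
  case (insert i S)
  then have u: "u i \<in> gauge_algebra" and s: "(\<lambda>a. \<Sum>i\<in>S. u i a) \<in> gauge_algebra" by auto
  have "(\<lambda>a. u i a + (\<Sum>i\<in>S. u i a)) \<in> gauge_algebra"
    unfolding gauge_algebra_def mem_Collect_eq
  proof (intro conjI ballI)
    show "derivation (\<lambda>a. u i a + (\<Sum>i\<in>S. u i a))"
      using u s by (intro derivation_add) (simp_all add: gauge_algebra_def)
    show "equivariant (\<lambda>a. u i a + (\<Sum>i\<in>S. u i a))"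
      using u s by (intro equivariant_add) (simp_all add: gauge_algebra_def derivation_clinear)
    show "u i b + (\<Sum>i\<in>S. u i b) = 0" if "b \<in> OS4" for b
      using u s that by (simp add: gauge_algebra_def)
  qed
  then show ?case using insert.hyps by simp
qed

lemma gauge_algebra_mult_left:
  assumes "u \<in> gauge_algebra" "c \<in> OS4"
  shows "(\<lambda>a. c * u a) \<in> gauge_algebra"
  using assms equivariant_mult_left[OF derivation_clinear]
  by (simp add: gauge_algebra_def derivation_mult_left)

lemma tmod_sum_left: "tmod \<theta> (\<Sum>i\<in>I. c i) u a = (\<Sum>i\<in>I. tmod \<theta> (c i) u a)"
  by (simp add: tmod_def clinear_sum[OF clinear_tprod_left])

text \<open>The elements of \<open>module_generated\<close> are sums over sets of maps. If an indexed family repeats a map, its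
  coefficients have to be added.\<close>

lemma module_generated_sum:
  assumes "finite I" "\<And>i. i \<in> I \<Longrightarrow> c i \<in> OS4"
  shows "(\<lambda>a. \<Sum>i\<in>I. tmod \<theta> (c i) (u i) a) \<in> module_generated \<theta> (u ` I)"
proof -
  let ?c = "\<lambda>g. \<Sum>i\<in>{i\<in>I. u i = g}. c i"
  have "(\<Sum>i\<in>I. tmod \<theta> (c i) (u i) a) = (\<Sum>g\<in>u ` I. tmod \<theta> (?c g) g a)" for a
  proof -
    have "(\<Sum>i\<in>I. tmod \<theta> (c i) (u i) a)
        = (\<Sum>g\<in>u ` I. \<Sum>i\<in>{i\<in>I. u i = g}. tmod \<theta> (c i) (u i) a)"
      by (rule sum.image_gen[OF assms(1)])
    also have "\<dots> = (\<Sum>g\<in>u ` I. \<Sum>i\<in>{i\<in>I. u i = g}. tmod \<theta> (c i) g a)"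
      by (intro sum.cong) auto
    finally show ?thesis by (simp only: tmod_sum_left)
  qed
  then have "(\<lambda>a. \<Sum>i\<in>I. tmod \<theta> (c i) (u i) a) = (\<lambda>a. \<Sum>g\<in>u ` I. tmod \<theta> (?c g) g a)" by blast
  moreover have "?c ` u ` I \<subseteq> OS4"
    using assms(2) by (auto intro: OS4_sum)
  ultimately show ?thesis
    unfolding module_generated_def mem_Collect_eq
    by (intro exI[of _ ?c] exI[of _ "u ` I"] conjI) (simp_all add: assms(1))
qed

text \<open>The twist converts coefficients \<open>c\<close> of a generator of weight \<open>r\<close> into \<open>torus r c\<close>. This is a bijection
  of \<open>OS4\<close>, because the torus commutes with the coaction.\<close>

lemma aut_eq_module_generated:
  "aut \<theta> = module_generated \<theta> ((\<lambda>i. Dtwist \<theta> (generator i)) ` gauge_index)"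
proof
  have fin: "finite gauge_index" by (simp add: gauge_index_def)
  show "aut \<theta> \<subseteq> module_generated \<theta> ((\<lambda>i. Dtwist \<theta> (generator i)) ` gauge_index)"
  proof
    fix u assume "u \<in> aut \<theta>"
    then obtain D where D: "D \<in> gauge_algebra" and u: "u = Dtwist \<theta> D"
      using aut_eq_Dtwist_image by blast
    obtain c where c: "\<And>i. i \<in> gauge_index \<Longrightarrow> c i \<in> OS4"
      and D_eq: "D = (\<lambda>a. \<Sum>i\<in>gauge_index. c i * generator i a)"
      by (rule gauge_algebra_generated[OF D]) blast
    have lin: "clinear (\<lambda>a. c i * generator i a)" if "i \<in> gauge_index" for i
      using clinear_mult_left[OF derivation_clinear[OF derivation_generator[OF that]]] .
    have "u = (\<lambda>a. \<Sum>i\<in>gauge_index. tmod \<theta> (torus \<theta> (generator_weight i) (c i)) (Dtwist \<theta> (generator i)) a)"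
      unfolding u D_eq
      by (subst Dtwist_sum[OF lin], assumption, intro ext sum.cong refl)
        (simp add: Dtwist_mult_left[OF weight_map_generator])
    then show "u \<in> module_generated \<theta> ((\<lambda>i. Dtwist \<theta> (generator i)) ` gauge_index)"
      using module_generated_sum[OF fin, of "\<lambda>i. torus \<theta> (generator_weight i) (c i)"] OS4_torus[OF c]
      by simp
  qed
  show "module_generated \<theta> ((\<lambda>i. Dtwist \<theta> (generator i)) ` gauge_index) \<subseteq> aut \<theta>"
  proof
    fix u assume "u \<in> module_generated \<theta> ((\<lambda>i. Dtwist \<theta> (generator i)) ` gauge_index)"
    then obtain c T where T: "finite T" "T \<subseteq> (\<lambda>i. Dtwist \<theta> (generator i)) ` gauge_index"
      and c: "c ` T \<subseteq> OS4" and u: "u = (\<lambda>a. \<Sum>g\<in>T. tmod \<theta> (c g) g a)"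
      unfolding module_generated_def by blast
    have "\<forall>g\<in>T. \<exists>i\<in>gauge_index. g = Dtwist \<theta> (generator i)" using T(2) by blast
    then obtain j where j: "\<And>g. g \<in> T \<Longrightarrow> j g \<in> gauge_index"
      "\<And>g. g \<in> T \<Longrightarrow> g = Dtwist \<theta> (generator (j g))"
      by metis
    define e where "e g = torus \<theta> (- generator_weight (j g)) (c g)" for g
    have e: "e g \<in> OS4" if "g \<in> T" for g
      unfolding e_def using c that by (blast intro: OS4_torus)
    have summand: "tmod \<theta> (c g) g = Dtwist \<theta> (\<lambda>a. e g * generator (j g) a)" if "g \<in> T" for g
      using Dtwist_mult_left[OF weight_map_generator[OF j(1)[OF that]], of \<theta> "e g"] j(2)[OF that]
      by (simp add: e_def)
    have gauge: "(\<lambda>a. e g * generator (j g) a) \<in> gauge_algebra" if "g \<in> T" for g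
      by (rule gauge_algebra_mult_left[OF generator_in_gauge_algebra[OF j(1)[OF that]] e[OF that]])
    have lin: "clinear (\<lambda>a. e g * generator (j g) a)" if "g \<in> T" for g
      by (rule clinear_mult_left[OF derivation_clinear[OF derivation_generator[OF j(1)[OF that]]]])
    have "u = Dtwist \<theta> (\<lambda>a. \<Sum>g\<in>T. e g * generator (j g) a)"
      unfolding u by (subst Dtwist_sum[OF lin], assumption, intro ext sum.cong refl) (simp add: summand)
    then show "u \<in> aut \<theta>"
      using Dtwist_gauge_algebra[OF gauge_algebra_sum[OF T(1) gauge]] by simp
  qed
qed

lemma twisted_generators_image:
  "Kt \<theta> ` {1, 2} \<union> Wt \<theta> ` Roots = (\<lambda>i. Dtwist \<theta> (generator i)) ` gauge_index"
  unfolding gauge_index_image image_Un image_image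
  by (simp add: generator_def Kt_def[abs_def] Wt_def[abs_def])

lemma weight_map_K: "j \<in> {1, 2} \<Longrightarrow> weight_map 0 (K j)"
  using weight_map_generator[of "Inl j"]
  by (auto simp: gauge_index_image generator_def generator_weight_def)

lemma weight_map_W: "r \<in> Roots \<Longrightarrow> weight_map r (W r)"
  using weight_map_generator[of "Inr r"]
  by (auto simp: gauge_index_image generator_def generator_weight_def)

lemma Dtwist_weight_zero:
  assumes "weight_map 0 u"
  shows "Dtwist \<theta> u = u"
proof
  note lin = weight_map_clinear[OF assms]
  show "Dtwist \<theta> u a = u a" for a
    by (rule clinear_weight_eqI[OF clinear_Dtwist[OF lin] lin]) (simp add: Dtwist_weight_map[OF assms])
qed

lemma Dtwist_weight_map_torus:
  assumes "weight_map r u"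
  shows "Dtwist \<theta> u = u \<circ> torus \<theta> r"
proof
  note lin = weight_map_clinear[OF assms]
  show "Dtwist \<theta> u a = (u \<circ> torus \<theta> r) a" for a
    unfolding comp_def
    by (rule clinear_weight_eqI[OF clinear_Dtwist[OF lin] clinear_comp[OF lin clinear_torus]])
      (simp add: Dtwist_weight_map[OF assms] torus_homogeneous clinear_scaleC[OF lin])
qed

lemma weight_exp_eq_torus:
  "weight_exp (\<i> * of_real (pi * \<theta> * snd r)) (- (\<i> * of_real (pi * \<theta> * fst r))) = torus \<theta> r"
proof
  have "exp (\<i> * of_real (pi * \<theta> * snd r) * of_real (fst m) + - (\<i> * of_real (pi * \<theta> * fst r)) * of_real (snd m))
      = Fbar \<theta> r m" for m
    unfolding Fbar_def wedge_def of_real_mult of_real_diff by (rule arg_cong[where f = exp]) algebra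
  then show "weight_exp (\<i> * of_real (pi * \<theta> * snd r)) (- (\<i> * of_real (pi * \<theta> * fst r))) a = torus \<theta> r a" for a
    by (simp add: weight_exp_def torus_def)
qed


section \<open>The braided bracket of module elements\<close>

lemma clinear_tmod: "clinear u \<Longrightarrow> clinear (tmod \<theta> b u)"
  unfolding tmod_def by (rule clinear_comp[OF clinear_tprod_right])

lemma mpart_tmod:
  assumes u: "clinear u" and b: "b \<in> weight_space k"
  shows "mpart (tmod \<theta> b u) r a = b \<star>\<^bsub>\<theta>\<^esub> mpart u (r - k) a"
proof -
  have "map_decomposition (tmod \<theta> b u) (\<lambda>r a. b \<star>\<^bsub>\<theta>\<^esub> mpart u (r - k) a)"
    unfolding map_decomposition_def
  proof (intro conjI allI)
    show "weight_map r (\<lambda>a. b \<star>\<^bsub>\<theta>\<^esub> mpart u (r - k) a)" for r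
      unfolding weight_map_iff
    proof (intro conjI allI ballI)
      show "clinear (\<lambda>a. b \<star>\<^bsub>\<theta>\<^esub> mpart u (r - k) a)"
        by (rule clinear_comp[OF clinear_tprod_right clinear_mpart[OF u]])
      fix m a assume "a \<in> weight_space m"
      then have "b \<star>\<^bsub>\<theta>\<^esub> mpart u (r - k) a \<in> weight_space (k + (m + (r - k)))"
        by (intro tprod_in_weight_space b mpart_in_weight_space[OF u])
      then show "b \<star>\<^bsub>\<theta>\<^esub> mpart u (r - k) a \<in> weight_space (m + r)" by simp
    qed
    fix a
    have fin: "finite {r. mpart u (r - k) a \<noteq> 0}"
      using finite_support_shift[OF finite_mpart[OF u], of "- k" a] by simp
    show "finite {r. b \<star>\<^bsub>\<theta>\<^esub> mpart u (r - k) a \<noteq> 0}"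
      by (rule finite_support_mono[OF fin]) (simp add: tprod_zero_right)
    have "Sum_any (\<lambda>r. mpart u (r - k) a) = u a"
      using Sum_any_shift[of "\<lambda>r. mpart u r a" "- k"] by (simp add: Sum_any_mpart[OF u])
    then show "Sum_any (\<lambda>r. b \<star>\<^bsub>\<theta>\<^esub> mpart u (r - k) a) = tmod \<theta> b u a"
      by (simp add: tmod_def clinear_Sum_any[OF clinear_tprod_right fin, symmetric])
  qed
  then show ?thesis by (simp add: mpart_eqI)
qed

lemma tprod_commute_homogeneous:
  assumes b: "b \<in> weight_space k" and b': "b' \<in> weight_space l"
  shows "b' \<star>\<^bsub>\<theta>\<^esub> b = Fbar \<theta> (l + l) k *\<^sub>C (b \<star>\<^bsub>\<theta>\<^esub> b')"
  by (simp add: tprod_homogeneous_left[OF b'] tprod_homogeneous_left[OF b] torus_homogeneous[OF b]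
      torus_homogeneous[OF b'] Fbar_add_left mult.assoc mult.commute[of b])

text \<open>One summand of the second half of the bracket: moving \<open>b\<close> to the left past \<open>X'\<close> and \<open>b'\<close> produces
  braiding factors that all cancel, except for that between the map and \<open>b'\<close>.\<close>

lemma braided_summand:
  fixes r :: weight
  assumes X': "X' \<in> aut \<theta>" and b: "b \<in> OS4" "b \<in> weight_space k" and b': "b' \<in> weight_space l"
  defines "q \<equiv> (r + k) + (r + k)"
  shows "torus \<theta> q (tmod \<theta> b' X' (torus \<theta> (- q) (b \<star>\<^bsub>\<theta>\<^esub> y)))
    = Rmat \<theta> r l *\<^sub>C ((b \<star>\<^bsub>\<theta>\<^esub> b') \<star>\<^bsub>\<theta>\<^esub> torus \<theta> (r + r) (X' (torus \<theta> (- (r + r)) y)))"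
proof -
  note lin = aut_clinear[OF X']
  have q: "q + - (k + k) = r + r" "k + k + - q = - (r + r)"
    by (simp_all add: q_def algebra_simps)
  have "X' (torus \<theta> (- q) (b \<star>\<^bsub>\<theta>\<^esub> y))
      = Fbar \<theta> (- q) k *\<^sub>C (b \<star>\<^bsub>\<theta>\<^esub> torus \<theta> (- (k + k)) (X' (torus \<theta> (- (r + r)) y)))"
    by (simp only: torus_tprod torus_homogeneous[OF b(2)] tprod_scale_left clinear_scaleC[OF lin]
        aut_tprod_OS4[OF X' b] torus_torus q)
  then have "torus \<theta> q (tmod \<theta> b' X' (torus \<theta> (- q) (b \<star>\<^bsub>\<theta>\<^esub> y)))
      = (Fbar \<theta> (- q) k * (Fbar \<theta> q k * Fbar \<theta> q l)) *\<^sub>C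
        (b' \<star>\<^bsub>\<theta>\<^esub> (b \<star>\<^bsub>\<theta>\<^esub> torus \<theta> (r + r) (X' (torus \<theta> (- (r + r)) y))))"
    by (simp only: tmod_def tprod_scale_right torus_scale torus_tprod torus_homogeneous[OF b(2)]
        torus_homogeneous[OF b'] tprod_scale_left scaleC_scaleC torus_torus q)
  also have "\<dots> = (Fbar \<theta> (- q) k * (Fbar \<theta> q k * Fbar \<theta> q l) * Fbar \<theta> (l + l) k) *\<^sub>C
        ((b \<star>\<^bsub>\<theta>\<^esub> b') \<star>\<^bsub>\<theta>\<^esub> torus \<theta> (r + r) (X' (torus \<theta> (- (r + r)) y)))"
    by (simp only: tprod_assoc[symmetric] tprod_commute_homogeneous[OF b(2) b'] tprod_scale_left
        scaleC_scaleC)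
  also have "Fbar \<theta> (- q) k * (Fbar \<theta> q k * Fbar \<theta> q l) * Fbar \<theta> (l + l) k = Rmat \<theta> r l"
  proof -
    have "Fbar \<theta> k q * Fbar \<theta> q k = 1" "Fbar \<theta> k l * Fbar \<theta> l k = 1" by simp_all
    moreover have "Fbar \<theta> q l = (Fbar \<theta> r l * Fbar \<theta> k l) * (Fbar \<theta> r l * Fbar \<theta> k l)"
      by (simp only: q_def Fbar_add_left)
    ultimately show ?thesis
      unfolding Fbar_minus_left Fbar_add_left[of \<theta> l l] Rmat_def power2_eq_square by algebra
  qed
  finally show ?thesis .
qed

lemma Sum_any_diff:
  fixes f g :: "'i \<Rightarrow> 'a::ab_group_add"
  assumes f: "finite {i. f i \<noteq> 0}" and g: "finite {i. g i \<noteq> 0}"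
  shows "Sum_any (\<lambda>i. f i - g i) = Sum_any f - Sum_any g"
proof -
  have "finite {i. f i - g i \<noteq> 0}"
    by (rule finite_subset[OF _ finite_UnI[OF f g]]) auto
  then have "Sum_any (\<lambda>i. (f i - g i) + g i) = Sum_any (\<lambda>i. f i - g i) + Sum_any g"
    using g by (rule Sum_any.distrib)
  then show ?thesis by simp
qed

lemma tbracket_mpart:
  assumes X: "clinear X" and X': "clinear X'"
  shows "tbracket \<theta> (mpart X r) X' a
    = mpart X r (X' a) - torus \<theta> (r + r) (X' (torus \<theta> (- (r + r)) (mpart X r a)))"
proof -
  note lin = clinear_mpart[OF X, of r]
  have part: "mpart (mpart X r) q a = (if q = r then mpart X r a else 0)" for q
    by (rule mpart_weight_map[OF weight_map_mpart[OF X]])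
  have "Sum_any (\<lambda>q. torus \<theta> (q + q) (X' (torus \<theta> (- (q + q)) (mpart (mpart X r) q a))))
      = (\<Sum>q\<in>{r}. torus \<theta> (q + q) (X' (torus \<theta> (- (q + q)) (mpart (mpart X r) q a))))"
    by (rule Sum_any.expand_superset)
      (auto simp: part clinear_zero[OF clinear_torus] clinear_zero[OF X'] split: if_splits)
  then show ?thesis by (simp add: tbracket_swap[OF lin X'] part)
qed

lemma finite_tbracket_mpart:
  assumes X: "clinear X" and X': "clinear X'"
  shows "finite {r. tbracket \<theta> (mpart X r) X' a \<noteq> 0}"
  by (rule finite_subset[OF _ finite_UnI[OF finite_mpart[OF X, of "X' a"] finite_mpart[OF X, of a]]])
    (auto simp: tbracket_mpart[OF X X'] clinear_zero[OF clinear_torus] clinear_zero[OF X'])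

text \<open>In the first half of the bracket \<open>X\<close> passes \<open>b'\<close> and is conjugated, which amounts to the factors
  \<open>Rmat r l\<close> on its components. In the second half the components of \<open>b \<bullet> X\<close> have weights \<open>r + k\<close>, and
  after a shift of the summation each summand is treated by the preceding lemma.\<close>

lemma tbracket_tmod_homogeneous:
  assumes X: "X \<in> aut \<theta>" and X': "X' \<in> aut \<theta>"
    and b: "b \<in> OS4" "b \<in> weight_space k" and b': "b' \<in> OS4" "b' \<in> weight_space l"
  shows "tbracket \<theta> (tmod \<theta> b X) (tmod \<theta> b' X') a
    = (b \<star>\<^bsub>\<theta>\<^esub> b') \<star>\<^bsub>\<theta>\<^esub> Sum_any (\<lambda>r. Rmat \<theta> r l *\<^sub>C tbracket \<theta> (mpart X r) X' a)"
proof -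
  note lin = aut_clinear[OF X] and lin' = aut_clinear[OF X']
  let ?B = "b \<star>\<^bsub>\<theta>\<^esub> b'"
  let ?conj = "\<lambda>r. torus \<theta> (r + r) (X' (torus \<theta> (- (r + r)) (mpart X r a)))"
  have fin1: "finite {r. Rmat \<theta> r l *\<^sub>C mpart X r (X' a) \<noteq> 0}"
    by (rule finite_support_mono[OF finite_mpart[OF lin, of "X' a"]]) simp
  have fin2: "finite {r. Rmat \<theta> r l *\<^sub>C ?conj r \<noteq> 0}"
    by (rule finite_support_mono[OF finite_mpart[OF lin, of a]])
      (simp add: clinear_zero[OF clinear_torus] clinear_zero[OF lin'])
  have "Sum_any (\<lambda>r. torus \<theta> (r + r) (tmod \<theta> b' X' (torus \<theta> (- (r + r)) (mpart (tmod \<theta> b X) r a))))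
      = Sum_any (\<lambda>r. torus \<theta> ((r + k) + (r + k)) (tmod \<theta> b' X'
          (torus \<theta> (- ((r + k) + (r + k))) (mpart (tmod \<theta> b X) (r + k) a))))"
    by (rule Sum_any_shift[symmetric])
  also have "\<dots> = Sum_any (\<lambda>r. Rmat \<theta> r l *\<^sub>C (?B \<star>\<^bsub>\<theta>\<^esub> ?conj r))"
    by (simp only: mpart_tmod[OF lin b(2)] add_diff_cancel_right' braided_summand[OF X' b b'(2)])
  also have "\<dots> = ?B \<star>\<^bsub>\<theta>\<^esub> Sum_any (\<lambda>r. Rmat \<theta> r l *\<^sub>C ?conj r)"
    unfolding clinear_Sum_any[OF clinear_tprod_right fin2] tprod_scale_right ..
  finally have second: "Sum_any (\<lambda>r. torus \<theta> (r + r)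
      (tmod \<theta> b' X' (torus \<theta> (- (r + r)) (mpart (tmod \<theta> b X) r a))))
    = ?B \<star>\<^bsub>\<theta>\<^esub> Sum_any (\<lambda>r. Rmat \<theta> r l *\<^sub>C ?conj r)" .
  have "tmod \<theta> b X (tmod \<theta> b' X' a)
      = ?B \<star>\<^bsub>\<theta>\<^esub> torus \<theta> (- (l + l)) (X (torus \<theta> (l + l) (X' a)))"
    by (simp add: tmod_def aut_tprod_OS4[OF X b'] tprod_assoc)
  also have "torus \<theta> (- (l + l)) (X (torus \<theta> (l + l) (X' a))) = Sum_any (\<lambda>r. Rmat \<theta> r l *\<^sub>C mpart X r (X' a))"
    unfolding Sum_any_Fbar_mpart[OF lin, symmetric] Rmat_Fbar ..
  finally have "tbracket \<theta> (tmod \<theta> b X) (tmod \<theta> b' X') a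
      = ?B \<star>\<^bsub>\<theta>\<^esub> (Sum_any (\<lambda>r. Rmat \<theta> r l *\<^sub>C mpart X r (X' a)) - Sum_any (\<lambda>r. Rmat \<theta> r l *\<^sub>C ?conj r))"
    by (simp add: tbracket_swap[OF clinear_tmod[OF lin] clinear_tmod[OF lin']] second tprod_diff_right
        del: minus_add_distrib)
  then show ?thesis
    by (simp add: tbracket_mpart[OF lin lin'] complex_algebra.scale_right_diff_distrib
        Sum_any_diff[OF fin1 fin2] del: minus_add_distrib)
qed

text \<open>The weight components of a coinvariant are coinvariant.\<close>

lemma OS4_homogeneous_induct [consumes 1, case_names homogeneous add]:
  assumes b: "b \<in> OS4" and hom: "\<And>m b. b \<in> OS4 \<Longrightarrow> b \<in> weight_space m \<Longrightarrow> P b"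
    and add: "\<And>b c. b \<in> OS4 \<Longrightarrow> c \<in> OS4 \<Longrightarrow> P b \<Longrightarrow> P c \<Longrightarrow> P (b + c)"
  shows "P b"
proof -
  have "(\<Sum>m\<in>S. wpart b m) \<in> OS4 \<and> P (\<Sum>m\<in>S. wpart b m)" if "finite S" for S
    using that
  proof (induction S rule: finite_induct)
    case empty
    show ?case using hom[OF OS4_zero weight_space_zero] by (simp add: OS4_zero)
  next
    case (insert m S)
    then show ?case
      using add[OF OS4_wpart[OF b] _ hom[OF OS4_wpart[OF b] wpart_in_weight_space]]
      by (simp add: OS4_add OS4_wpart[OF b])
  qed
  from this[OF finite_wpart[of b]] show ?thesis
    using Sum_any_wpart[of b] by (simp add: Sum_any.expand_set)
qed

lemma tbracket_add_left:
  assumes u: "clinear u" and v: "clinear v" and w: "clinear w"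
  shows "tbracket \<theta> (\<lambda>a. u a + v a) w a = tbracket \<theta> u w a + tbracket \<theta> v w a"
proof -
  have fin: "finite {r. torus \<theta> (r + r) (w (torus \<theta> (- (r + r)) (mpart x r a))) \<noteq> 0}" if "clinear x" for x
    by (rule finite_support_mono[OF finite_mpart[OF that, of a]])
      (simp add: clinear_zero[OF clinear_torus] clinear_zero[OF w])
  show ?thesis
    by (simp add: tbracket_swap u v w clinear_plus mpart_add[OF u v] torus_add clinear_add[OF w]
        Sum_any.distrib fin add_diff_add del: minus_add_distrib)
qed

lemma tbracket_add_right:
  assumes u: "clinear u" and v: "clinear v" and w: "clinear w"
  shows "tbracket \<theta> u (\<lambda>a. v a + w a) a = tbracket \<theta> u v a + tbracket \<theta> u w a"
proof -
  have fin: "finite {r. torus \<theta> (r + r) (x (torus \<theta> (- (r + r)) (mpart u r a))) \<noteq> 0}" if "clinear x" for x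
    by (rule finite_support_mono[OF finite_mpart[OF u, of a]])
      (simp add: clinear_zero[OF clinear_torus] clinear_zero[OF that])
  show ?thesis
    by (simp add: tbracket_swap u v w clinear_plus torus_add clinear_add[OF u]
        Sum_any.distrib fin add_diff_add del: minus_add_distrib)
qed

lemma tmod_add_left: "tmod \<theta> (b + c) u = (\<lambda>a. tmod \<theta> b u a + tmod \<theta> c u a)"
  by (simp add: tmod_def tprod_add_left)

lemma tbracket_tmod:
  assumes X: "X \<in> aut \<theta>" and X': "X' \<in> aut \<theta>" and b: "b \<in> OS4" and b': "b' \<in> OS4"
  shows "tbracket \<theta> (tmod \<theta> b X) (tmod \<theta> b' X') a
    = Sum_any (\<lambda>s. Sum_any (\<lambda>r.
        Rmat \<theta> r s *\<^sub>C tmod \<theta> (b \<star>\<^bsub>\<theta>\<^esub> wpart b' s) (tbracket \<theta> (mpart X r) X') a))"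
proof -
  note lin = aut_clinear[OF X] and lin' = aut_clinear[OF X']
  define Y where "Y s = Sum_any (\<lambda>r. Rmat \<theta> r s *\<^sub>C tbracket \<theta> (mpart X r) X' a)" for s
  have fin: "finite {r. Rmat \<theta> r s *\<^sub>C tbracket \<theta> (mpart X r) X' a \<noteq> 0}" for s
    by (rule finite_support_mono[OF finite_tbracket_mpart[OF lin lin', of \<theta> a]]) simp
  have inner: "Sum_any (\<lambda>r. Rmat \<theta> r s *\<^sub>C tmod \<theta> c (tbracket \<theta> (mpart X r) X') a) = c \<star>\<^bsub>\<theta>\<^esub> Y s" for c s
    unfolding Y_def tmod_def
    by (simp add: clinear_Sum_any[OF clinear_tprod_right fin] tprod_scale_right)
  have L: "clinear (\<lambda>c. (b \<star>\<^bsub>\<theta>\<^esub> c) \<star>\<^bsub>\<theta>\<^esub> Y s)" for s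
    by (rule clinear_comp[OF clinear_tprod_left clinear_tprod_right])
  have "tbracket \<theta> (tmod \<theta> b X) (tmod \<theta> b' X') a = Sum_any (\<lambda>s. (b \<star>\<^bsub>\<theta>\<^esub> wpart b' s) \<star>\<^bsub>\<theta>\<^esub> Y s)"
    using b'
  proof (induction b' rule: OS4_homogeneous_induct)
    case (homogeneous l b')
    note b' = this
    have "tbracket \<theta> (tmod \<theta> b X) (tmod \<theta> b' X') a = (b \<star>\<^bsub>\<theta>\<^esub> b') \<star>\<^bsub>\<theta>\<^esub> Y l"
      using b
    proof (induction b rule: OS4_homogeneous_induct)
      case (homogeneous k b)
      then show ?case
        unfolding Y_def by (rule tbracket_tmod_homogeneous[OF X X' _ _ b'])
    next
      case (add b c)
      then show ?case
        by (simp add: tmod_add_left tbracket_add_left[OF clinear_tmod[OF lin] clinear_tmod[OF lin]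
              clinear_tmod[OF lin']] tprod_add_left)
    qed
    then show ?case
      by (simp add: on_weights_homogeneous[of "\<lambda>s c. (b \<star>\<^bsub>\<theta>\<^esub> c) \<star>\<^bsub>\<theta>\<^esub> Y s", OF L b'(2)])
  next
    case (add b' c')
    then show ?case
      by (simp add: tmod_add_left tbracket_add_right[OF clinear_tmod[OF lin] clinear_tmod[OF lin']
            clinear_tmod[OF lin']]
          clinear_add[OF clinear_on_weights[of "\<lambda>s c. (b \<star>\<^bsub>\<theta>\<^esub> c) \<star>\<^bsub>\<theta>\<^esub> Y s", OF L]])
  qed
  then show ?thesis by (simp only: inner)
qed

theorem proposition8p5:
  fixes \<theta> :: real
  shows
    "(\<forall>j\<in>{1, 2}. Kt \<theta> j = K j) \<and>
     (\<forall>r\<in>Roots. Wt \<theta> r =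
        W r \<circ> weight_exp (\<i> * of_real (pi * \<theta> * snd r)) (- (\<i> * of_real (pi * \<theta> * fst r)))) \<and>
     aut \<theta> = module_generated \<theta> (Kt \<theta> ` {1, 2} \<union> Wt \<theta> ` Roots) \<and>
     tbracket \<theta> (Kt \<theta> 1) (Kt \<theta> 2) = Dtwist \<theta> (commutator (K 1) (K 2)) \<and>
     (\<forall>j\<in>{1, 2}. \<forall>r\<in>Roots.
        tbracket \<theta> (Kt \<theta> j) (Wt \<theta> r) = Dtwist \<theta> (commutator (K j) (W r))) \<and>
     (\<forall>r\<in>Roots. \<forall>s\<in>Roots.
        tbracket \<theta> (Wt \<theta> r) (Wt \<theta> s) =
          (\<lambda>a. exp (- (\<i> * of_real (pi * \<theta> * wedge r s))) *\<^sub>C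
                 Dtwist \<theta> (commutator (W r) (W s)) a)) \<and>
     (\<forall>X\<in>aut \<theta>. \<forall>X'\<in>aut \<theta>. \<forall>b\<in>OS4. \<forall>b'\<in>OS4.
        tbracket \<theta> (tmod \<theta> b X) (tmod \<theta> b' X') =
          (\<lambda>a. Sum_any (\<lambda>s. Sum_any (\<lambda>r.
             Rmat \<theta> r s *\<^sub>C tmod \<theta> (b \<star>\<^bsub>\<theta>\<^esub> wpart b' s) (tbracket \<theta> (mpart X r) X') a))))"
proof (intro conjI ballI)
  show "Kt \<theta> j = K j" if "j \<in> {1, 2}" for j
    unfolding Kt_def by (rule Dtwist_weight_zero[OF weight_map_K[OF that]])
  show "Wt \<theta> r = W r \<circ> weight_exp (\<i> * of_real (pi * \<theta> * snd r)) (- (\<i> * of_real (pi * \<theta> * fst r)))"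
    if "r \<in> Roots" for r
    unfolding Wt_def weight_exp_eq_torus by (rule Dtwist_weight_map_torus[OF weight_map_W[OF that]])
  show "aut \<theta> = module_generated \<theta> (Kt \<theta> ` {1, 2} \<union> Wt \<theta> ` Roots)"
    unfolding twisted_generators_image by (rule aut_eq_module_generated)
  show "tbracket \<theta> (Kt \<theta> 1) (Kt \<theta> 2) = Dtwist \<theta> (commutator (K 1) (K 2))"
    using tbracket_Dtwist[OF weight_map_K weight_map_K, of 1 2 \<theta>] by (simp add: Kt_def)
  show "tbracket \<theta> (Kt \<theta> j) (Wt \<theta> r) = Dtwist \<theta> (commutator (K j) (W r))"
    if "j \<in> {1, 2}" "r \<in> Roots" for j r
    using tbracket_Dtwist[OF weight_map_K[OF that(1)] weight_map_W[OF that(2)], of \<theta>]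
    by (simp add: Kt_def Wt_def)
  show "tbracket \<theta> (Wt \<theta> r) (Wt \<theta> s) =
      (\<lambda>a. exp (- (\<i> * of_real (pi * \<theta> * wedge r s))) *\<^sub>C Dtwist \<theta> (commutator (W r) (W s)) a)"
    if "r \<in> Roots" "s \<in> Roots" for r s
    unfolding Wt_def tbracket_Dtwist[OF weight_map_W[OF that(1)] weight_map_W[OF that(2)]] Fbar_def
    by (simp only: mult.commute)
  show "tbracket \<theta> (tmod \<theta> b X) (tmod \<theta> b' X') =
      (\<lambda>a. Sum_any (\<lambda>s. Sum_any (\<lambda>r.
         Rmat \<theta> r s *\<^sub>C tmod \<theta> (b \<star>\<^bsub>\<theta>\<^esub> wpart b' s) (tbracket \<theta> (mpart X r) X') a)))"
    if "X \<in> aut \<theta>" "X' \<in> aut \<theta>" "b \<in> OS4" "b' \<in> OS4" for X X' b b'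
    using tbracket_tmod[OF that] by blast
qed


end
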